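(* Let $\mathcal{S}_1 \subset \mathcal{G}_1$ and $\mathcal{S}_2 \subset \mathcal{G}_2$ be higher rank numerical semigroups. Then the following are equivalent: (i) $\mathcal{S}_1 \simeq \mathcal{S}_2$ (as semigroups); (ii) $\mathcal{A}(\mathcal{S}_1) \simeq \mathcal{A}(\mathcal{S}_2)$ by a completely isometric isomorphism; (iii) $\mathcal{A}(\mathcal{S}_1) \simeq \mathcal{A}(\mathcal{S}_2)$ by an algebraic isomorphism.
   Context: $\mathbb{N}=\{1,2,\dots\}$ and $\mathbb{Z}_+=\{0,1,2,\dots\}$. A positive cone $\mathcal{S}$ of an abelian group $\mathcal{G}$ is a unital sub-semigroup (i.e. containing $0$) of $\mathcal{G}$ such that (1) $\mathcal{S}\cap(-\mathcal{S})=\{0\}$, and (2) for every $g\in\mathcal{G}$ there are $s,t\in\mathcal{S}$ with $g=s-t$. Its seminormalization is $\mathcal{S}_{\mathrm{sn}}:=\{g\in\mathcal{G} \mid ng\in\mathcal{S} \text{ eventually for } n\in\mathbb{N}\}$, where "eventually" means that there is $N\in\mathbb{N}$ with $ng\in\mathcal{S}$ for all $n\ge N$. A positive cone $\mathcal{S}$ of a group $\mathcal{G}$ is a higher rank numerical semigroup if $\mathcal{S}_{\mathrm{sn}}$ is isomorphic as a semigroup to $\mathbb{Z}_+^d$ for some $d\in\mathbb{N}$ (the $d$'s of $\mathcal{S}_1$ and $\mathcal{S}_2$ are not assumed equal). The Fock representation $V:\mathcal{S}\to\mathcal{B}(\ell^2(\mathcal{S}))$ is given on the canonical orthonormal basis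 by $V_s e_t=e_{s+t}$, and $\mathcal{A}(\mathcal{S})$ is the norm-closed subalgebra of $\mathcal{B}(\ell^2(\mathcal{S}))$ generated by $\{V_s \mid s\in\mathcal{S}\}$, with the operator algebra structure inherited from $\mathcal{B}(\ell^2(\mathcal{S}))$. An algebraic isomorphism is a bijective algebra homomorphism (no continuity assumed); a completely isometric isomorphism is a bijective algebra homomorphism all of whose matrix amplifications are isometric. *)

theory Defs
  imports "HOL-Analysis.Analysis" "HOL-Library.Function_Algebras"
begin

section \<open>Higher rank numerical semigroups\<close>

text \<open>The ambient abelian group is the whole type \<open>'a\<close>. Sums, differences and the zero of
  functions below are the pointwise ones of \<^theory>\<open>HOL-Library.Function_Algebras\<close>.\<close>

definition positive_cone :: "'a::ab_group_add set \<Rightarrow> bool" where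
  "positive_cone S \<longleftrightarrow>
     0 \<in> S \<and> (\<forall>s\<in>S. \<forall>t\<in>S. s + t \<in> S) \<and>
     S \<inter> uminus ` S = {0} \<and>
     (\<forall>g. \<exists>s\<in>S. \<exists>t\<in>S. g = s - t)"

definition seminormalization :: "'a::ab_group_add set \<Rightarrow> 'a set" where
  "seminormalization S = {g. \<forall>\<^sub>F n in sequentially. (\<Sum>i<n. g) \<in> S}"

definition semigroup_isomorphic :: "'a::plus set \<Rightarrow> 'b::plus set \<Rightarrow> bool" where
  "semigroup_isomorphic S T \<longleftrightarrow>
     (\<exists>h. bij_betw h S T \<and> (\<forall>s\<in>S. \<forall>t\<in>S. h (s + t) = h s + h t))"

text \<open>\<open>\<int>\<^sub>+\<^sup>d\<close>, a tuple being extended by zero beyond its \<open>d\<close> coordinates.\<close>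

definition nat_tuples :: "nat \<Rightarrow> (nat \<Rightarrow> nat) set" where
  "nat_tuples d = {v. \<forall>i\<ge>d. v i = 0}"

definition higher_rank_numerical_semigroup :: "'a::ab_group_add set \<Rightarrow> bool" where
  "higher_rank_numerical_semigroup S \<longleftrightarrow>
     positive_cone S \<and> (\<exists>d\<ge>1. semigroup_isomorphic (seminormalization S) (nat_tuples d))"


section \<open>Operators on \<open>\<ell>\<^sup>2(S)\<close>\<close>

text \<open>Vectors of \<open>\<ell>\<^sup>2(S)\<close> are functions on the whole group that vanish off \<open>S\<close>.\<close>

definition ell2 :: "'a set \<Rightarrow> ('a \<Rightarrow> complex) set" where
  "ell2 S = {f. (\<forall>x. x \<notin> S \<longrightarrow> f x = 0) \<and> (\<lambda>x. (cmod (f x))\<^sup>2) summable_on S}"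

definition ell2_norm :: "'a set \<Rightarrow> ('a \<Rightarrow> complex) \<Rightarrow> real" where
  "ell2_norm S f = sqrt (\<Sum>\<^sub>\<infinity>x\<in>S. (cmod (f x))\<^sup>2)"

definition basis_vec :: "'a \<Rightarrow> 'a \<Rightarrow> complex" where
  "basis_vec t = (\<lambda>x. if x = t then 1 else 0)"

type_synonym 'a l2op = "('a \<Rightarrow> complex) \<Rightarrow> ('a \<Rightarrow> complex)"

text \<open>\<open>\<B>(\<ell>\<^sup>2(S))\<close>. Operators take the value \<open>0\<close> outside \<open>\<ell>\<^sup>2(S)\<close>, so that
  equality of operators is equality of functions and the algebra operations are pointwise
  addition, pointwise scaling and composition.\<close>

definition bounded_ops :: "'a set \<Rightarrow> 'a l2op set" where
  "bounded_ops S = {T.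
     (\<forall>f\<in>ell2 S. T f \<in> ell2 S) \<and>
     (\<forall>f. f \<notin> ell2 S \<longrightarrow> T f = 0) \<and>
     (\<forall>f\<in>ell2 S. \<forall>g\<in>ell2 S. T (f + g) = T f + T g) \<and>
     (\<forall>c. \<forall>f\<in>ell2 S. T (\<lambda>x. c * f x) = (\<lambda>x. c * T f x)) \<and>
     (\<exists>K. \<forall>f\<in>ell2 S. ell2_norm S (T f) \<le> K * ell2_norm S f)}"

definition op_scale :: "complex \<Rightarrow> 'a l2op \<Rightarrow> 'a l2op" where
  "op_scale c T = (\<lambda>f x. c * T f x)"

definition op_norm :: "'a set \<Rightarrow> 'a l2op \<Rightarrow> real" where
  "op_norm S T = Sup {ell2_norm S (T f) | f. f \<in> ell2 S \<and> ell2_norm S f \<le> 1}"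

text \<open>The norm of the \<open>n \<times> n\<close> operator matrix \<open>M\<close> acting on the Hilbert space direct sum
  \<open>\<ell>\<^sup>2(S)\<^sup>n\<close>; only the entries \<open>M i j\<close> with \<open>i, j < n\<close> matter.\<close>

definition matrix_op_norm :: "'a set \<Rightarrow> nat \<Rightarrow> (nat \<Rightarrow> nat \<Rightarrow> 'a l2op) \<Rightarrow> real" where
  "matrix_op_norm S n M =
     Sup {sqrt (\<Sum>i<n. (ell2_norm S (\<Sum>j<n. M i j (F j)))\<^sup>2) | F.
            (\<forall>j<n. F j \<in> ell2 S) \<and> sqrt (\<Sum>j<n. (ell2_norm S (F j))\<^sup>2) \<le> 1}"

definition subalgebra :: "'a set \<Rightarrow> 'a l2op set \<Rightarrow> bool" where
  "subalgebra S A \<longleftrightarrow>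
     A \<subseteq> bounded_ops S \<and> 0 \<in> A \<and>
     (\<forall>T\<in>A. \<forall>U\<in>A. T + U \<in> A) \<and>
     (\<forall>c. \<forall>T\<in>A. op_scale c T \<in> A) \<and>
     (\<forall>T\<in>A. \<forall>U\<in>A. T \<circ> U \<in> A)"

definition norm_closed :: "'a set \<Rightarrow> 'a l2op set \<Rightarrow> bool" where
  "norm_closed S A \<longleftrightarrow>
     (\<forall>T\<in>bounded_ops S. \<forall>X. (\<forall>n::nat. X n \<in> A) \<and>
        (\<lambda>n. op_norm S (X n - T)) \<longlonglongrightarrow> 0 \<longrightarrow> T \<in> A)"


section \<open>The Fock representation and its operator algebra\<close>

text \<open>For \<open>f\<close> in \<open>\<ell>\<^sup>2(S)\<close> and \<open>s\<close> in \<open>S\<close>, the value \<open>f (x - s)\<close> is \<open>0\<close> unless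
  \<open>x\<close> lies in \<open>s + S\<close>. The lemmas \<open>fock_basis_vec\<close>, \<open>fock_bounded\<close> and
  \<open>bounded_ops_eqI\<close> below show that this is the unique bounded operator mapping
  \<open>e\<^sub>t\<close> to \<open>e\<^sub>s\<^sub>+\<^sub>t\<close> for all \<open>t\<close> in \<open>S\<close>.\<close>

definition fock :: "'a::ab_group_add set \<Rightarrow> 'a \<Rightarrow> 'a l2op" where
  "fock S s = (\<lambda>f. if f \<in> ell2 S then (\<lambda>x. f (x - s)) else 0)"

definition fock_algebra :: "'a::ab_group_add set \<Rightarrow> 'a l2op set" where
  "fock_algebra S = \<Inter> {A. subalgebra S A \<and> norm_closed S A \<and> fock S ` S \<subseteq> A}"

definition algebra_iso :: "'a l2op set \<Rightarrow> 'b l2op set \<Rightarrow> ('a l2op \<Rightarrow> 'b l2op) \<Rightarrow> bool" where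
  "algebra_iso A B \<phi> \<longleftrightarrow>
     bij_betw \<phi> A B \<and>
     (\<forall>T\<in>A. \<forall>U\<in>A. \<phi> (T + U) = \<phi> T + \<phi> U) \<and>
     (\<forall>c. \<forall>T\<in>A. \<phi> (op_scale c T) = op_scale c (\<phi> T)) \<and>
     (\<forall>T\<in>A. \<forall>U\<in>A. \<phi> (T \<circ> U) = \<phi> T \<circ> \<phi> U)"

definition completely_isometric ::
  "'a set \<Rightarrow> 'b set \<Rightarrow> 'a l2op set \<Rightarrow> ('a l2op \<Rightarrow> 'b l2op) \<Rightarrow> bool" where
  "completely_isometric S1 S2 A \<phi> \<longleftrightarrow>
     (\<forall>n\<ge>1. \<forall>M. (\<forall>i<n. \<forall>j<n. M i j \<in> A) \<longrightarrow>
        matrix_op_norm S2 n (\<lambda>i j. \<phi> (M i j)) = matrix_op_norm S1 n M)"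


section \<open>Sanity checks\<close>

lemma ell2_zero: "0 \<in> ell2 S"
  by (simp add: ell2_def)

lemma ell2_scale:
  assumes "f \<in> ell2 S"
  shows "(\<lambda>x. c * f x) \<in> ell2 S" "ell2_norm S (\<lambda>x. c * f x) = cmod c * ell2_norm S f"
  using assms
  by (auto simp: ell2_def ell2_norm_def norm_mult power_mult_distrib real_sqrt_mult
      infsum_cmult_right intro!: summable_on_cmult_right)

lemma ell2_norm_nonneg: "0 \<le> ell2_norm S f"
  by (simp add: ell2_norm_def infsum_nonneg)

lemma cmod_add_sq: "(cmod (a + b))\<^sup>2 \<le> 2 * (cmod a)\<^sup>2 + 2 * (cmod b)\<^sup>2"
proof -
  have "(cmod (a + b))\<^sup>2 \<le> (cmod a + cmod b)\<^sup>2"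
    by (intro power_mono norm_triangle_ineq) simp
  also have "\<dots> \<le> 2 * (cmod a)\<^sup>2 + 2 * (cmod b)\<^sup>2"
    using zero_le_power2[of "cmod a - cmod b"] by (simp add: power2_eq_square algebra_simps)
  finally show ?thesis .
qed

lemma ell2_add:
  assumes "f \<in> ell2 S" "g \<in> ell2 S"
  shows "f + g \<in> ell2 S"
    and "ell2_norm S (f + g) \<le> 2 * (ell2_norm S f + ell2_norm S g)"
proof -
  let ?q = "\<lambda>f x. (cmod (f x))\<^sup>2"
  have s: "?q f summable_on S" "?q g summable_on S"
    using assms by (auto simp: ell2_def)
  have s2: "(\<lambda>x. 2 * ?q f x + 2 * ?q g x) summable_on S"
    by (intro summable_on_add summable_on_cmult_right s)
  have s3: "?q (f + g) summable_on S"
    by (rule summable_on_comparison_test[OF s2]) (auto simp: cmod_add_sq)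
  then show "f + g \<in> ell2 S"
    using assms by (auto simp: ell2_def)
  have "infsum (?q (f + g)) S \<le> (\<Sum>\<^sub>\<infinity>x\<in>S. 2 * ?q f x + 2 * ?q g x)"
    by (rule infsum_mono[OF s3 s2]) (simp add: cmod_add_sq)
  also have "\<dots> = 2 * infsum (?q f) S + 2 * infsum (?q g) S"
    using s by (simp add: infsum_add infsum_cmult_right summable_on_cmult_right)
  also have "\<dots> = 2 * (ell2_norm S f)\<^sup>2 + 2 * (ell2_norm S g)\<^sup>2"
    by (simp add: ell2_norm_def infsum_nonneg)
  also have "\<dots> \<le> (2 * (ell2_norm S f + ell2_norm S g))\<^sup>2"
    using ell2_norm_nonneg[of S f] ell2_norm_nonneg[of S g]
    by (simp add: power2_eq_square algebra_simps)
  finally show "ell2_norm S (f + g) \<le> 2 * (ell2_norm S f + ell2_norm S g)"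
    unfolding ell2_norm_def[of S "f + g"]
    by (intro real_le_lsqrt) (use ell2_norm_nonneg[of S f] ell2_norm_nonneg[of S g] in auto)
qed

lemma basis_vec_ell2: "t \<in> S \<Longrightarrow> basis_vec t \<in> ell2 S"
proof -
  assume "t \<in> S"
  have "(\<lambda>x. (cmod (basis_vec t x))\<^sup>2) summable_on S
      \<longleftrightarrow> (\<lambda>x. (cmod (basis_vec t x))\<^sup>2) summable_on {t}"
    using \<open>t \<in> S\<close> by (intro summable_on_cong_neutral) (auto simp: basis_vec_def)
  then show ?thesis
    using \<open>t \<in> S\<close> by (auto simp: ell2_def basis_vec_def)
qed

lemma fock_basis_vec: "t \<in> S \<Longrightarrow> fock S s (basis_vec t) = basis_vec (s + t)"
  by (auto simp: fock_def basis_vec_ell2) (auto simp: basis_vec_def fun_eq_iff algebra_simps)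

lemma shift_ell2:
  fixes S :: "'a::ab_group_add set"
  assumes S: "\<forall>s\<in>S. \<forall>t\<in>S. s + t \<in> S" and s: "s \<in> S" and f: "f \<in> ell2 S"
  shows "(\<lambda>x. f (x - s)) \<in> ell2 S" "ell2_norm S (\<lambda>x. f (x - s)) = ell2_norm S f"
proof -
  let ?h = "\<lambda>x. (cmod (f x))\<^sup>2"
  have z: "f x = 0" if "x \<notin> S" for x
    using f that by (simp add: ell2_def)
  have bij: "bij_betw (\<lambda>x. x + s) S ((\<lambda>x. x + s) ` S)"
    by (simp add: bij_betw_def inj_on_def)
  have sub: "(\<lambda>x. x + s) ` S \<subseteq> S"
    using S s by auto
  have z': "f (x - s) = 0" if "x \<notin> (\<lambda>x. x + s) ` S" for x
  proof (rule z)
    show "x - s \<notin> S"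
      using that by (metis diff_add_cancel image_eqI)
  qed
  have "(\<lambda>x. ?h (x - s)) summable_on S \<longleftrightarrow> (\<lambda>x. ?h (x - s)) summable_on (\<lambda>x. x + s) ` S"
    using sub by (intro summable_on_cong_neutral) (auto simp: z')
  also have "\<dots> \<longleftrightarrow> ?h summable_on S"
    using summable_on_reindex_bij_betw[OF bij, of "\<lambda>x. ?h (x - s)"] by simp
  finally show "(\<lambda>x. f (x - s)) \<in> ell2 S"
    using f z' sub by (auto simp: ell2_def)
  have "infsum (\<lambda>x. ?h (x - s)) S = infsum (\<lambda>x. ?h (x - s)) ((\<lambda>x. x + s) ` S)"
    using sub by (intro infsum_cong_neutral) (auto simp: z')
  also have "\<dots> = infsum ?h S"
    using infsum_reindex_bij_betw[OF bij, of "\<lambda>x. ?h (x - s)"] by simp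
  finally show "ell2_norm S (\<lambda>x. f (x - s)) = ell2_norm S f"
    by (simp add: ell2_norm_def)
qed

lemma fock_bounded:
  assumes "positive_cone S" "s \<in> S"
  shows "fock S s \<in> bounded_ops S"
proof -
  have S: "\<forall>s\<in>S. \<forall>t\<in>S. s + t \<in> S"
    using assms by (simp add: positive_cone_def)
  note sh = shift_ell2[OF S assms(2)]
  show ?thesis
    unfolding bounded_ops_def
    by (auto simp: fock_def sh ell2_add ell2_scale fun_eq_iff intro!: exI[of _ 1])
qed

lemma bounded_ops_bound:
  assumes "T \<in> bounded_ops S"
  obtains K where "\<And>f. f \<in> ell2 S \<Longrightarrow> ell2_norm S (T f) \<le> K * ell2_norm S f"
  using assms unfolding bounded_ops_def by blast

lemma bounded_ops_subalgebra: "subalgebra S (bounded_ops S)"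
proof -
  have zero: "0 \<in> bounded_ops S"
    by (auto simp: bounded_ops_def ell2_zero fun_eq_iff intro!: exI[of _ 0])
       (simp add: ell2_norm_def)
  have add: "T + U \<in> bounded_ops S" if T: "T \<in> bounded_ops S" and U: "U \<in> bounded_ops S" for T U
  proof -
    obtain K where K: "\<And>f. f \<in> ell2 S \<Longrightarrow> ell2_norm S (T f) \<le> K * ell2_norm S f"
      using bounded_ops_bound[OF T] by blast
    obtain L where L: "\<And>f. f \<in> ell2 S \<Longrightarrow> ell2_norm S (U f) \<le> L * ell2_norm S f"
      using bounded_ops_bound[OF U] by blast
    have "ell2_norm S (T f + U f) \<le> (2 * (K + L)) * ell2_norm S f" if f: "f \<in> ell2 S" for f
    proof -
      have "ell2_norm S (T f + U f) \<le> 2 * (ell2_norm S (T f) + ell2_norm S (U f))"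
        using T U f by (intro ell2_add) (auto simp: bounded_ops_def)
      then show ?thesis
        using K[OF f] L[OF f] by (simp add: algebra_simps)
    qed
    then have "\<exists>K. \<forall>f\<in>ell2 S. ell2_norm S (T f + U f) \<le> K * ell2_norm S f"
      by blast
    then show ?thesis
      using T U by (auto simp: bounded_ops_def ell2_add fun_eq_iff algebra_simps)
  qed
  have scale: "op_scale c T \<in> bounded_ops S" if T: "T \<in> bounded_ops S" for c T
  proof -
    obtain K where K: "\<And>f. f \<in> ell2 S \<Longrightarrow> ell2_norm S (T f) \<le> K * ell2_norm S f"
      using bounded_ops_bound[OF T] by blast
    have "ell2_norm S (\<lambda>x. c * T f x) \<le> (cmod c * K) * ell2_norm S f" if f: "f \<in> ell2 S" for f
      using T f K[OF f] by (auto simp: bounded_ops_def ell2_scale mult.assoc intro!: mult_left_mono)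
    then have "\<exists>K. \<forall>f\<in>ell2 S. ell2_norm S (\<lambda>x. c * T f x) \<le> K * ell2_norm S f"
      by blast
    then show ?thesis
      using T by (auto simp: bounded_ops_def op_scale_def ell2_scale fun_eq_iff algebra_simps)
  qed
  have comp: "T \<circ> U \<in> bounded_ops S" if T: "T \<in> bounded_ops S" and U: "U \<in> bounded_ops S" for T U
  proof -
    obtain K where K: "\<And>f. f \<in> ell2 S \<Longrightarrow> ell2_norm S (T f) \<le> K * ell2_norm S f"
      using bounded_ops_bound[OF T] by blast
    obtain L where L: "\<And>f. f \<in> ell2 S \<Longrightarrow> ell2_norm S (U f) \<le> L * ell2_norm S f"
      using bounded_ops_bound[OF U] by blast
    have "ell2_norm S (T (U f)) \<le> (\<bar>K\<bar> * L) * ell2_norm S f" if f: "f \<in> ell2 S" for f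
    proof -
      have Uf: "U f \<in> ell2 S"
        using U f by (auto simp: bounded_ops_def)
      have "ell2_norm S (T (U f)) \<le> \<bar>K\<bar> * ell2_norm S (U f)"
        using K[OF Uf] mult_right_mono[OF abs_ge_self[of K] ell2_norm_nonneg[of S "U f"]]
        by linarith
      also have "\<dots> \<le> \<bar>K\<bar> * (L * ell2_norm S f)"
        by (intro mult_left_mono L f) simp
      finally show ?thesis
        by (simp add: mult.assoc)
    qed
    then have "\<exists>K. \<forall>f\<in>ell2 S. ell2_norm S (T (U f)) \<le> K * ell2_norm S f"
      by blast
    moreover have "T 0 = 0"
    proof -
      have "T (0 + 0) = T 0 + T 0"
        using T ell2_zero unfolding bounded_ops_def by blast
      then show ?thesis by simp
    qed
    ultimately show ?thesis
      using T U by (auto simp: bounded_ops_def)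
  qed
  show ?thesis
    using zero add scale comp by (auto simp: subalgebra_def)
qed

lemma fock_algebra_subset: "positive_cone S \<Longrightarrow> fock_algebra S \<subseteq> bounded_ops S"
  unfolding fock_algebra_def
  by (intro Inter_lower) (auto simp: bounded_ops_subalgebra norm_closed_def fock_bounded)

lemma cmod_le_ell2_norm:
  assumes "f \<in> ell2 S"
  shows "cmod (f x) \<le> ell2_norm S f"
proof (cases "x \<in> S")
  case True
  have "(\<Sum>y\<in>{x}. (cmod (f y))\<^sup>2) \<le> (\<Sum>\<^sub>\<infinity>y\<in>S. (cmod (f y))\<^sup>2)"
    using assms True by (intro finite_sum_le_infsum) (auto simp: ell2_def)
  then show ?thesis
    by (simp add: ell2_norm_def real_le_rsqrt)
next
  case False
  then show ?thesis
    using assms ell2_norm_nonneg[of S f] by (simp add: ell2_def)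
qed

lemma ell2_finite_support_approx:
  assumes f: "f \<in> ell2 S" and e: "e > 0"
  obtains F where "finite F" "F \<subseteq> S" "ell2_norm S (\<lambda>x. if x \<in> F then 0 else f x) \<le> e"
    "(\<lambda>x. if x \<in> F then 0 else f x) \<in> ell2 S"
proof -
  let ?h = "\<lambda>x. (cmod (f x))\<^sup>2"
  have sm: "?h summable_on S"
    using f by (simp add: ell2_def)
  obtain F where F: "finite F" "F \<subseteq> S" "dist (sum ?h F) (infsum ?h S) \<le> e\<^sup>2"
    using infsum_finite_approximation[OF sm, of "e\<^sup>2"] e by auto
  let ?g = "\<lambda>x. if x \<in> F then 0 else f x"
  have sF: "?h summable_on (S - F)"
    by (rule summable_on_subset_banach[OF sm]) auto
  have gS: "(\<lambda>x. (cmod (?g x))\<^sup>2) summable_on S \<longleftrightarrow> ?h summable_on (S - F)"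
    by (intro summable_on_cong_neutral) auto
  have "infsum (\<lambda>x. (cmod (?g x))\<^sup>2) S = infsum ?h (S - F)"
    by (intro infsum_cong_neutral) auto
  also have "\<dots> = infsum ?h S - sum ?h F"
  proof -
    have "infsum ?h (F \<union> (S - F)) = infsum ?h F + infsum ?h (S - F)"
      by (rule infsum_Un_disjoint) (use F sF in auto)
    moreover have "F \<union> (S - F) = S"
      using F by auto
    ultimately show ?thesis
      using F by simp
  qed
  also have "\<dots> \<le> e\<^sup>2"
    using F(3) by (simp add: dist_real_def)
  finally have "ell2_norm S ?g \<le> e"
    unfolding ell2_norm_def using e by (intro real_le_lsqrt) auto
  moreover have "?g \<in> ell2 S"
    using f sF gS by (auto simp: ell2_def)
  ultimately show ?thesis
    using that F by blast
qed

lemma bounded_ops_eqI: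
  assumes T: "T \<in> bounded_ops S" and U: "U \<in> bounded_ops S"
    and eq: "\<And>t. t \<in> S \<Longrightarrow> T (basis_vec t) = U (basis_vec t)"
  shows "T = U"
proof -
  define D where "D = T + op_scale (-1) U"
  have D: "D \<in> bounded_ops S"
    using bounded_ops_subalgebra[of S] T U by (auto simp: D_def subalgebra_def)
  have D0: "D (basis_vec t) = 0" if "t \<in> S" for t
    using eq[OF that] by (simp add: D_def op_scale_def fun_eq_iff)
  obtain K where K: "\<And>f. f \<in> ell2 S \<Longrightarrow> ell2_norm S (D f) \<le> K * ell2_norm S f"
    using bounded_ops_bound[OF D] by blast
  have Dadd: "D (f + g) = D f + D g" if "f \<in> ell2 S" "g \<in> ell2 S" for f g
    using D that by (auto simp: bounded_ops_def)
  have Dscale: "D (\<lambda>x. c * f x) = (\<lambda>x. c * D f x)" if "f \<in> ell2 S" for c f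
    using D that by (auto simp: bounded_ops_def)
  have fin: "(\<lambda>x. if x \<in> F then f x else 0) \<in> ell2 S \<and> D (\<lambda>x. if x \<in> F then f x else 0) = 0"
    if "finite F" "F \<subseteq> S" for F f
    using that
  proof (induction F rule: finite_induct)
    case empty
    have "D (0 + 0) = D 0 + D 0"
      by (intro Dadd ell2_zero)
    then have "D 0 = 0" by simp
    then show ?case
      using ell2_zero[of S] by (simp add: zero_fun_def)
  next
    case (insert a F)
    have split: "(\<lambda>x. if x \<in> insert a F then f x else 0)
        = (\<lambda>x. f a * basis_vec a x) + (\<lambda>x. if x \<in> F then f x else 0)"
      using insert.hyps by (auto simp: fun_eq_iff basis_vec_def)
    have a: "basis_vec a \<in> ell2 S"
      using insert.prems by (simp add: basis_vec_ell2)
    have "D (\<lambda>x. f a * basis_vec a x) = 0"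
      using insert.prems by (simp add: Dscale[OF a] D0 fun_eq_iff)
    then show ?case
      unfolding split using insert ell2_scale(1)[OF a] by (simp add: Dadd ell2_add)
  qed
  have small: "cmod (D f x) \<le> \<bar>K\<bar> * e" if f: "f \<in> ell2 S" and e: "e > 0" for f x e
  proof -
    obtain F where F: "finite F" "F \<subseteq> S" "ell2_norm S (\<lambda>x. if x \<in> F then 0 else f x) \<le> e"
      and g: "(\<lambda>x. if x \<in> F then 0 else f x) \<in> ell2 S"
      using ell2_finite_support_approx[OF f e] by blast
    let ?g = "\<lambda>x. if x \<in> F then 0 else f x"
    have "f = (\<lambda>x. if x \<in> F then f x else 0) + ?g"
      by (auto simp: fun_eq_iff)
    then have "D f = D ?g"
      using Dadd[OF _ g] fin[OF F(1,2), of f] by (metis add_0)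
    moreover have "D ?g \<in> ell2 S"
      using D g by (auto simp: bounded_ops_def)
    ultimately have "cmod (D f x) \<le> ell2_norm S (D ?g)"
      using cmod_le_ell2_norm by metis
    also have "\<dots> \<le> \<bar>K\<bar> * ell2_norm S ?g"
      using K[OF g] mult_right_mono[OF abs_ge_self[of K] ell2_norm_nonneg[of S ?g]] by linarith
    also have "\<dots> \<le> \<bar>K\<bar> * e"
      by (intro mult_left_mono F(3)) simp
    finally show ?thesis .
  qed
  have "D f x = 0" if f: "f \<in> ell2 S" for f x
  proof (rule ccontr)
    assume "D f x \<noteq> 0"
    then have p: "cmod (D f x) > 0" by simp
    have "\<bar>K\<bar> * (cmod (D f x) / (2 * (\<bar>K\<bar> + 1))) < cmod (D f x)"
      using p by (simp add: field_simps add_nonneg_pos)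
    moreover have "cmod (D f x) \<le> \<bar>K\<bar> * (cmod (D f x) / (2 * (\<bar>K\<bar> + 1)))"
      using p by (intro small f) (simp add: add_nonneg_pos)
    ultimately show False by linarith
  qed
  then have "T f x = U f x" if "f \<in> ell2 S" for f x
    using that by (simp add: D_def op_scale_def)
  moreover have "T f = U f" if "f \<notin> ell2 S" for f
    using T U that by (simp add: bounded_ops_def)
  ultimately show ?thesis
    by (metis ext)
qed

end

theory Submission
  imports Defs "HOL-Complex_Analysis.Complex_Analysis"
begin

text \<open>
  The first step is to see \<open>\<A>(S)\<close> as an algebra of functions on the open polydisc. Choose
  coordinates in which the seminormalization of \<open>S\<close> is \<open>\<int>\<^sub>+\<^sup>d\<close>. Then \<open>S\<close> becomes a submonoid
  of \<open>\<int>\<^sub>+\<^sup>d\<close> that contains all large multiples of each unit vector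
  (\<open>higher_rank_coordinates\<close>). An operator \<open>T\<close> in \<open>\<A>(S)\<close> acts as multiplication by the power
  series \<open>ev z T\<close> whose coefficients are the entries of \<open>T e\<^sub>0\<close> (\<open>transform_apply\<close>), so its
  exponents lie in \<open>S\<close>. Conversely, every character of \<open>\<A>(S)\<close> is contractive, by a Neumann
  series, and its values at the generators are the monomials at a point of the closed polydisc
  (\<open>character_point\<close>): the \<open>i\<close>-th coordinate of that point is the quotient of the values at
  \<open>n + 1\<close> times and \<open>n\<close> times the \<open>i\<close>-th unit vector.

  An algebraic isomorphism \<open>\<phi>\<close> from \<open>\<A>(S\<^sub>1)\<close> to \<open>\<A>(S\<^sub>2)\<close> pulls characters back, so it induces a
  map \<open>f\<close> between polydiscs with \<open>ev z (\<phi> T) = ev (f z) T\<close>. The maximum modulus principle keeps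
  \<open>f\<close> inside the open polydisc, and \<open>f\<close> is biholomorphic because \<open>\<phi>\<close> is invertible
  (\<open>algebra_iso_point_map\<close>). The Schwarz lemma then forces the classical form: for a bijection \<open>p\<close>
  of the coordinates, \<open>f z (p j) = m\<^sub>j (z\<^sub>j)\<close> with automorphisms \<open>m\<^sub>j\<close> of the disc
  (\<open>polydisc_biholomorphism_splits\<close>). Hence \<open>\<phi>\<close> sends the generator with exponent \<open>x\<close> to the
  function \<open>\<Prod>\<^sub>j m\<^sub>j(z\<^sub>j)\<close> with the \<open>j\<close>-th factor raised to the power \<open>x (p j)\<close>.

  It remains to find the exponent \<open>(x (p j))\<^sub>j\<close> in \<open>S\<^sub>2\<close>, although some \<open>m\<^sub>j\<close> may move the origin
  (\<open>exponents_transfer\<close>). For such \<open>j\<close> a power of \<open>m\<^sub>j(z\<^sub>j)\<close> has a nonzero linear coefficient, so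
  the \<open>j\<close>-th unit vector itself belongs to \<open>S\<^sub>2\<close>. The image of the generator has a nonzero
  coefficient at the exponent that agrees with \<open>x (p j)\<close> where \<open>m\<^sub>j\<close> fixes the origin and is \<open>0\<close>
  elsewhere; adding multiples of the available unit vectors completes it. This gives a
  degree-preserving embedding of \<open>S\<^sub>1\<close> into \<open>S\<^sub>2\<close> by permuting coordinates, and the inverse of \<open>\<phi>\<close>
  gives one in the other direction; since there are only finitely many exponents of each degree,
  both are bijective (\<open>mutual_reindex_surj\<close>).

  Conversely, an isomorphism of semigroups permutes the orthonormal bases, and conjugation by the
  resulting unitary is a completely isometric isomorphism
  (\<open>semigroup_isomorphic_imp_completely_isometric\<close>).
\<close>

section \<open>Holomorphic maps between polydiscs\<close>

text \<open>Points of \<open>\<complex>\<^sup>d\<close> are sequences that vanish beyond their \<open>d\<close> coordinates, so that equality of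
  points is equality of functions and the dimension can vary.\<close>

definition polydisc :: "nat \<Rightarrow> (nat \<Rightarrow> complex) set" where
  "polydisc d = {z. (\<forall>i<d. cmod (z i) < 1) \<and> (\<forall>i\<ge>d. z i = 0)}"

definition analytic_disc :: "nat \<Rightarrow> (complex \<Rightarrow> nat \<Rightarrow> complex) \<Rightarrow> bool" where
  "analytic_disc d y \<longleftrightarrow>
     (\<forall>l\<in>ball 0 1. y l \<in> polydisc d) \<and> (\<forall>i. (\<lambda>l. y l i) holomorphic_on ball 0 1)"

text \<open>Every argument below restricts to a disc, so holomorphy in several variables is encoded as
  holomorphy along all analytic discs; the one-variable theorems then apply without further
  preparation.\<close>

definition disc_holomorphic :: "nat \<Rightarrow> ((nat \<Rightarrow> complex) \<Rightarrow> complex) \<Rightarrow> bool" where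
  "disc_holomorphic d u \<longleftrightarrow>
     (\<forall>y. analytic_disc d y \<longrightarrow> (\<lambda>l. u (y l)) holomorphic_on ball 0 1)"

lemma polydisc_norm_less: "z \<in> polydisc d \<Longrightarrow> cmod (z i) < 1"
  by (cases "i < d") (auto simp: polydisc_def)

lemma zero_in_polydisc: "0 \<in> polydisc d"
  by (simp add: polydisc_def)

text \<open>Where \<open>f\<close> does not vanish it is the quotient of its two powers. It is continuous at a zero
  because \<open>|f|\<close> is a root of the continuous function \<open>|f\<^sup>n|\<close>, and a zero of \<open>f\<^sup>n\<close> is isolated unless
  \<open>f\<close> vanishes nearby, so the singularities of that quotient are removable. The point is that the
  coordinate functions of the polydisc may be missing from \<open>\<A>(S)\<close> while their high powers are
  always there.\<close>

lemma holomorphic_from_consecutive_powers: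
  fixes f :: "complex \<Rightarrow> complex"
  assumes U: "open U" and n: "n \<ge> 1"
    and A: "(\<lambda>l. f l ^ n) holomorphic_on U" and B: "(\<lambda>l. f l ^ Suc n) holomorphic_on U"
  shows "f holomorphic_on U"
proof -
  define V where "V = {l \<in> U. f l \<noteq> 0}"
  have "V = {l \<in> U. f l ^ n \<in> - {0}}"
    using n by (auto simp: V_def)
  also have "\<dots> = U \<inter> (\<lambda>l. f l ^ n) -` (- {0})" by auto
  finally have "V = \<dots>" .
  moreover have "open \<dots>"
    by (intro continuous_open_preimage[OF holomorphic_on_imp_continuous_on[OF A] U]) auto
  ultimately have V: "open V" by simp
  have "(\<lambda>l. f l ^ Suc n / f l ^ n) holomorphic_on V"
    by (intro holomorphic_on_divide holomorphic_on_subset[OF A] holomorphic_on_subset[OF B])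
       (auto simp: V_def)
  then have hV: "f holomorphic_on V"
    by (rule holomorphic_transform) (auto simp: V_def)
  have cont: "isCont f p" if p: "p \<in> U" for p
  proof (cases "f p = 0")
    case False
    then show ?thesis
      using holomorphic_on_imp_continuous_on[OF hV] V p
      by (auto simp: V_def continuous_on_eq_continuous_at)
  next
    case True
    have "(\<lambda>l. f l ^ n) \<midarrow>p\<rightarrow> f p ^ n"
      using holomorphic_on_imp_continuous_on[OF A] U p
      by (simp add: continuous_on_eq_continuous_at isCont_def)
    then have "(\<lambda>l. root n (cmod (f l ^ n))) \<midarrow>p\<rightarrow> root n (cmod (f p ^ n))"
      by (intro tendsto_real_root tendsto_norm)
    then have "(\<lambda>l. cmod (f l)) \<midarrow>p\<rightarrow> cmod (f p)"
      using n by (simp add: norm_power real_root_power_cancel)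
    then show ?thesis
      using True by (simp add: isCont_def tendsto_norm_zero_iff)
  qed
  have "\<exists>r>0. f holomorphic_on ball p r" if p: "p \<in> U" for p
  proof -
    obtain r where r: "r > 0" "ball p r \<subseteq> U"
      using U p openE by blast
    show ?thesis
    proof (cases "f p \<noteq> 0")
      case True
      then obtain s where "s > 0" "ball p s \<subseteq> V"
        using V p openE[of V p] by (auto simp: V_def)
      then show ?thesis
        using hV holomorphic_on_subset by blast
    next
      case False
      show ?thesis
      proof (cases "\<forall>l\<in>ball p r. f l ^ n = 0")
        case True
        then have "f l = 0" if "l \<in> ball p r" for l
          using that by auto
        then have "f holomorphic_on ball p r"
          using holomorphic_transform[of "\<lambda>_. 0"] by (metis holomorphic_on_const)
        then show ?thesis using r by blast
      next
        case False
        then obtain b where b: "b \<in> ball p r" "f b ^ n \<noteq> 0" by blast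
        have "(\<lambda>l. f l ^ n) holomorphic_on ball p r"
          using A r holomorphic_on_subset by blast
        then obtain s where s: "s > 0" "ball p s \<subseteq> ball p r"
          "\<And>z. z \<in> ball p s - {p} \<Longrightarrow> f z ^ n \<noteq> 0"
          using isolated_zeros[of "\<lambda>l. f l ^ n" "ball p r" p b] b r n \<open>\<not> f p \<noteq> 0\<close>
          by (auto simp: power_0_left)
        have "ball p s - {p} \<subseteq> V"
          using s r n by (fastforce simp: V_def power_0_left)
        then have "f holomorphic_on ball p s"
          using s r cont
          by (intro no_isolated_singularity[of "ball p s" f "{p}"] holomorphic_on_subset[OF hV])
             (auto intro!: continuous_at_imp_continuous_on)
        then show ?thesis using s by blast
      qed
    qed
  qed
  then show ?thesis
    unfolding holomorphic_on_def
    by (meson centre_in_ball field_differentiable_at_within holomorphic_on_imp_differentiable_at open_ball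
        holomorphic_on_def at_within_open)
qed

lemma disc_holomorphic_compose_ball:
  assumes "disc_holomorphic d u" "\<And>z. z \<in> polydisc d \<Longrightarrow> cmod (u z) < 1"
    and "m holomorphic_on ball 0 1"
  shows "disc_holomorphic d (\<lambda>z. m (u z))"
proof -
  have "(m \<circ> (\<lambda>l. u (y l))) holomorphic_on ball 0 1" if "analytic_disc d y" for y
    using that assms by (intro holomorphic_on_compose_gen[where t = "ball 0 1"])
      (auto simp: disc_holomorphic_def analytic_disc_def)
  then show ?thesis by (auto simp: disc_holomorphic_def o_def)
qed

lemma holomorphic_if_const:
  assumes "P \<Longrightarrow> f holomorphic_on A" "\<not> P \<Longrightarrow> g holomorphic_on A"
  shows "(\<lambda>l. if P then f l else g l) holomorphic_on A"
  using assms by (cases P) auto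

lemma axis_disc: "j < d \<Longrightarrow> analytic_disc d (\<lambda>l k. if k = j then l else 0)"
  by (auto simp: analytic_disc_def polydisc_def intro: holomorphic_if_const)

lemma polydisc_radius:
  assumes z: "z \<in> polydisc d"
  obtains r :: real where "0 < r" "r < 1" "\<And>k. cmod (z k) \<le> r"
proof
  let ?r = "Max (insert (1/2) ((\<lambda>k. cmod (z k)) ` {..<d}))"
  show "?r < 1" using z by (auto simp: polydisc_def)
  have half: "1/2 \<le> ?r" by (intro Max_ge) auto
  then show "0 < ?r" by linarith
  show "cmod (z k) \<le> ?r" for k
  proof (cases "k < d")
    case True then show ?thesis by (intro Max_ge) auto
  next
    case False then show ?thesis using z half by (simp add: polydisc_def)
  qed
qed

lemma radial_disc:
  assumes z: "z \<in> polydisc d" and r: "0 < r" "\<And>k. cmod (z k) \<le> r"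
  shows "analytic_disc d (\<lambda>l k. (l / of_real r) * z k)"
  unfolding analytic_disc_def
proof (intro conjI ballI allI)
  fix l :: complex assume l: "l \<in> ball 0 1"
  have "cmod ((l / of_real r) * z k) \<le> cmod l" for k
    using r mult_left_mono[OF r(2)[of k] norm_ge_zero[of l]]
    by (simp add: norm_mult norm_divide field_simps)
  then have "cmod ((l / of_real r) * z k) < 1" for k
    using l by (meson le_less_trans mem_ball_0)
  then show "(\<lambda>k. (l / of_real r) * z k) \<in> polydisc d"
    using z unfolding polydisc_def by simp
qed (use r in \<open>auto intro!: holomorphic_intros\<close>)

text \<open>The one-variable Schwarz lemma on the radial disc through \<open>z\<close>.\<close>

lemma schwarz_polydisc:
  assumes u: "disc_holomorphic d u" "\<And>z. z \<in> polydisc d \<Longrightarrow> cmod (u z) < 1" "u 0 = 0"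
    and z: "z \<in> polydisc d" and r: "0 < r" "r < 1" "\<And>k. cmod (z k) \<le> r"
  shows "cmod (u z) \<le> r"
proof -
  define y where "y l k = (l / of_real r) * z k" for l :: complex and k
  have y: "analytic_disc d y" unfolding y_def[abs_def] by (rule radial_disc[OF z r(1,3)])
  have "y 0 = 0" by (auto simp: y_def fun_eq_iff)
  moreover have "y (of_real r) = z" using r by (auto simp: y_def fun_eq_iff)
  moreover have "cmod (u (y (of_real r))) \<le> cmod (of_real r)"
    using u y r calculation(1)
    by (intro Schwarz_Lemma(1)[of "\<lambda>l. u (y l)"]) (auto simp: disc_holomorphic_def analytic_disc_def)
  ultimately show ?thesis using r by simp
qed

text \<open>The hypothesis on \<open>u\<close> is the equality case of the Schwarz lemma on the \<open>j\<close>-th axis, so \<open>u\<close> is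
  linear there. Move from the axis into the polydisc with the \<open>j\<close>-th coordinate frozen at \<open>z\<^sub>j\<close>: as
  long as the other coordinates stay smaller than \<open>|z\<^sub>j|\<close>, the Schwarz estimate bounds \<open>|u|\<close> by its
  value on the axis, so the maximum modulus principle makes \<open>u\<close> constant in that direction.\<close>

lemma schwarz_rigidity_polydisc:
  assumes u: "disc_holomorphic d u" "\<And>z. z \<in> polydisc d \<Longrightarrow> cmod (u z) < 1" "u 0 = 0"
    and j: "j < d" and eq: "cmod (u (\<lambda>k. if k = j then 1/2 else 0)) \<ge> 1/2"
  obtains \<alpha> where "cmod \<alpha> = 1" "\<And>z. z \<in> polydisc d \<Longrightarrow> u z = \<alpha> * z j"
proof -
  let ?ax = "\<lambda>l k. if k = j then l else (0::complex)"
  have ax0: "?ax 0 = 0" by auto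
  have inpd: "?ax l \<in> polydisc d" if "cmod l < 1" for l
    using axis_disc[OF j] that by (auto simp: analytic_disc_def)
  have hol: "(\<lambda>l. u (?ax l)) holomorphic_on ball 0 1"
    using u(1) axis_disc[OF j] by (auto simp: disc_holomorphic_def)
  note S = Schwarz_Lemma[OF hol, where \<xi> = "1/2"]
  have z0: "u (?ax 0) = 0" using u(3) ax0 by simp
  have le: "cmod (u (?ax (1/2))) \<le> 1/2"
    using S(1) z0 u(2) inpd by simp
  then have "cmod (u (?ax (1/2))) = cmod (1/2)" using eq by simp
  then have "\<exists>z. cmod z < 1 \<and> z \<noteq> 0 \<and> cmod (u (?ax z)) = cmod z"
    by (intro exI[of _ "1/2"]) simp
  then obtain \<alpha> where \<alpha>: "\<And>l. cmod l < 1 \<Longrightarrow> u (?ax l) = \<alpha> * l" "cmod \<alpha> = 1"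
    using S(3) z0 u(2) inpd by auto
  have nz: "u z = \<alpha> * z j" if z: "z \<in> polydisc d" and zj: "z j \<noteq> 0" for z
  proof -
    obtain \<rho> where \<rho>0: "0 < \<rho>" and \<rho>1: "\<rho> < 1" and \<rho>_ge: "\<And>k. cmod (z k) \<le> \<rho>"
      using polydisc_radius[OF z] by blast
    \<comment> \<open>The parameter \<open>l = \<rho>\<close> gives \<open>z\<close> and \<open>l = 0\<close> gives a point of the \<open>j\<close>-th axis.\<close>
    define y where "y l k = (if k = j then z j else (l / of_real \<rho>) * z k)" for l :: complex and k
    have yk: "cmod (y l k) \<le> cmod l" if "k \<noteq> j" for l k
      using that \<rho>0 mult_left_mono[OF \<rho>_ge[of k] norm_ge_zero[of l]]
      by (simp add: y_def norm_mult norm_divide field_simps)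
    have y: "analytic_disc d y"
      unfolding analytic_disc_def
    proof (intro conjI ballI allI)
      fix l :: complex assume l: "l \<in> ball 0 1"
      have "cmod (y l i) < 1" for i
        using l yk[of i l] polydisc_norm_less[OF z, of j] by (cases "i = j") (auto simp: y_def)
      then show "y l \<in> polydisc d"
        using z j by (auto simp: polydisc_def y_def)
    next
      show "(\<lambda>l. y l i) holomorphic_on ball 0 1" for i
        using \<rho>0 unfolding y_def by (cases "i = j") (auto intro!: holomorphic_intros)
    qed
    have y0: "y 0 = ?ax (z j)" by (auto simp: y_def fun_eq_iff)
    have uy0: "u (y 0) = \<alpha> * z j"
      unfolding y0 using \<alpha>(1)[of "z j"] polydisc_norm_less[OF z] by simp
    have bound: "cmod (u (y l)) \<le> cmod (u (y 0))" if l: "l \<in> ball 0 (cmod (z j))" for l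
    proof -
      have "cmod (y l k) \<le> cmod (z j)" for k
        using yk[of k l] l by (cases "k = j") (auto simp: y_def)
      then have "cmod (u (y l)) \<le> cmod (z j)"
        using y l zj polydisc_norm_less[OF z, of j]
        by (intro schwarz_polydisc[OF u]) (auto simp: analytic_disc_def)
      then show ?thesis by (simp add: uy0 norm_mult \<alpha>(2))
    qed
    have "(\<lambda>l. u (y l)) constant_on ball 0 1"
      using u(1) y zj polydisc_norm_less[OF z, of j] bound
      by (intro maximum_modulus_principle[where U = "ball 0 (cmod (z j))" and \<xi> = 0])
         (auto simp: disc_holomorphic_def)
    then have "u (y (of_real \<rho>)) = u (y 0)"
      using \<rho>0 \<rho>1 unfolding constant_on_def by auto
    moreover have "y (of_real \<rho>) = z"
      using \<rho>0 by (auto simp: y_def fun_eq_iff)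
    ultimately show ?thesis using uy0 by simp
  qed
  \<comment> \<open>If \<open>z j = 0\<close>, vary the \<open>j\<close>-th coordinate and use the nonzero values.\<close>
  have "u z = \<alpha> * z j" if z: "z \<in> polydisc d" for z
  proof (cases "z j = 0")
    case True
    define y where "y l k = (if k = j then l else z k)" for l :: complex and k
    have y: "analytic_disc d y"
      using z j by (auto simp: analytic_disc_def polydisc_def y_def intro!: holomorphic_if_const)
    have "(\<lambda>l. u (y l)) holomorphic_on ball 0 1"
      using u(1) y by (auto simp: disc_holomorphic_def)
    then have "u (y 0) - \<alpha> * 0 = 0"
    proof (intro analytic_continuation[of "\<lambda>l. u (y l) - \<alpha> * l" "ball 0 1" "ball 0 1 - {0}" 0 0])
      fix l :: complex assume l: "l \<in> ball 0 1 - {0}"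
      then have "u (y l) = \<alpha> * y l j"
        using y by (intro nz) (auto simp: analytic_disc_def y_def)
      then show "u (y l) - \<alpha> * l = 0" by (simp add: y_def)
    next
      show "0 islimpt (ball 0 1 - {0 :: complex})"
        by (subst islimpt_punctured[symmetric]) (simp add: islimpt_ball)
    qed (auto intro!: holomorphic_intros)
    moreover have "y 0 = z" using True by (auto simp: y_def fun_eq_iff)
    ultimately show ?thesis using True by simp
  qed (use nz z in blast)
  with \<alpha>(2) show thesis by (rule that)
qed

text \<open>A quantitative form of the invariance of the Kobayashi distance. Let \<open>a = f 0\<close> and let \<open>p\<close> be
  the point of the \<open>j\<close>-th axis with coordinate \<open>1/2\<close>. If every coordinate of \<open>f p\<close> were at
  pseudohyperbolic distance less than \<open>1/2\<close> from \<open>a\<close>, then a disc through \<open>a\<close> and \<open>f p\<close> would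
  reach \<open>f p\<close> at a parameter \<open>r < 1/2\<close>, and the \<open>j\<close>-th coordinate of \<open>g\<close> on this disc would violate the
  Schwarz lemma. So some coordinate of \<open>f\<close>, moved to the origin by a Moebius transformation,
  attains equality in the Schwarz lemma and is therefore linear in \<open>z\<^sub>j\<close>.\<close>

lemma polydisc_map_coordinate:
  assumes f: "\<And>z. z \<in> polydisc d \<Longrightarrow> f z \<in> polydisc e"
      "\<And>i. i < e \<Longrightarrow> disc_holomorphic d (\<lambda>z. f z i)"
    and g: "\<And>w. w \<in> polydisc e \<Longrightarrow> g w \<in> polydisc d"
      "\<And>j. j < d \<Longrightarrow> disc_holomorphic e (\<lambda>w. g w j)"
    and gf: "\<And>z. z \<in> polydisc d \<Longrightarrow> g (f z) = z"
    and j: "j < d"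
  obtains i m where "i < e" "m holomorphic_on ball 0 1" "deriv m 0 \<noteq> 0"
    "\<And>z. z \<in> polydisc d \<Longrightarrow> f z i = m (z j)"
    "m 0 = 0 \<Longrightarrow> \<exists>c. c \<noteq> 0 \<and> (\<forall>l. cmod l < 1 \<longrightarrow> m l = c * l)"
proof -
  define p where "p = (\<lambda>k. if k = j then 1/2 else (0::complex))"
  have p: "p \<in> polydisc d"
    using axis_disc[OF j] by (auto simp: analytic_disc_def p_def)
  define a where "a = f 0"
  have a: "cmod (a i) < 1" for i
    unfolding a_def using f(1)[OF zero_in_polydisc] by (rule polydisc_norm_less)
  have ma: "cmod (- a i) < 1" for i using a by simp
  define v where "v i = Moebius_function 0 (a i) (f p i)" for i
  have v1: "cmod (v i) < 1" for i
    unfolding v_def by (intro Moebius_function_norm_lt_1 a polydisc_norm_less[OF f(1)[OF p]])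
  have "\<exists>i<e. cmod (v i) \<ge> 1/2"
  proof (rule ccontr)
    assume "\<not> (\<exists>i<e. cmod (v i) \<ge> 1/2)"
    then have small: "cmod (v i) < 1/2" if "i < e" for i using that by force
    \<comment> \<open>The value \<open>1/4\<close> only makes the maximum positive; any number in \<open>(0, 1/2)\<close> would do.\<close>
    define r where "r = Max (insert (1/4) ((\<lambda>i. cmod (v i)) ` {..<e}))"
    have "1/4 \<le> r" unfolding r_def by (intro Max_ge) auto
    then have r0: "r > 0" by simp
    have r1: "r < 1/2" unfolding r_def using small by (subst Max_less_iff) auto
    have vr: "cmod (v i) \<le> r" if "i < e" for i
      unfolding r_def using that by (intro Max_ge) auto
    define y where
      "y l i = (if i < e then Moebius_function 0 (- a i) (l * (v i / of_real r)) else 0)" for l i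
    have lv: "cmod (l * (v i / of_real r)) < 1" if "i < e" "cmod l < 1" for l i
    proof -
      have "cmod (v i / of_real r) \<le> 1"
        using vr[OF that(1)] r0 by (simp add: norm_divide)
      then have "cmod l * cmod (v i / of_real r) \<le> cmod l * 1"
        by (intro mult_left_mono) auto
      then show ?thesis using that(2) unfolding norm_mult by linarith
    qed
    have hy: "(\<lambda>l. y l i) holomorphic_on ball 0 1" for i
    proof (cases "i < e")
      case True
      have "(Moebius_function 0 (- a i) \<circ> (\<lambda>l. l * (v i / of_real r))) holomorphic_on ball 0 1"
        using lv[OF True] r0
        by (intro holomorphic_on_compose_gen[OF _ Moebius_function_holomorphic[OF ma]])
           (auto intro!: holomorphic_intros)
      then show ?thesis using True by (simp add: y_def o_def)
    qed (simp add: y_def)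
    have y: "analytic_disc e y"
    proof -
      have "cmod (y l i) < 1" if "i < e" "cmod l < 1" for l i
        using that Moebius_function_norm_lt_1[OF ma lv[OF that]] by (simp add: y_def)
      then show ?thesis
        using hy by (auto simp: analytic_disc_def polydisc_def y_def)
    qed
    have y0: "y 0 = f 0"
      using f(1)[OF zero_in_polydisc]
      by (auto simp: y_def fun_eq_iff Moebius_function_of_zero a_def polydisc_def)
    have yr: "y (of_real r) = f p"
    proof
      fix i show "y (of_real r) i = f p i"
        using f(1)[OF p] r0 Moebius_function_compose[of "- a i" "a i" "f p i"] a[of i]
          polydisc_norm_less[OF f(1)[OF p], of i]
        by (cases "i < e") (auto simp: y_def v_def polydisc_def)
    qed
    have "cmod (g (y (of_real r)) j) \<le> cmod (of_real r)"
    proof (rule Schwarz_Lemma(1)[of "\<lambda>l. g (y l) j"])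
      show "(\<lambda>l. g (y l) j) holomorphic_on ball 0 1"
        using g(2)[OF j] y by (auto simp: disc_holomorphic_def)
      show "g (y 0) j = 0" by (simp add: y0 gf zero_in_polydisc)
      show "cmod (g (y z) j) < 1" if "cmod z < 1" for z
        using g(1) y that by (intro polydisc_norm_less[of _ d]) (auto simp: analytic_disc_def)
      show "cmod (complex_of_real r) < 1" using r0 r1 by simp
    qed
    then show False
      using r0 r1 by (simp add: yr gf p) (simp add: p_def)
  qed
  then obtain i where i: "i < e" "cmod (v i) \<ge> 1/2" by blast
  define u where "u z = Moebius_function 0 (a i) (f z i)" for z
  have u1: "disc_holomorphic d u"
    unfolding u_def
    by (intro disc_holomorphic_compose_ball[OF f(2)[OF i(1)]] Moebius_function_holomorphic a)
       (use f(1) polydisc_norm_less in blast)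
  have u2: "cmod (u z) < 1" if "z \<in> polydisc d" for z
    unfolding u_def by (intro Moebius_function_norm_lt_1 a polydisc_norm_less[OF f(1)[OF that]])
  have u3: "u 0 = 0" by (simp add: u_def a_def Moebius_function_eq_zero)
  have u4: "cmod (u (\<lambda>k. if k = j then 1/2 else 0)) \<ge> 1/2"
    using i(2) by (simp add: u_def v_def p_def)
  obtain \<alpha> where \<alpha>: "cmod \<alpha> = 1" "\<And>z. z \<in> polydisc d \<Longrightarrow> u z = \<alpha> * z j"
    using schwarz_rigidity_polydisc[OF u1 u2 u3 j u4] by blast
  define m where "m l = Moebius_function 0 (- a i) (\<alpha> * l)" for l
  show thesis
  proof (rule that[OF i(1)])
    have "(Moebius_function 0 (- a i) \<circ> (\<lambda>l. \<alpha> * l)) holomorphic_on ball 0 1"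
      using \<alpha>(1) by (intro holomorphic_on_compose_gen[OF _ Moebius_function_holomorphic[OF ma]])
        (auto intro!: holomorphic_intros simp: norm_mult)
    then show "m holomorphic_on ball 0 1" by (simp add: m_def[abs_def] o_def)
    have "(m has_field_derivative \<alpha> * (1 - a i * cnj (a i))) (at 0)"
      unfolding m_def[abs_def] Moebius_function_simple
      by (auto intro!: derivative_eq_intros simp: algebra_simps)
    then have "deriv m 0 = \<alpha> * (1 - a i * cnj (a i))" by (rule DERIV_imp_deriv)
    moreover have "cmod (a i * cnj (a i)) < 1"
      using norm_mult_less[of "a i" 1 "cnj (a i)" 1] a[of i] by simp
    then have "a i * cnj (a i) \<noteq> 1" by auto
    ultimately show "deriv m 0 \<noteq> 0" using \<alpha>(1) by auto
    show "f z i = m (z j)" if "z \<in> polydisc d" for z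
      using \<alpha>(2)[OF that] Moebius_function_compose[of "- a i" "a i" "f z i"] a[of i]
        polydisc_norm_less[OF f(1)[OF that], of i]
      by (simp add: u_def m_def)
    show "\<exists>c. c \<noteq> 0 \<and> (\<forall>l. cmod l < 1 \<longrightarrow> m l = c * l)" if "m 0 = 0"
    proof -
      have "a i = 0" using that by (simp add: m_def Moebius_function_of_zero)
      then show ?thesis
        using \<alpha>(1) by (intro exI[of _ \<alpha>]) (auto simp: m_def Moebius_function_simple)
    qed
  qed
qed

text \<open>A function of \<open>z\<^sub>j\<close> that is also a function of another coordinate is constant.\<close>

lemma coordinate_assignment_inj:
  assumes m: "\<And>j. j < d \<Longrightarrow> deriv (m j) 0 \<noteq> 0"
    and f: "\<And>j z. j < d \<Longrightarrow> z \<in> polydisc d \<Longrightarrow> f z (p j) = m j (z j)"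
  shows "inj_on p {..<d}"
proof (rule inj_onI, rule ccontr)
  fix j k assume jk: "j \<in> {..<d}" "k \<in> {..<d}" "p j = p k" "j \<noteq> k"
  have "m j l = m k 0" if l: "cmod l < 1" for l
  proof -
    define z where "z i = (if i = j then l else 0)" for i
    have "z \<in> polydisc d" using jk l by (auto simp: z_def polydisc_def)
    then have "m j (z j) = m k (z k)" using f[of j z] f[of k z] jk by auto
    then show ?thesis using jk by (simp add: z_def)
  qed
  then have "deriv (m j) 0 = deriv (\<lambda>_. m k 0) 0"
    by (intro deriv_cong_ev) (auto simp: eventually_nhds intro!: exI[of _ "ball 0 1"])
  then show False using m[of j] jk by simp
qed

text \<open>The assignments of coordinates obtained from \<open>f\<close> and from \<open>g\<close> are both injective, so the
  dimensions agree and the assignment is a bijection.\<close>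

lemma polydisc_biholomorphism_splits:
  assumes f: "\<And>z. z \<in> polydisc d \<Longrightarrow> f z \<in> polydisc e"
      "\<And>i. i < e \<Longrightarrow> disc_holomorphic d (\<lambda>z. f z i)"
    and g: "\<And>w. w \<in> polydisc e \<Longrightarrow> g w \<in> polydisc d"
      "\<And>j. j < d \<Longrightarrow> disc_holomorphic e (\<lambda>w. g w j)"
    and gf: "\<And>z. z \<in> polydisc d \<Longrightarrow> g (f z) = z"
    and fg: "\<And>w. w \<in> polydisc e \<Longrightarrow> f (g w) = w"
  obtains p m where "bij_betw p {..<d} {..<e}"
    "\<And>j. j < d \<Longrightarrow> m j holomorphic_on ball 0 1"
    "\<And>j. j < d \<Longrightarrow> deriv (m j) 0 \<noteq> 0"
    "\<And>j z. j < d \<Longrightarrow> z \<in> polydisc d \<Longrightarrow> f z (p j) = m j (z j)"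
    "\<And>j. j < d \<Longrightarrow> m j 0 = 0 \<Longrightarrow> \<exists>c. c \<noteq> 0 \<and> (\<forall>l. cmod l < 1 \<longrightarrow> m j l = c * l)"
proof -
  have "\<exists>i m. i < e \<and> m holomorphic_on ball 0 1 \<and> deriv m 0 \<noteq> 0 \<and>
      (\<forall>z\<in>polydisc d. f z i = m (z j)) \<and>
      (m 0 = 0 \<longrightarrow> (\<exists>c. c \<noteq> 0 \<and> (\<forall>l. cmod l < 1 \<longrightarrow> m l = c * l)))" if "j < d" for j
    using polydisc_map_coordinate[OF f g gf that] by metis
  then obtain p m where pm: "\<And>j. j < d \<Longrightarrow> p j < e \<and> m j holomorphic_on ball 0 1 \<and> deriv (m j) 0 \<noteq> 0 \<and>
      (\<forall>z\<in>polydisc d. f z (p j) = m j (z j)) \<and>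
      (m j 0 = 0 \<longrightarrow> (\<exists>c. c \<noteq> 0 \<and> (\<forall>l. cmod l < 1 \<longrightarrow> m j l = c * l)))"
    by metis
  have "\<exists>i m. i < d \<and> deriv m 0 \<noteq> 0 \<and> (\<forall>w\<in>polydisc e. g w i = m (w j))" if "j < e" for j
    using polydisc_map_coordinate[OF g f fg that] by metis
  then obtain q n where qn: "\<And>j. j < e \<Longrightarrow> q j < d \<and> deriv (n j) 0 \<noteq> 0 \<and>
      (\<forall>w\<in>polydisc e. g w (q j) = n j (w j))"
    by metis
  have p: "inj_on p {..<d}" and q: "inj_on q {..<e}"
    using pm qn by (auto intro!: coordinate_assignment_inj[of _ m f p] coordinate_assignment_inj[of _ n g q])
  have "d \<le> e" using card_inj_on_le[OF p, of "{..<e}"] pm by auto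
  moreover have "e \<le> d" using card_inj_on_le[OF q, of "{..<d}"] qn by auto
  ultimately have "p ` {..<d} = {..<e}"
    using p pm by (intro card_subset_eq) (auto simp: card_image)
  then have "bij_betw p {..<d} {..<e}" using p by (simp add: bij_betw_def)
  then show thesis using pm by (intro that[of p m]) auto
qed

section \<open>Power series in several variables\<close>

definition monom_at :: "nat \<Rightarrow> (nat \<Rightarrow> complex) \<Rightarrow> (nat \<Rightarrow> nat) \<Rightarrow> complex" where
  "monom_at d z x = (\<Prod>i<d. z i ^ x i)"

lemma monom_at_zero: "monom_at d z 0 = 1"
  by (simp add: monom_at_def)

lemma monom_at_add: "monom_at d z (x + y) = monom_at d z x * monom_at d z y"
  by (simp add: monom_at_def power_add prod.distrib)

lemma monom_at_single:
  "i < d \<Longrightarrow> monom_at d z (\<lambda>k. if k = i then n else 0) = z i ^ n"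
  by (simp add: monom_at_def if_distrib[of "power _"] prod.delta cong: if_cong)

lemma monom_at_Suc: "monom_at (Suc d) (z(d := l)) (x(d := n)) = monom_at d z x * l ^ n"
  by (simp add: monom_at_def)

lemma nat_tuples_Suc_bij:
  "bij_betw (\<lambda>(x, n). x(d := n)) (nat_tuples d \<times> UNIV) (nat_tuples (Suc d))"
proof (rule bij_betwI[where g = "\<lambda>x. (x(d := 0), x d)"])
  show "(\<lambda>x. (x(d := 0), x d)) \<in> nat_tuples (Suc d) \<rightarrow> nat_tuples d \<times> UNIV"
    by (auto simp: nat_tuples_def le_Suc_eq Suc_le_eq)
qed (auto simp: nat_tuples_def fun_eq_iff)

text \<open>A product of geometric series.\<close>

lemma monom_at_abs_summable:
  assumes "\<And>i. i < d \<Longrightarrow> cmod (z i) < 1"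
  shows "(\<lambda>x. cmod (monom_at d z x)) summable_on nat_tuples d"
  using assms
proof (induction d)
  case 0
  have "nat_tuples 0 = {0}" by (auto simp: nat_tuples_def)
  then show ?case by simp
next
  case (Suc d)
  have IH: "(\<lambda>x. cmod (monom_at d z x)) summable_on nat_tuples d" using Suc by simp
  have geo: "(\<lambda>n. cmod (z d) ^ n) summable_on UNIV"
    using Suc.prems[of d] by (intro norm_summable_imp_summable_on) (simp add: norm_power summable_geometric)
  have "(\<lambda>(x, n). cmod (monom_at d z x) * cmod (z d) ^ n) summable_on nat_tuples d \<times> UNIV"
    using geo IH
    by (intro summable_on_SigmaI[where g = "\<lambda>x. cmod (monom_at d z x) * (\<Sum>\<^sub>\<infinity>n. cmod (z d) ^ n)"])
       (auto intro!: has_sum_cmult_right summable_on_cmult_left)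
  then have "(\<lambda>p. cmod (monom_at (Suc d) z (case p of (x, n) \<Rightarrow> x(d := n)))) summable_on nat_tuples d \<times> UNIV"
  proof (rule summable_on_cong[THEN iffD1, rotated])
    fix p :: "(nat \<Rightarrow> nat) \<times> nat"
    show "(case p of (x, n) \<Rightarrow> cmod (monom_at d z x) * cmod (z d) ^ n) =
       cmod (monom_at (Suc d) z (case p of (x, n) \<Rightarrow> x(d := n)))"
      using monom_at_Suc[of d z "z d"]
      by (cases p) (simp add: norm_mult norm_power)
  qed
  then show ?case
    using summable_on_reindex_bij_betw[OF nat_tuples_Suc_bij, of "\<lambda>x. cmod (monom_at (Suc d) z x)"]
    by simp
qed

lemma power_series_coefficients_unique:
  fixes a b :: "nat \<Rightarrow> complex"
  assumes a: "\<And>l. cmod l < 1 \<Longrightarrow> (\<lambda>n. a n * l ^ n) sums f l"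
    and b: "\<And>l. cmod l < 1 \<Longrightarrow> (\<lambda>n. b n * l ^ n) sums f l"
  shows "a = b"
proof (rule ccontr)
  assume "a \<noteq> b"
  have d: "(\<lambda>n. (a n - b n) * (l - 0) ^ n) sums 0" if "cmod (l - 0) < 1" for l
    using sums_diff[OF a b, of l l] that by (simp add: algebra_simps)
  have "a 0 - b 0 = 0" using d[of 0] powser_sums_zero_iff[of "\<lambda>n. a n - b n" 0] by simp
  with \<open>a \<noteq> b\<close> obtain m where m: "a m - b m \<noteq> 0" "m > 0"
    by (metis ext gr0I right_minus_eq)
  obtain s :: real where s: "0 < s" "\<And>z :: complex. z \<in> cball 0 s - {0} \<Longrightarrow> (0 :: complex) \<noteq> 0"
    by (rule powser_0_nonzero[of 1 0 "\<lambda>n. a n - b n" "\<lambda>_. 0" m]) (use d m in auto)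
  then show False using s(2)[of "of_real s"] by auto
qed

text \<open>Induction on the number of variables: with the first \<open>d\<close> variables frozen both sides are power
  series in the last one, and comparing their coefficients gives an identity of the same kind in
  \<open>d\<close> variables. The constant \<open>c\<close> absorbs the coefficient \<open>b d n\<close> in that step; with \<open>c = 0\<close> the
  lemma is the uniqueness of coefficients.\<close>

lemma product_coefficients:
  fixes A :: "(nat \<Rightarrow> nat) \<Rightarrow> complex"
  assumes "\<And>z. z \<in> polydisc d \<Longrightarrow>
      ((\<lambda>x. A x * monom_at d z x) has_sum c * (\<Prod>j<d. u j (z j))) (nat_tuples d)"
    and "\<And>j l. j < d \<Longrightarrow> cmod l < 1 \<Longrightarrow> (\<lambda>n. b j n * l ^ n) sums u j l"
    and "x \<in> nat_tuples d"
  shows "A x = c * (\<Prod>j<d. b j (x j))"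
  using assms
proof (induction d arbitrary: A c x)
  case 0
  have "nat_tuples 0 = {0}" by (auto simp: nat_tuples_def)
  then have "((\<lambda>x. A x * monom_at 0 0 x) has_sum c) {0}"
    using 0(1)[OF zero_in_polydisc] by (simp add: zero_fun_def)
  moreover have "((\<lambda>x. A x * monom_at 0 0 x) has_sum A 0) {0}"
    using has_sum_finite[of "{0}" "\<lambda>x. A x * monom_at 0 0 x"] by (simp add: monom_at_def)
  ultimately have "A 0 = c"
    using has_sum_unique by blast
  then show ?case
    using 0(3) \<open>nat_tuples 0 = {0}\<close> by (simp add: zero_fun_def)
next
  case (Suc d)
  have slice: "((\<lambda>y. A (y(d := n)) * monom_at d z y) has_sum
      (c * b d n) * (\<Prod>j<d. u j (z j))) (nat_tuples d)"
    if z: "z \<in> polydisc d" for z n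
  proof -
    have zl: "z(d := l) \<in> polydisc (Suc d)" if "cmod l < 1" for l
      using z that by (auto simp: polydisc_def less_Suc_eq)
    have sum: "((\<lambda>(y, n). A (y(d := n)) * monom_at d z y * l ^ n) has_sum
        c * (\<Prod>j<d. u j (z j)) * u d l) (nat_tuples d \<times> UNIV)" if l: "cmod l < 1" for l
    proof -
      have "(\<Prod>j<Suc d. u j ((z(d := l)) j)) = (\<Prod>j<d. u j (z j)) * u d l"
        by simp
      then have "((\<lambda>x. A x * monom_at (Suc d) (z(d := l)) x) has_sum
          c * (\<Prod>j<d. u j (z j)) * u d l) (nat_tuples (Suc d))"
        using Suc.prems(1)[OF zl[OF l]] by (simp only: mult.assoc)
      then have "((\<lambda>p. A (case p of (y, n) \<Rightarrow> y(d := n)) *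
          monom_at (Suc d) (z(d := l)) (case p of (y, n) \<Rightarrow> y(d := n))) has_sum
          c * (\<Prod>j<d. u j (z j)) * u d l) (nat_tuples d \<times> UNIV)"
        using has_sum_reindex_bij_betw[OF nat_tuples_Suc_bij[of d],
            of "\<lambda>x. A x * monom_at (Suc d) (z(d := l)) x"] by simp
      then show ?thesis
        by (simp add: case_prod_unfold monom_at_Suc mult.assoc)
    qed
    define C where "C n = (\<Sum>\<^sub>\<infinity>y\<in>nat_tuples d. A (y(d := n)) * monom_at d z y)" for n
    have swapped: "((\<lambda>(n, y). A (y(d := n)) * monom_at d z y * l ^ n) has_sum
        c * (\<Prod>j<d. u j (z j)) * u d l) (UNIV \<times> nat_tuples d)" if l: "cmod l < 1" for l
      using sum[OF l] has_sum_swap[of "\<lambda>(y, n). A (y(d := n)) * monom_at d z y * l ^ n"]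
      by (simp add: case_prod_unfold)
    have part: "(\<lambda>y. A (y(d := n)) * monom_at d z y) summable_on nat_tuples d" for n
    proof -
      have "(\<lambda>(n, y). A (y(d := n)) * monom_at d z y * (1/2) ^ n) summable_on UNIV \<times> nat_tuples d"
        using swapped[of "1/2"] by (auto simp: summable_on_def)
      then have "(\<lambda>y. A (y(d := n)) * monom_at d z y * (1/2) ^ n) summable_on nat_tuples d"
        using summable_on_SigmaD1[of "\<lambda>n y. A (y(d := n)) * monom_at d z y * (1/2) ^ n" UNIV "\<lambda>_. nat_tuples d" n]
        by simp
      then have "(\<lambda>y. A (y(d := n)) * monom_at d z y * (1/2) ^ n * 2 ^ n) summable_on nat_tuples d"
        by (rule summable_on_cmult_left)
      then show ?thesis
        by (simp add: mult.assoc flip: power_mult_distrib)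
    qed
    have "(\<lambda>n. C n * l ^ n) sums (c * (\<Prod>j<d. u j (z j)) * u d l)" if l: "cmod l < 1" for l
    proof (rule has_sum_imp_sums, rule has_sum_SigmaD[OF swapped[OF l]])
      show "((\<lambda>y. case (n, y) of (n, y) \<Rightarrow> A (y(d := n)) * monom_at d z y * l ^ n) has_sum C n * l ^ n)
          (nat_tuples d)" for n
        using has_sum_infsum[OF part[of n]] unfolding C_def by (auto intro: has_sum_cmult_left)
    qed
    moreover have "(\<lambda>n. (c * b d n * (\<Prod>j<d. u j (z j))) * l ^ n) sums (c * (\<Prod>j<d. u j (z j)) * u d l)"
      if l: "cmod l < 1" for l
      using sums_mult[OF Suc.prems(2)[OF lessI l], of "c * (\<Prod>j<d. u j (z j))"]
      by (simp add: mult_ac)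
    ultimately have "C = (\<lambda>n. c * b d n * (\<Prod>j<d. u j (z j)))"
      by (rule power_series_coefficients_unique)
    then show ?thesis
      using has_sum_infsum[OF part[of n]] by (simp add: C_def fun_eq_iff)
  qed
  have "x(d := 0) \<in> nat_tuples d"
    using Suc.prems(3) by (auto simp: nat_tuples_def le_Suc_eq Suc_le_eq)
  from Suc.IH[where A = "\<lambda>y. A (y(d := x d))", OF slice Suc.prems(2)[OF less_SucI] this]
  have "A ((x(d := 0))(d := x d)) = c * b d (x d) * (\<Prod>j<d. b j ((x(d := 0)) j))" .
  also have "(\<Prod>j<d. b j ((x(d := 0)) j)) = (\<Prod>j<d. b j (x j))"
    by (intro prod.cong) auto
  finally have "A ((x(d := 0))(d := x d)) = c * b d (x d) * (\<Prod>j<d. b j (x j))" .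
  moreover have "(x(d := 0))(d := x d) = x" by auto
  ultimately have "A x = c * b d (x d) * (\<Prod>j<d. b j (x j))" by (simp only:)
  then show ?case by (simp add: mult_ac)
qed

section \<open>The norm of operators on square-summable functions\<close>

lemma L2_set_le_ell2_norm:
  assumes "f \<in> ell2 S" "finite F" "F \<subseteq> S"
  shows "L2_set (\<lambda>x. cmod (f x)) F \<le> ell2_norm S f"
  unfolding L2_set_def ell2_norm_def using assms
  by (intro real_sqrt_le_mono finite_sum_le_infsum) (auto simp: ell2_def)

text \<open>Membership in \<open>\<ell>\<^sup>2(S)\<close> and its norm are controlled by finite sets, on which the inequalities
  for the Euclidean norm are available.\<close>

lemma ell2_from_finite_bound:
  assumes "\<And>x. x \<notin> S \<Longrightarrow> f x = 0"
    and b: "\<And>F. finite F \<Longrightarrow> F \<subseteq> S \<Longrightarrow> L2_set (\<lambda>x. cmod (f x)) F \<le> C"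
  shows "f \<in> ell2 S" "ell2_norm S f \<le> C"
proof -
  have C: "0 \<le> C" using b[of "{}"] by simp
  have b2: "(\<Sum>x\<in>F. (cmod (f x))\<^sup>2) \<le> C\<^sup>2" if "finite F" "F \<subseteq> S" for F
    using b[OF that] C unfolding L2_set_def by (simp add: real_le_lsqrt sqrt_le_D)
  then have s: "(\<lambda>x. (cmod (f x))\<^sup>2) summable_on S"
    by (intro nonneg_bdd_above_summable_on bdd_aboveI2[where M = "C\<^sup>2"]) auto
  then show "f \<in> ell2 S" using assms(1) by (simp add: ell2_def)
  show "ell2_norm S f \<le> C"
    unfolding ell2_norm_def using C b2
    by (intro real_le_lsqrt infsum_le_finite_sums[OF s]) auto
qed

lemma ell2_norm_triangle:
  assumes f: "f \<in> ell2 S" and g: "g \<in> ell2 S"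
  shows "ell2_norm S (f + g) \<le> ell2_norm S f + ell2_norm S g"
proof (rule ell2_from_finite_bound(2))
  show "(f + g) x = 0" if "x \<notin> S" for x using f g that by (simp add: ell2_def)
  fix F assume F: "finite F" "F \<subseteq> S"
  have "L2_set (\<lambda>x. cmod ((f + g) x)) F \<le> L2_set (\<lambda>x. cmod (f x) + cmod (g x)) F"
    by (intro L2_set_mono) (auto simp: norm_triangle_ineq)
  also have "\<dots> \<le> L2_set (\<lambda>x. cmod (f x)) F + L2_set (\<lambda>x. cmod (g x)) F"
    by (rule L2_set_triangle_ineq)
  also have "\<dots> \<le> ell2_norm S f + ell2_norm S g"
    by (intro add_mono L2_set_le_ell2_norm F f g)
  finally show "L2_set (\<lambda>x. cmod ((f + g) x)) F \<le> ell2_norm S f + ell2_norm S g" .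
qed

lemma ell2_norm_zero: "ell2_norm S 0 = 0"
  by (simp add: ell2_norm_def)

lemma ell2_diff: "f \<in> ell2 S \<Longrightarrow> g \<in> ell2 S \<Longrightarrow> f - g \<in> ell2 S"
  using ell2_add(1)[of f S "\<lambda>x. -1 * g x"] ell2_scale(1)[of g S "-1"]
  by (simp add: fun_diff_def plus_fun_def)

lemma ell2_norm_sum:
  assumes "\<And>k. k \<in> K \<Longrightarrow> f k \<in> ell2 S"
  shows "(\<Sum>k\<in>K. f k) \<in> ell2 S \<and> ell2_norm S (\<Sum>k\<in>K. f k) \<le> (\<Sum>k\<in>K. ell2_norm S (f k))"
  using assms
proof (induction K rule: infinite_finite_induct)
  case (insert k K)
  then have "ell2_norm S (f k + (\<Sum>k\<in>K. f k)) \<le> ell2_norm S (f k) + ell2_norm S (\<Sum>k\<in>K. f k)"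
    by (intro ell2_norm_triangle) auto
  moreover have "f k + (\<Sum>k\<in>K. f k) \<in> ell2 S"
    using insert by (intro ell2_add(1)) auto
  ultimately show ?case
    unfolding sum.insert[OF insert.hyps] using insert.IH insert.prems by (meson add_left_mono insertCI order_trans)
qed (simp_all only: sum.infinite sum.empty ell2_zero ell2_norm_zero simp_thms order_refl)

lemma bounded_opsD:
  assumes "T \<in> bounded_ops S"
  shows "f \<in> ell2 S \<Longrightarrow> T f \<in> ell2 S" "f \<notin> ell2 S \<Longrightarrow> T f = 0"
    "f \<in> ell2 S \<Longrightarrow> g \<in> ell2 S \<Longrightarrow> T (f + g) = T f + T g"
    "f \<in> ell2 S \<Longrightarrow> T (\<lambda>x. c * f x) = (\<lambda>x. c * T f x)"
  using assms by (auto simp: bounded_ops_def)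

lemma bounded_ops_apply_zero:
  assumes "T \<in> bounded_ops S"
  shows "T 0 = 0"
  using bounded_opsD(3)[OF assms ell2_zero ell2_zero] by simp

lemma bounded_ops_range:
  assumes "T \<in> bounded_ops S"
  shows "T f \<in> ell2 S"
proof (cases "f \<in> ell2 S")
  case False
  show ?thesis unfolding bounded_opsD(2)[OF assms False] by (rule ell2_zero)
qed (rule bounded_opsD(1)[OF assms])

lemma op_norm_bound:
  assumes T: "T \<in> bounded_ops S" and f: "f \<in> ell2 S"
  shows "ell2_norm S (T f) \<le> op_norm S T * ell2_norm S f"
proof -
  obtain K where K: "\<And>f. f \<in> ell2 S \<Longrightarrow> ell2_norm S (T f) \<le> K * ell2_norm S f"
    using bounded_ops_bound[OF T] by blast
  have bdd: "bdd_above {ell2_norm S (T f) | f. f \<in> ell2 S \<and> ell2_norm S f \<le> 1}"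
  proof (rule bdd_aboveI)
    fix t assume "t \<in> {ell2_norm S (T f) | f. f \<in> ell2 S \<and> ell2_norm S f \<le> 1}"
    then obtain f where f: "t = ell2_norm S (T f)" "f \<in> ell2 S" "ell2_norm S f \<le> 1" by blast
    have "K * ell2_norm S f \<le> \<bar>K\<bar> * 1"
      using f(3) ell2_norm_nonneg[of S f] by (intro mult_mono) auto
    then show "t \<le> \<bar>K\<bar>" using K[OF f(2)] f(1) by simp
  qed
  show ?thesis
  proof (cases "ell2_norm S f = 0")
    case True
    then show ?thesis using K[OF f] by simp
  next
    case False
    define r where "r = ell2_norm S f"
    have r: "r > 0" using False ell2_norm_nonneg[of S f] by (simp add: r_def)
    let ?g = "\<lambda>x. of_real (1 / r) * f x"
    have "ell2_norm S (T ?g) \<le> op_norm S T"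
      unfolding op_norm_def
      using r ell2_scale[OF f, of "of_real (1 / r)"]
      by (intro cSup_upper[OF _ bdd]) (auto simp: norm_divide r_def intro!: exI[of _ ?g])
    moreover have "ell2_norm S (T ?g) = ell2_norm S (T f) / r"
      using r ell2_scale(2)[OF bounded_opsD(1)[OF T f], of "of_real (1 / r)"]
      by (simp only: bounded_opsD(4)[OF T f]) (simp add: norm_divide)
    ultimately show ?thesis using r by (simp add: field_simps r_def)
  qed
qed

lemma op_norm_le:
  assumes "\<And>f. f \<in> ell2 S \<Longrightarrow> ell2_norm S (T f) \<le> C * ell2_norm S f" "C \<ge> 0"
  shows "op_norm S T \<le> C"
  unfolding op_norm_def
proof (rule cSup_least)
  show "{ell2_norm S (T f) | f. f \<in> ell2 S \<and> ell2_norm S f \<le> 1} \<noteq> {}"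
    using ell2_zero[of S] ell2_norm_zero[of S] by (auto intro!: exI[of _ 0])
  fix t assume "t \<in> {ell2_norm S (T f) | f. f \<in> ell2 S \<and> ell2_norm S f \<le> 1}"
  then obtain f where f: "t = ell2_norm S (T f)" "f \<in> ell2 S" "ell2_norm S f \<le> 1" by blast
  have "C * ell2_norm S f \<le> C * 1" using f(3) assms(2) by (intro mult_left_mono)
  then show "t \<le> C" using assms(1)[OF f(2)] f(1) by simp
qed

lemma op_norm_nonneg:
  assumes T: "T \<in> bounded_ops S"
  shows "0 \<le> op_norm S T"
proof (cases "S = {}")
  case True
  then have "op_norm S T = Sup {0}"
    unfolding op_norm_def ell2_norm_def
    by (intro arg_cong[of _ _ Sup]) (auto simp: ell2_def)
  then show ?thesis by simp
next
  case False
  then obtain t where t: "t \<in> S" by blast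
  have "cmod (basis_vec t t) \<le> ell2_norm S (basis_vec t)"
    by (rule cmod_le_ell2_norm[OF basis_vec_ell2[OF t]])
  then have p: "ell2_norm S (basis_vec t) > 0" by (simp add: basis_vec_def)
  have "0 \<le> op_norm S T * ell2_norm S (basis_vec t)"
    using op_norm_bound[OF T basis_vec_ell2[OF t]] ell2_norm_nonneg[of S "T (basis_vec t)"] by linarith
  then show ?thesis using p by (simp add: zero_le_mult_iff)
qed

lemma op_scale_minus: "op_scale (-1) T = - T"
  by (auto simp: op_scale_def fun_eq_iff)

section \<open>Characters of the Fock algebra\<close>

lemma subalgebra_fock_algebra: "positive_cone S \<Longrightarrow> subalgebra S (fock_algebra S)"
  using fock_algebra_subset[of S] unfolding subalgebra_def fock_algebra_def by auto

lemma fock_algebra_closed: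
  assumes S: "positive_cone S" and T: "T \<in> fock_algebra S"
  shows "U \<in> fock_algebra S \<Longrightarrow> T + U \<in> fock_algebra S"
    "op_scale c T \<in> fock_algebra S"
    "U \<in> fock_algebra S \<Longrightarrow> T \<circ> U \<in> fock_algebra S"
    "U \<in> fock_algebra S \<Longrightarrow> T - U \<in> fock_algebra S"
    "0 \<in> fock_algebra S"
    "T \<in> bounded_ops S"
proof -
  note A = subalgebra_fock_algebra[OF S, unfolded subalgebra_def]
  show "U \<in> fock_algebra S \<Longrightarrow> T + U \<in> fock_algebra S"
    "op_scale c T \<in> fock_algebra S"
    "U \<in> fock_algebra S \<Longrightarrow> T \<circ> U \<in> fock_algebra S"
    "0 \<in> fock_algebra S" "T \<in> bounded_ops S"
    using A T by auto
  show "T - U \<in> fock_algebra S" if "U \<in> fock_algebra S"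
  proof -
    have "T + op_scale (-1) U \<in> fock_algebra S" using A T that by blast
    then show ?thesis by (simp only: op_scale_minus) simp
  qed
qed

lemma fock_in_fock_algebra: "s \<in> S \<Longrightarrow> fock S s \<in> fock_algebra S"
  by (auto simp: fock_algebra_def)

lemma fock_algebra_limit:
  assumes "T \<in> bounded_ops S" "\<And>n. X n \<in> fock_algebra S" "(\<lambda>n. op_norm S (X n - T)) \<longlonglongrightarrow> 0"
  shows "T \<in> fock_algebra S"
  using assms unfolding fock_algebra_def norm_closed_def by blast

text \<open>The closed algebra is the least norm-closed algebra that contains the generators, so a property
  of all its elements needs to be checked only for the generators and for the closure operations.\<close>

lemma fock_algebra_induct [consumes 2, case_names fock add scale comp limit]:
  assumes S: "positive_cone S" and T: "T \<in> fock_algebra S"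
    and fock: "\<And>s. s \<in> S \<Longrightarrow> P (fock S s)"
    and add: "\<And>T U. T \<in> fock_algebra S \<Longrightarrow> U \<in> fock_algebra S \<Longrightarrow> P T \<Longrightarrow> P U \<Longrightarrow> P (T + U)"
    and scale: "\<And>c T. T \<in> fock_algebra S \<Longrightarrow> P T \<Longrightarrow> P (op_scale c T)"
    and comp: "\<And>T U. T \<in> fock_algebra S \<Longrightarrow> U \<in> fock_algebra S \<Longrightarrow> P T \<Longrightarrow> P U \<Longrightarrow> P (T \<circ> U)"
    and limit: "\<And>X T. (\<And>n. X n \<in> fock_algebra S) \<Longrightarrow> (\<And>n. P (X n)) \<Longrightarrow> T \<in> fock_algebra S \<Longrightarrow>
        (\<lambda>n. op_norm S (X n - T)) \<longlonglongrightarrow> 0 \<Longrightarrow> P T"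
  shows "P T"
proof -
  define B where "B = {T \<in> fock_algebra S. P T}"
  have S0: "0 \<in> S" using S by (simp add: positive_cone_def)
  note closed = fock_algebra_closed[OF S]
  have "op_scale 0 (fock S 0) = 0" by (auto simp: op_scale_def fun_eq_iff)
  then have "0 \<in> B"
    using scale[OF fock_in_fock_algebra[OF S0] fock[OF S0], of 0]
      closed(5)[OF fock_in_fock_algebra[OF S0]] by (simp add: B_def)
  then have "subalgebra S B"
    using closed add scale comp fock_algebra_subset[OF S] by (auto simp: subalgebra_def B_def)
  moreover have "norm_closed S B"
    using limit fock_algebra_limit unfolding norm_closed_def B_def by blast
  moreover have "fock S ` S \<subseteq> B"
    using fock fock_in_fock_algebra by (auto simp: B_def)
  ultimately have "fock_algebra S \<subseteq> B" unfolding fock_algebra_def by blast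
  then show ?thesis using T by (auto simp: B_def)
qed

lemma fock_zero_apply: "fock S 0 f = (if f \<in> ell2 S then f else 0)"
  by (simp add: fock_def)

lemma fock_zero_comp: "T \<in> bounded_ops S \<Longrightarrow> fock S 0 \<circ> T = T"
  by (auto simp: fun_eq_iff fock_zero_apply bounded_ops_range)

lemma comp_fock_zero: "T \<in> bounded_ops S \<Longrightarrow> T \<circ> fock S 0 = T"
  by (auto simp: fun_eq_iff fock_zero_apply bounded_opsD bounded_ops_apply_zero)

text \<open>The sum \<open>R\<close> of the powers of \<open>T\<close> is formed entrywise. Its distance from the \<open>n\<close>-th partial sum
  is bounded on each finite set of entries by the geometric tail, hence in operator norm; so \<open>R\<close> is
  bounded and, as a norm limit, belongs to the algebra.\<close>

lemma neumann_inverse: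
  assumes S: "positive_cone S" and T: "T \<in> fock_algebra S" and q: "op_norm S T < 1"
  obtains R where "R \<in> fock_algebra S" "R \<circ> (fock S 0 - T) = fock S 0"
proof -
  define q where "q = op_norm S T"
  note closed = fock_algebra_closed[OF S]
  have S0: "0 \<in> S" using S by (simp add: positive_cone_def)
  have TB: "T \<in> bounded_ops S" by (rule closed(6)[OF T])
  have q0: "0 \<le> q" "q < 1" using op_norm_nonneg[OF TB] q by (auto simp: q_def)
  define W where "W k = (T ^^ k) \<circ> fock S 0" for k :: nat
  have W0: "W 0 = fock S 0" by (simp add: W_def)
  have WS: "W (Suc k) = T \<circ> W k" for k by (simp add: W_def o_assoc)
  have WA: "W k \<in> fock_algebra S" for k
  proof (induction k)
    case (Suc k)
    show ?case unfolding WS by (rule closed(3)[OF T Suc])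
  qed (simp only: W0 fock_in_fock_algebra S0)
  have WB: "W k \<in> bounded_ops S" for k by (rule closed(6)[OF WA])
  have Wn: "ell2_norm S (W k f) \<le> q ^ k * ell2_norm S f" if f: "f \<in> ell2 S" for f k
  proof (induction k)
    case (Suc k)
    have "ell2_norm S (T (W k f)) \<le> q * ell2_norm S (W k f)"
      unfolding q_def by (rule op_norm_bound[OF TB bounded_ops_range[OF WB]])
    also have "\<dots> \<le> q * (q ^ k * ell2_norm S f)" using Suc q0 by (intro mult_left_mono)
    finally show ?case by (simp add: WS mult_ac)
  qed (simp add: W0 fock_zero_apply f)
  define X where "X n = (\<Sum>k<n. W k)" for n
  have XA: "X n \<in> fock_algebra S" for n
  proof (induction n)
    case (Suc n)
    show ?case
      unfolding X_def sum.lessThan_Suc by (rule closed(1)[OF Suc[unfolded X_def] WA])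
  qed (simp only: X_def lessThan_0 sum.empty closed(5)[OF T])
  have Xapp: "X n f = (\<Sum>k<n. W k f)" for n f
    unfolding X_def by (induction n) auto
  have Xapp': "X n f x = (\<Sum>k<n. W k f x)" for n f x
    unfolding Xapp by (induction n) auto
  have XB: "X n \<in> bounded_ops S" for n by (rule closed(6)[OF XA])
  define R where "R f x = (\<Sum>k. W k f x)" for f x
  have smW: "summable (\<lambda>k. W k f x)" if f: "f \<in> ell2 S" for f x
  proof (rule summable_comparison_test')
    show "summable (\<lambda>k. q ^ k * ell2_norm S f)"
      using q0 by (intro summable_mult2 summable_geometric) auto
    show "cmod (W k f x) \<le> q ^ k * ell2_norm S f" for k
      using cmod_le_ell2_norm[OF bounded_ops_range[OF WB]] Wn[OF f] order_trans by blast
  qed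
  have tail: "ell2_norm S (X m f - X n f) \<le> q ^ n / (1 - q) * ell2_norm S f"
    if f: "f \<in> ell2 S" and mn: "n \<le> m" for f m n
  proof -
    have "X m f - X n f = (\<Sum>k\<in>{n..<m}. W k f)"
      unfolding Xapp using mn sum_diff_nat_ivl[of 0 n m "\<lambda>k. W k f"] by (simp add: lessThan_atLeast0)
    then have "ell2_norm S (X m f - X n f) \<le> (\<Sum>k\<in>{n..<m}. ell2_norm S (W k f))"
      using ell2_norm_sum[of "{n..<m}" "\<lambda>k. W k f" S] bounded_ops_range[OF WB] by simp
    also have "\<dots> \<le> (\<Sum>k\<in>{n..<m}. q ^ k * ell2_norm S f)" by (intro sum_mono Wn f)
    also have "\<dots> = (\<Sum>k\<in>{n..<m}. q ^ k) * ell2_norm S f" by (simp add: sum_distrib_right)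
    also have "\<dots> \<le> q ^ n / (1 - q) * ell2_norm S f"
    proof (rule mult_right_mono)
      have "(1 - q) * (\<Sum>k\<in>{n..<m}. q ^ k) = q ^ n - q ^ m"
        using mn by (induction m rule: dec_induct) (simp_all add: distrib_left, simp add: algebra_simps)
      then have "(\<Sum>k\<in>{n..<m}. q ^ k) = (q ^ n - q ^ m) / (1 - q)"
        using q0 by (simp add: field_simps)
      then show "(\<Sum>k\<in>{n..<m}. q ^ k) \<le> q ^ n / (1 - q)"
        using q0 by (auto intro!: divide_right_mono)
    qed (rule ell2_norm_nonneg)
    finally show ?thesis .
  qed
  have RX: "R f - X n f \<in> ell2 S \<and> ell2_norm S (R f - X n f) \<le> q ^ n / (1 - q) * ell2_norm S f"
    if f: "f \<in> ell2 S" for f n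
  proof -
    have supp: "(R f - X n f) x = 0" if "x \<notin> S" for x
    proof -
      have "W k f x = 0" for k using bounded_ops_range[OF WB] that by (auto simp: ell2_def)
      then show ?thesis by (simp add: R_def Xapp')
    qed
    have bound: "L2_set (\<lambda>x. cmod ((R f - X n f) x)) F \<le> q ^ n / (1 - q) * ell2_norm S f"
      if F: "finite F" "F \<subseteq> S" for F
    proof (rule LIMSEQ_le_const2)
      have "(\<lambda>m. X m f x) \<longlonglongrightarrow> R f x" for x
      proof -
        have "(\<lambda>m. \<Sum>k<m. W k f x) \<longlonglongrightarrow> R f x"
          unfolding R_def by (rule summable_LIMSEQ[OF smW[OF f]])
        then show ?thesis by (simp only: Xapp')
      qed
      then show "(\<lambda>m. L2_set (\<lambda>x. cmod ((X m f - X n f) x)) F) \<longlonglongrightarrow> L2_set (\<lambda>x. cmod ((R f - X n f) x)) F"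
        unfolding L2_set_def by (auto intro!: tendsto_intros)
      show "\<exists>N. \<forall>m\<ge>N. L2_set (\<lambda>x. cmod ((X m f - X n f) x)) F \<le> q ^ n / (1 - q) * ell2_norm S f"
        using L2_set_le_ell2_norm[OF ell2_diff[OF bounded_ops_range[OF XB] bounded_ops_range[OF XB]] F] tail[OF f]
        by (meson order_trans)
    qed
    show ?thesis using ell2_from_finite_bound[OF supp bound] by blast
  qed
  have R0: "R f = 0" if "f \<notin> ell2 S" for f
    using that by (auto simp: R_def fun_eq_iff bounded_opsD[OF WB])
  have RB: "R \<in> bounded_ops S"
    unfolding bounded_ops_def
  proof (safe intro!: R0)
    show "R f \<in> ell2 S" if f: "f \<in> ell2 S" for f
      using RX[OF f, of 0] by (simp add: X_def)
    show "R (f + g) = R f + R g" if "f \<in> ell2 S" "g \<in> ell2 S" for f g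
      using that by (auto simp: R_def fun_eq_iff bounded_opsD(3)[OF WB] suminf_add smW)
    show "R (\<lambda>x. c * f x) = (\<lambda>x. c * R f x)" if "f \<in> ell2 S" for c f
      using that by (auto simp: R_def fun_eq_iff bounded_opsD(4)[OF WB] suminf_mult smW)
    show "\<exists>K. \<forall>f\<in>ell2 S. ell2_norm S (R f) \<le> K * ell2_norm S f"
      using RX[of _ 0] by (auto simp: X_def intro!: exI[of _ "1 / (1 - q)"])
  qed
  have RA: "R \<in> fock_algebra S"
  proof (rule fock_algebra_limit[OF RB XA])
    have neg: "ell2_norm S (- g) = ell2_norm S g" for g by (simp add: ell2_norm_def)
    have up: "op_norm S (X n - R) \<le> q ^ n / (1 - q)" for n
    proof (rule op_norm_le)
      show "ell2_norm S ((X n - R) f) \<le> q ^ n / (1 - q) * ell2_norm S f" if "f \<in> ell2 S" for f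
        using RX[OF that, of n] neg[of "R f - X n f"] by simp
    qed (use q0 in simp)
    have lo: "0 \<le> op_norm S (X n - R)" for n
    proof -
      have "X n + op_scale (-1) R \<in> bounded_ops S"
        using bounded_ops_subalgebra[of S] XB RB unfolding subalgebra_def by blast
      then show ?thesis by (intro op_norm_nonneg) (simp only: op_scale_minus, simp)
    qed
    show "(\<lambda>n. op_norm S (X n - R)) \<longlonglongrightarrow> 0"
    proof (rule tendsto_sandwich[OF _ _ tendsto_const])
      show "(\<lambda>n. q ^ n / (1 - q)) \<longlonglongrightarrow> 0"
        using tendsto_divide[OF LIMSEQ_realpow_zero[OF q0] tendsto_const[of "1 - q"]] q0 by simp
    qed (auto simp: up lo)
  qed
  have "R ((fock S 0 - T) f) x = fock S 0 f x" for f x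
  proof (cases "f \<in> ell2 S")
    case True
    have Tf: "T f \<in> ell2 S" by (rule bounded_ops_range[OF TB])
    have WT: "W k (T f) = W (Suc k) f" for k
      using Tf True by (simp add: W_def fock_zero_apply funpow_swap1)
    have "W k ((fock S 0 - T) f) x = W k f x - W (Suc k) f x" for k
    proof -
      have "f - T f = f + (\<lambda>x. -1 * T f x)" by (auto simp: fun_eq_iff)
      then have "W k (f - T f) = W k f + (\<lambda>x. -1 * W k (T f) x)"
        using bounded_opsD(3,4)[OF WB] True Tf ell2_scale(1)[OF Tf] by metis
      then show ?thesis using True by (simp add: fock_zero_apply WT)
    qed
    moreover have "(\<lambda>k. W k f x - W (Suc k) f x) sums (W 0 f x - 0)"
      by (rule telescope_sums'[OF summable_LIMSEQ_zero[OF smW[OF True]]])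
    ultimately show ?thesis
      by (simp add: R_def sums_iff W0)
  next
    case False
    then show ?thesis
      by (simp add: fock_zero_apply bounded_opsD[OF TB] bounded_ops_apply_zero[OF RB])
  qed
  then have "R \<circ> (fock S 0 - T) = fock S 0" by (auto simp: fun_eq_iff)
  with RA show thesis by (rule that)
qed

definition character :: "'a::ab_group_add set \<Rightarrow> ('a l2op \<Rightarrow> complex) \<Rightarrow> bool" where
  "character S \<omega> \<longleftrightarrow> \<omega> (fock S 0) = 1 \<and>
     (\<forall>T\<in>fock_algebra S. \<forall>U\<in>fock_algebra S. \<omega> (T + U) = \<omega> T + \<omega> U) \<and>
     (\<forall>c. \<forall>T\<in>fock_algebra S. \<omega> (op_scale c T) = c * \<omega> T) \<and>
     (\<forall>T\<in>fock_algebra S. \<forall>U\<in>fock_algebra S. \<omega> (T \<circ> U) = \<omega> T * \<omega> U)"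

lemma characterD:
  assumes "character S \<omega>"
  shows "\<omega> (fock S 0) = 1"
    and "T \<in> fock_algebra S \<Longrightarrow> U \<in> fock_algebra S \<Longrightarrow> \<omega> (T + U) = \<omega> T + \<omega> U"
    and "T \<in> fock_algebra S \<Longrightarrow> \<omega> (op_scale c T) = c * \<omega> T"
    and "T \<in> fock_algebra S \<Longrightarrow> U \<in> fock_algebra S \<Longrightarrow> \<omega> (T \<circ> U) = \<omega> T * \<omega> U"
  using assms unfolding character_def by blast+

lemma character_diff:
  assumes S: "positive_cone S" and \<omega>: "character S \<omega>" and T: "T \<in> fock_algebra S" and U: "U \<in> fock_algebra S"
  shows "\<omega> (T - U) = \<omega> T - \<omega> U"
proof -
  have "\<omega> (T + op_scale (-1) U) = \<omega> T + (-1) * \<omega> U"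
    using \<omega> T U fock_algebra_closed(2)[OF S U, of "-1"] by (simp add: character_def)
  then show ?thesis by (simp only: op_scale_minus) simp
qed

text \<open>If \<open>|\<omega> T|\<close> exceeded the norm, then \<open>1 - T / \<omega> T\<close> would be invertible in the algebra and
  annihilated by \<open>\<omega>\<close>. Because continuity of characters comes for free in this way, an isomorphism
  that is merely algebraic can be handled.\<close>

lemma character_le_op_norm:
  assumes S: "positive_cone S" and \<omega>: "character S \<omega>" and T: "T \<in> fock_algebra S"
  shows "cmod (\<omega> T) \<le> op_norm S T"
proof (rule ccontr)
  assume "\<not> ?thesis"
  then have big: "op_norm S T < cmod (\<omega> T)" by simp
  note closed = fock_algebra_closed[OF S]
  have n0: "0 \<le> op_norm S T" by (rule op_norm_nonneg[OF closed(6)[OF T]])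
  then have nz: "\<omega> T \<noteq> 0" using big by auto
  define U where "U = op_scale (1 / \<omega> T) T"
  have U: "U \<in> fock_algebra S" unfolding U_def by (rule closed(2)[OF T])
  have U1: "\<omega> U = 1" using \<omega> T nz by (simp add: U_def character_def)
  have "op_norm S U \<le> op_norm S T / cmod (\<omega> T)"
  proof (rule op_norm_le)
    fix f assume f: "f \<in> ell2 S"
    have "ell2_norm S (U f) = ell2_norm S (T f) / cmod (\<omega> T)"
      unfolding U_def op_scale_def
      by (subst ell2_scale(2)[OF bounded_ops_range[OF closed(6)[OF T]]]) (simp add: norm_divide)
    also have "\<dots> \<le> (op_norm S T * ell2_norm S f) / cmod (\<omega> T)"
      by (intro divide_right_mono op_norm_bound[OF closed(6)[OF T] f]) simp
    finally show "ell2_norm S (U f) \<le> op_norm S T / cmod (\<omega> T) * ell2_norm S f" by simp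
  qed (use n0 in simp)
  also have "\<dots> < 1" using big n0 by (simp add: divide_less_eq)
  finally obtain R where R: "R \<in> fock_algebra S" "R \<circ> (fock S 0 - U) = fock S 0"
    using neumann_inverse[OF S U] by blast
  have I: "fock S 0 \<in> fock_algebra S"
    using S by (intro fock_in_fock_algebra) (simp add: positive_cone_def)
  have "\<omega> (R \<circ> (fock S 0 - U)) = \<omega> R * \<omega> (fock S 0 - U)"
    using \<omega> R(1) closed(4)[OF I U] by (simp add: character_def)
  also have "\<dots> = 0"
    using character_diff[OF S \<omega> I U] U1 \<omega> by (simp add: character_def)
  finally show False using R(2) \<omega> by (simp add: character_def)
qed

lemma op_norm_fock_le_1:
  assumes "positive_cone S" "s \<in> S"
  shows "op_norm S (fock S s) \<le> 1"
  using assms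
  by (intro op_norm_le) (auto simp: fock_def positive_cone_def shift_ell2(2))

lemma fock_comp:
  assumes S: "positive_cone S" and st: "s \<in> S" "t \<in> S"
  shows "fock S s \<circ> fock S t = fock S (s + t)"
  using S st
  by (auto simp: fun_eq_iff fock_def positive_cone_def shift_ell2(1) diff_diff_eq add.commute)

section \<open>The Fock algebra as an algebra of functions on the polydisc\<close>

lemma eq_from_consecutive_powers:
  fixes a b :: complex
  assumes "n \<ge> 1" "a ^ n = b ^ n" "a ^ Suc n = b ^ Suc n"
  shows "a = b"
proof (cases "b = 0")
  case True
  then show ?thesis using assms(1,2) by (simp add: power_0_left)
next
  case False
  have "a * b ^ n = b * b ^ n" using assms(2,3) by simp
  then show ?thesis using False by simp
qed

definition axis_tuple :: "nat \<Rightarrow> nat \<Rightarrow> nat \<Rightarrow> nat" where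
  "axis_tuple i n = (\<lambda>k. if k = i then n else 0)"

lemma monom_at_axis: "i < d \<Longrightarrow> monom_at d z (axis_tuple i n) = z i ^ n"
  unfolding axis_tuple_def by (rule monom_at_single)

lemma axis_tuple_add: "axis_tuple i m + axis_tuple i n = axis_tuple i (m + n)"
  by (auto simp: axis_tuple_def fun_eq_iff)

lemma axis_tuple_zero: "axis_tuple i 0 = 0"
  by (auto simp: axis_tuple_def fun_eq_iff)

text \<open>On the \<open>i\<close>-th axis \<open>c\<close> is multiplicative from some point on, hence a geometric progression whose
  ratio is the \<open>i\<close>-th coordinate of \<open>w\<close>. For \<open>M\<close> large the multiple \<open>M x\<close> of any exponent \<open>x\<close> is a
  sum of elements of the axes, which determines \<open>c(x)\<^sup>M\<close>; two consecutive such powers determine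
  \<open>c(x)\<close>.\<close>

lemma monoid_character_is_monomial:
  fixes K :: "(nat \<Rightarrow> nat) set" and c :: "(nat \<Rightarrow> nat) \<Rightarrow> complex"
  assumes K: "K \<subseteq> nat_tuples d" "0 \<in> K" "\<And>x y. x \<in> K \<Longrightarrow> y \<in> K \<Longrightarrow> x + y \<in> K"
    and axes: "\<And>n i. n \<ge> N \<Longrightarrow> i < d \<Longrightarrow> axis_tuple i n \<in> K"
    and c: "c 0 = 1" "\<And>x y. x \<in> K \<Longrightarrow> y \<in> K \<Longrightarrow> c (x + y) = c x * c y"
  obtains w where "\<And>i. i \<ge> d \<Longrightarrow> w i = 0" "\<And>x. x \<in> K \<Longrightarrow> c x = monom_at d w x"
proof -
  \<comment> \<open>Positive exponents are needed to conclude from a power that is zero.\<close>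
  define N' where "N' = Suc N"
  have axes': "axis_tuple i n \<in> K" if "n \<ge> N'" "i < d" for i n
    using that by (intro axes) (auto simp: N'_def)
  define w where
    "w i = (if i < d then c (axis_tuple i (Suc N')) / c (axis_tuple i N') else 0)" for i
  have mult: "(\<lambda>k. n * x k) \<in> K \<and> c (\<lambda>k. n * x k) = c x ^ n" if x: "x \<in> K" for x n
  proof (induction n)
    case 0
    have "(\<lambda>k. 0 * x k) = 0" by auto
    then show ?case using K(2) c(1) by (metis power_0)
  next
    case (Suc n)
    have "(\<lambda>k. Suc n * x k) = x + (\<lambda>k. n * x k)" by auto
    then show ?case using Suc K(3)[OF x, of "\<lambda>k. n * x k"] c(2)[OF x, of "\<lambda>k. n * x k"]
      by (metis power_Suc)
  qed
  have axis: "c (axis_tuple i n) = w i ^ n" if i: "i < d" and n: "n \<ge> N'" for i n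
  proof (cases "c (axis_tuple i N') = 0")
    case True
    have "(\<lambda>k. n * axis_tuple i N' k) = (\<lambda>k. N' * axis_tuple i n k)"
      by (auto simp: axis_tuple_def)
    then have "c (axis_tuple i n) ^ N' = c (axis_tuple i N') ^ n"
      using mult[OF axes'[OF n i], of N'] mult[OF axes'[OF order_refl i], of n] by metis
    moreover have "n > 0" using n by (simp add: N'_def)
    ultimately have "c (axis_tuple i n) = 0" using True by (metis power_eq_0_iff power_0_left less_irrefl)
    moreover have "w i = 0" using True by (simp add: w_def)
    ultimately show ?thesis using n by (simp add: N'_def)
  next
    case False
    have step: "c (axis_tuple i (Suc m)) = w i * c (axis_tuple i m)" if m: "m \<ge> N'" for m
    proof -
      have "c (axis_tuple i (Suc m)) * c (axis_tuple i N') = c (axis_tuple i (Suc m) + axis_tuple i N')"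
        using m i by (intro c(2)[symmetric] axes') auto
      also have "\<dots> = c (axis_tuple i m + axis_tuple i (Suc N'))"
        by (simp add: axis_tuple_add)
      also have "\<dots> = c (axis_tuple i m) * c (axis_tuple i (Suc N'))"
        using m i by (intro c(2) axes') auto
      finally show ?thesis using False i by (simp add: w_def field_simps)
    qed
    have shifted: "c (axis_tuple i (N' + m)) = w i ^ m * c (axis_tuple i N')" for m
      by (induction m) (simp_all add: step)
    have "c (axis_tuple i N') * c (axis_tuple i N') = c (axis_tuple i (N' + N'))"
      using c(2)[OF axes'[OF order_refl i] axes'[OF order_refl i]] by (simp add: axis_tuple_add)
    then have "c (axis_tuple i N') = w i ^ N'" using False shifted[of N'] by simp
    then show ?thesis using shifted[of "n - N'"] n by (simp add: power_add[symmetric])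
  qed
  have trunc: "(\<lambda>k. if k < m then M * x k else 0) \<in> K \<and>
      c (\<lambda>k. if k < m then M * x k else 0) = (\<Prod>i<m. w i ^ (M * x i))"
    if x: "x \<in> K" and M: "M \<ge> N'" and m: "m \<le> d" for x M m
    using m
  proof (induction m)
    case 0
    have "(\<lambda>k. if k < 0 then M * x k else 0) = 0" by auto
    then show ?case using K(2) c(1) by (metis lessThan_0 prod.empty)
  next
    case (Suc m)
    let ?t = "\<lambda>m k. if k < m then M * x k else 0"
    have a: "axis_tuple m (M * x m) \<in> K \<and> c (axis_tuple m (M * x m)) = w m ^ (M * x m)"
    proof (cases "x m = 0")
      case True
      then show ?thesis using K(2) c(1) by (simp only: axis_tuple_zero mult_0_right power_0 simp_thms)
    next
      case False
      then have "M * x m \<ge> N'" using M by (metis One_nat_def Suc_leI le_trans mult.commute mult_le_mono nat_mult_1 neq0_conv)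
      then show ?thesis using axes' axis Suc.prems by auto
    qed
    have "?t (Suc m) = ?t m + axis_tuple m (M * x m)"
      by (auto simp: axis_tuple_def fun_eq_iff)
    moreover have "?t m \<in> K" "c (?t m) = (\<Prod>i<m. w i ^ (M * x i))"
      using Suc by auto
    ultimately have t: "?t (Suc m) = ?t m + axis_tuple m (M * x m)" "?t m \<in> K"
        "c (?t m) = (\<Prod>i<m. w i ^ (M * x i))"
      by blast+
    have "?t m + axis_tuple m (M * x m) \<in> K"
      using K(3) t(2) a by blast
    moreover have "c (?t m + axis_tuple m (M * x m)) = (\<Prod>i<Suc m. w i ^ (M * x i))"
      using c(2)[OF t(2) conjunct1[OF a]] a t(3) by (simp only: prod.lessThan_Suc)
    ultimately show ?case unfolding t(1) by blast
  qed
  have "c x = monom_at d w x" if x: "x \<in> K" for x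
  proof -
    have pw: "c x ^ M = monom_at d w x ^ M" if M: "M \<ge> N'" for M
    proof -
      have "(\<lambda>k. if k < d then M * x k else 0) = (\<lambda>k. M * x k)"
        using K(1) x by (auto simp: nat_tuples_def fun_eq_iff)
      then have "c (\<lambda>k. M * x k) = (\<Prod>i<d. w i ^ (M * x i))"
        using trunc[OF x M order_refl] by metis
      also have "\<dots> = monom_at d w x ^ M"
        by (simp add: monom_at_def prod_power_distrib power_mult[symmetric] mult.commute)
      finally show ?thesis using mult[OF x, of M] by simp
    qed
    show ?thesis
      by (rule eq_from_consecutive_powers[of N']) (use pw[of N'] pw[of "Suc N'"] in \<open>auto simp: N'_def\<close>)
  qed
  then show thesis by (intro that[of w]) (auto simp: w_def)
qed

text \<open>A positive cone with an embedding \<open>h\<close> into \<open>\<int>\<^sub>+\<^sup>d\<close> whose image contains all large multiples of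
  the unit vectors. The embedding is kept as an exponent map, so that \<open>S\<close> stays in its own group.\<close>

locale fock_coordinates =
  fixes S :: "'a::ab_group_add set" and d :: nat and h :: "'a \<Rightarrow> nat \<Rightarrow> nat"
  assumes cone: "positive_cone S"
    and exponent: "s \<in> S \<Longrightarrow> h s \<in> nat_tuples d"
    and inj: "inj_on h S"
    and exponent_add: "s \<in> S \<Longrightarrow> t \<in> S \<Longrightarrow> h (s + t) = h s + h t"
    and axes: "\<exists>N. \<forall>n\<ge>N. \<forall>i<d. axis_tuple i n \<in> h ` S"
begin

abbreviation "\<A> \<equiv> fock_algebra S"

lemma zero_S: "0 \<in> S" and add_S: "s \<in> S \<Longrightarrow> t \<in> S \<Longrightarrow> s + t \<in> S"
  using cone by (auto simp: positive_cone_def)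

lemma exponent_zero: "h 0 = 0"
proof -
  have "h 0 + 0 = h 0 + h 0" using exponent_add[OF zero_S zero_S] by (simp only: add_0_right)
  then show ?thesis by (simp only: add_left_cancel)
qed

lemmas closed = fock_algebra_closed[OF cone]

definition mon :: "(nat \<Rightarrow> complex) \<Rightarrow> 'a \<Rightarrow> complex" where
  "mon z x = monom_at d z (h x)"

text \<open>The pairing of \<open>f\<close> with the reproducing kernel at \<open>z\<close>: the generating function of the entries of
  \<open>f\<close>.\<close>

definition transform :: "(nat \<Rightarrow> complex) \<Rightarrow> ('a \<Rightarrow> complex) \<Rightarrow> complex" where
  "transform z f = (\<Sum>\<^sub>\<infinity>x\<in>S. f x * mon z x)"

text \<open>Evaluation at \<open>z\<close> of the function that \<open>T\<close> represents; its Taylor coefficients are the entries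
  of \<open>T e\<^sub>0\<close>.\<close>

definition ev :: "(nat \<Rightarrow> complex) \<Rightarrow> 'a l2op \<Rightarrow> complex" where
  "ev z T = transform z (T (basis_vec 0))"

lemma mon_square_summable:
  assumes z: "z \<in> polydisc d"
  shows "(\<lambda>x. (cmod (mon z x))\<^sup>2) summable_on S"
proof -
  have "cmod (z i ^ 2) < 1" for i
    using polydisc_norm_less[OF z, of i] by (simp add: norm_power power_less_one_iff)
  then have "(\<lambda>x. cmod (monom_at d (\<lambda>i. z i ^ 2) x)) summable_on nat_tuples d"
    by (intro monom_at_abs_summable)
  then have "(\<lambda>x. cmod (monom_at d (\<lambda>i. z i ^ 2) x)) summable_on h ` S"
    by (rule summable_on_subset_banach) (use exponent in auto)
  then have "(\<lambda>x. cmod (monom_at d (\<lambda>i. z i ^ 2) (h x))) summable_on S"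
    using summable_on_reindex[OF inj, of "\<lambda>x. cmod (monom_at d (\<lambda>i. z i ^ 2) x)"]
    by (simp only: o_def)
  moreover have "cmod (monom_at d (\<lambda>i. z i ^ 2) (h x)) = (cmod (mon z x))\<^sup>2" for x
    by (simp add: mon_def monom_at_def norm_power[symmetric] prod_power_distrib power_mult[symmetric] mult.commute)
  ultimately show ?thesis by simp
qed

text \<open>The Cauchy-Schwarz inequality: \<open>C\<close> is the norm of the reproducing kernel at \<open>z\<close>.\<close>

lemma transform_bound:
  assumes z: "z \<in> polydisc d"
  obtains C where "C \<ge> 0"
    "\<And>f. f \<in> ell2 S \<Longrightarrow> (\<lambda>x. f x * mon z x) summable_on S"
    "\<And>f. f \<in> ell2 S \<Longrightarrow> cmod (transform z f) \<le> C * ell2_norm S f"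
proof -
  define C where "C = sqrt (\<Sum>\<^sub>\<infinity>x\<in>S. (cmod (mon z x))\<^sup>2)"
  have C0: "0 \<le> C" by (simp add: C_def infsum_nonneg)
  have fin: "(\<Sum>x\<in>F. norm (f x * mon z x)) \<le> C * ell2_norm S f"
    if f: "f \<in> ell2 S" and F: "finite F" "F \<subseteq> S" for f F
  proof -
    have m: "L2_set (\<lambda>x. cmod (mon z x)) F \<le> C"
      unfolding L2_set_def C_def
      by (intro real_sqrt_le_mono finite_sum_le_infsum mon_square_summable z F) auto
    have "(\<Sum>x\<in>F. norm (f x * mon z x)) = (\<Sum>x\<in>F. \<bar>cmod (f x)\<bar> * \<bar>cmod (mon z x)\<bar>)"
      by (simp add: norm_mult)
    also have "\<dots> \<le> L2_set (\<lambda>x. cmod (f x)) F * L2_set (\<lambda>x. cmod (mon z x)) F"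
      by (rule L2_set_mult_ineq)
    also have "\<dots> \<le> ell2_norm S f * C"
      by (intro mult_mono L2_set_le_ell2_norm f F m ell2_norm_nonneg L2_set_nonneg)
    finally show ?thesis by (simp add: mult.commute)
  qed
  have s: "(\<lambda>x. norm (f x * mon z x)) summable_on S" if f: "f \<in> ell2 S" for f
    using fin[OF f] by (intro nonneg_bdd_above_summable_on bdd_aboveI2[where M = "C * ell2_norm S f"]) auto
  show thesis
  proof (rule that[OF C0])
    fix f assume f: "f \<in> ell2 S"
    show "(\<lambda>x. f x * mon z x) summable_on S" by (rule abs_summable_summable[OF s[OF f]])
    have "cmod (transform z f) \<le> (\<Sum>\<^sub>\<infinity>x\<in>S. norm (f x * mon z x))"
      unfolding transform_def by (rule norm_infsum_bound[OF s[OF f]])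
    also have "\<dots> \<le> C * ell2_norm S f"
      by (intro infsum_le_finite_sums s f fin)
    finally show "cmod (transform z f) \<le> C * ell2_norm S f" .
  qed
qed

lemma transform_summable:
  "z \<in> polydisc d \<Longrightarrow> f \<in> ell2 S \<Longrightarrow> (\<lambda>x. f x * mon z x) summable_on S"
  using transform_bound by metis

lemma transform_add:
  assumes "z \<in> polydisc d" "f \<in> ell2 S" "g \<in> ell2 S"
  shows "transform z (f + g) = transform z f + transform z g"
  using infsum_add[OF transform_summable[OF assms(1,2)] transform_summable[OF assms(1,3)]]
  by (simp add: transform_def distrib_right)

lemma transform_scale:
  assumes "z \<in> polydisc d" "f \<in> ell2 S"
  shows "transform z (\<lambda>x. c * f x) = c * transform z f"
  using infsum_cmult_right[OF transform_summable[OF assms], of c]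
  by (simp add: transform_def mult.assoc)

lemma transform_basis_zero: "transform z (basis_vec 0) = 1"
proof -
  have "transform z (basis_vec 0) = (\<Sum>\<^sub>\<infinity>x\<in>{0}. basis_vec 0 x * mon z x)"
    unfolding transform_def using zero_S
    by (intro infsum_cong_neutral) (auto simp: basis_vec_def)
  then show ?thesis
    by (simp add: basis_vec_def mon_def exponent_zero monom_at_zero)
qed

lemma transform_fock:
  assumes s: "s \<in> S" and f: "f \<in> ell2 S"
  shows "transform z (fock S s f) = mon z s * transform z f"
proof -
  have bij: "bij_betw (\<lambda>x. x + s) S ((\<lambda>x. x + s) ` S)"
    by (simp add: bij_betw_def inj_on_def)
  have "transform z (fock S s f) = (\<Sum>\<^sub>\<infinity>x\<in>S. f (x - s) * mon z x)"
    using f by (simp add: transform_def fock_def)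
  also have "\<dots> = (\<Sum>\<^sub>\<infinity>x\<in>(\<lambda>x. x + s) ` S. f (x - s) * mon z x)"
  proof (rule infsum_cong_neutral)
    fix x assume "x \<in> S - (\<lambda>x. x + s) ` S"
    then have "x - s \<notin> S" by (metis DiffD2 diff_add_cancel image_eqI)
    then show "f (x - s) * mon z x = 0" using f by (simp add: ell2_def)
  qed (use add_S s in auto)
  also have "\<dots> = (\<Sum>\<^sub>\<infinity>x\<in>S. f x * mon z (x + s))"
    using infsum_reindex_bij_betw[OF bij, of "\<lambda>x. f (x - s) * mon z x"] by simp
  also have "\<dots> = (\<Sum>\<^sub>\<infinity>x\<in>S. mon z s * (f x * mon z x))"
    by (intro infsum_cong) (simp add: mon_def exponent_add s monom_at_add mult_ac)
  also have "\<dots> = mon z s * transform z f"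
    unfolding transform_def by (rule infsum_cmult_right')
  finally show ?thesis .
qed

lemma basis_zero: "basis_vec 0 \<in> ell2 S"
  by (rule basis_vec_ell2[OF zero_S])

lemma ev_fock: "s \<in> S \<Longrightarrow> ev z (fock S s) = mon z s"
  by (simp add: ev_def transform_fock basis_zero transform_basis_zero)

lemma op_norm_diff_bound:
  assumes "T \<in> \<A>" "U \<in> \<A>" "f \<in> ell2 S"
  shows "ell2_norm S (T f - U f) \<le> op_norm S (T - U) * ell2_norm S f"
  using op_norm_bound[OF closed(6)[OF closed(4)[OF assms(1,2)]] assms(3)] by simp

lemma transform_diff:
  assumes "z \<in> polydisc d" "f \<in> ell2 S" "g \<in> ell2 S"
  shows "transform z (f - g) = transform z f - transform z g"
proof -
  have "f - g = f + (\<lambda>x. -1 * g x)" by (auto simp: fun_eq_iff)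
  then have "transform z (f - g) = transform z f + transform z (\<lambda>x. -1 * g x)"
    using transform_add[OF assms(1,2) ell2_scale(1)[OF assms(3), of "-1"]] by (simp only:)
  also have "transform z (\<lambda>x. -1 * g x) = -1 * transform z g"
    by (rule transform_scale[OF assms(1,3)])
  finally show ?thesis by (simp only: mult_minus1 diff_conv_add_uminus)
qed

lemma transform_tendsto:
  assumes z: "z \<in> polydisc d" and X: "\<And>n. X n \<in> \<A>" and T: "T \<in> \<A>"
    and lim: "(\<lambda>n. op_norm S (X n - T)) \<longlonglongrightarrow> 0" and f: "f \<in> ell2 S"
  shows "(\<lambda>n. transform z (X n f)) \<longlonglongrightarrow> transform z (T f)"
proof -
  obtain C where C: "C \<ge> 0" "\<And>f. f \<in> ell2 S \<Longrightarrow> cmod (transform z f) \<le> C * ell2_norm S f"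
    using transform_bound[OF z] by metis
  note el = bounded_ops_range[OF closed(6)[OF X]] bounded_ops_range[OF closed(6)[OF T]]
  have bnd: "cmod (transform z (X n f) - transform z (T f)) \<le> C * (op_norm S (X n - T) * ell2_norm S f)" for n
  proof -
    have "cmod (transform z (X n f - T f)) \<le> C * ell2_norm S (X n f - T f)"
      by (intro C(2) ell2_diff el)
    also have "\<dots> \<le> C * (op_norm S (X n - T) * ell2_norm S f)"
      by (intro mult_left_mono op_norm_diff_bound X T f C(1))
    finally show ?thesis by (simp only: transform_diff[OF z el])
  qed
  have "(\<lambda>n. C * (op_norm S (X n - T) * ell2_norm S f)) \<longlonglongrightarrow> 0"
    using tendsto_mult_right_zero[OF tendsto_mult_left_zero[OF lim]] by simp
  then have "(\<lambda>n. transform z (X n f) - transform z (T f)) \<longlonglongrightarrow> 0"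
    by (rule Lim_null_comparison[OF always_eventually[OF allI[OF bnd]]])
  then show ?thesis by (rule LIM_zero_cancel)
qed

text \<open>The kernel at \<open>z\<close> is a joint eigenvector of the adjoints of the generators, hence of the adjoint
  of every element of the algebra; the eigenvalue is read off at \<open>e\<^sub>0\<close>.\<close>

lemma transform_apply:
  assumes z: "z \<in> polydisc d" and T: "T \<in> \<A>" and f: "f \<in> ell2 S"
  shows "transform z (T f) = ev z T * transform z f"
  using cone T f
proof (induction T arbitrary: f rule: fock_algebra_induct)
  case (fock s)
  then show ?case by (simp add: transform_fock ev_fock)
next
  case (add T U)
  note el = bounded_ops_range[OF closed(6)[OF add(1)]] bounded_ops_range[OF closed(6)[OF add(2)]]
  show ?case
    unfolding ev_def[of z "T + U"]
    by (subst plus_fun_apply, subst plus_fun_apply, subst transform_add[OF z el], subst transform_add[OF z el])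
       (simp only: add(3,4)[OF add(5)] ev_def distrib_right)
next
  case (scale c T)
  note el = bounded_ops_range[OF closed(6)[OF scale(1)]]
  show ?case
    unfolding ev_def[of z "op_scale c T"] unfolding op_scale_def
    by (subst transform_scale[OF z el], subst transform_scale[OF z el])
       (simp only: scale(2)[OF scale(3)] ev_def mult.assoc)
next
  case (comp T U)
  note el = bounded_ops_range[OF closed(6)[OF comp(2)]]
  show ?case
  proof -
    have "ev z (T \<circ> U) = ev z T * ev z U"
      using comp(3)[OF el[of "basis_vec 0"]] by (simp only: ev_def o_apply)
    moreover have "transform z ((T \<circ> U) f) = ev z T * transform z (U f)"
      using comp(3)[OF el[of f]] by (simp only: o_apply)
    ultimately show ?thesis by (simp only: comp(4)[OF comp(5)] mult.assoc)
  qed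
next
  case (limit X T)
  have "(\<lambda>n. transform z (X n f)) \<longlonglongrightarrow> transform z (T f)"
    by (rule transform_tendsto[OF z limit.hyps limit.prems])
  moreover have "(\<lambda>n. ev z (X n) * transform z f) \<longlonglongrightarrow> ev z T * transform z f"
    unfolding ev_def by (intro tendsto_intros transform_tendsto[OF z limit.hyps] basis_zero)
  ultimately show ?case
    using limit.IH[OF limit.prems] LIMSEQ_unique by (simp only:) blast
qed

lemma character_ev:
  assumes z: "z \<in> polydisc d"
  shows "character S (ev z)"
  unfolding character_def
proof (intro conjI ballI allI)
  show "ev z (fock S 0) = 1"
    by (simp add: ev_fock zero_S mon_def exponent_zero monom_at_zero)
  fix T assume T: "T \<in> \<A>"
  note eT = bounded_ops_range[OF closed(6)[OF T]]
  show "ev z (op_scale c T) = c * ev z T" for c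
    by (simp add: ev_def op_scale_def transform_scale[OF z eT])
  fix U assume U: "U \<in> \<A>"
  note eU = bounded_ops_range[OF closed(6)[OF U]]
  show "ev z (T + U) = ev z T + ev z U"
    by (simp add: ev_def transform_add[OF z eT eU])
  show "ev z (T \<circ> U) = ev z T * ev z U"
    using transform_apply[OF z T eU] by (simp add: ev_def)
qed

lemmas ev_add = characterD(2)[OF character_ev]
  and ev_scale = characterD(3)[OF character_ev]
  and ev_comp = characterD(4)[OF character_ev]

text \<open>Reads the entry of \<open>f\<close> at a prescribed exponent off its generating function. The entry is \<open>0\<close> at
  exponents outside \<open>h ` S\<close>, so a nonzero coefficient shows that the exponent belongs to \<open>S\<close>.\<close>

lemma transform_coefficient:
  assumes f: "f \<in> ell2 S"
    and eq: "\<And>z. z \<in> polydisc d \<Longrightarrow> transform z f = c * (\<Prod>j<d. u j (z j))"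
    and u: "\<And>j l. j < d \<Longrightarrow> cmod l < 1 \<Longrightarrow> (\<lambda>n. b j n * l ^ n) sums u j l"
    and x: "x \<in> nat_tuples d"
  shows "(if x \<in> h ` S then f (inv_into S h x) else 0) = c * (\<Prod>j<d. b j (x j))"
proof (rule product_coefficients[OF _ u x])
  fix z assume z: "z \<in> polydisc d"
  let ?A = "\<lambda>x. if x \<in> h ` S then f (inv_into S h x) else 0"
  have "((\<lambda>x. f x * mon z x) has_sum c * (\<Prod>j<d. u j (z j))) S"
    using has_sum_infsum[OF transform_summable[OF z f]] eq[OF z] by (simp add: transform_def)
  then have "((\<lambda>x. ?A x * monom_at d z x) \<circ> h has_sum c * (\<Prod>j<d. u j (z j))) S"
    by (rule has_sum_cong[THEN iffD1, rotated]) (simp add: mon_def inv_into_f_f[OF inj])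
  then have "((\<lambda>x. ?A x * monom_at d z x) has_sum c * (\<Prod>j<d. u j (z j))) (h ` S)"
    by (simp add: has_sum_reindex[OF inj])
  then show "((\<lambda>x. ?A x * monom_at d z x) has_sum c * (\<Prod>j<d. u j (z j))) (nat_tuples d)"
    by (rule has_sum_cong_neutral[THEN iffD1, rotated 3]) (use exponent in auto)
qed

text \<open>By \<open>transform_apply\<close>, the generating function of \<open>T f\<close> vanishes for every \<open>f\<close>.\<close>

lemma ev_injective:
  assumes T: "T \<in> \<A>" and 0: "\<And>z. z \<in> polydisc d \<Longrightarrow> ev z T = 0"
  shows "T = 0"
proof -
  have "T f x = 0" for f x
  proof (cases "f \<in> ell2 S \<and> x \<in> S")
    case True
    note e = bounded_ops_range[OF closed(6)[OF T], of f]
    have "(if h x \<in> h ` S then T f (inv_into S h (h x)) else 0) = 0 * (\<Prod>j<d. (\<lambda>_. 0) (h x j))"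
      using True T 0
      by (intro transform_coefficient[OF e, where u = "\<lambda>_ _. 0" and b = "\<lambda>_ _. 0"])
         (auto simp: transform_apply exponent)
    then show ?thesis using True inv_into_f_f[OF inj] by simp
  next
    case False
    have "T f \<in> ell2 S" "f \<notin> ell2 S \<Longrightarrow> T f = 0"
      using bounded_ops_range[OF closed(6)[OF T]] bounded_opsD(2)[OF closed(6)[OF T]] by auto
    then show ?thesis
    proof (cases "f \<in> ell2 S")
      case True
      then have "x \<notin> S" using False by blast
      then show ?thesis using \<open>T f \<in> ell2 S\<close> by (simp add: ell2_def)
    qed simp
  qed
  then show ?thesis by (auto simp: fun_eq_iff)
qed

lemma character_tendsto:
  assumes \<omega>: "character S \<omega>" and X: "\<And>n. X n \<in> \<A>" and T: "T \<in> \<A>"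
    and lim: "(\<lambda>n. op_norm S (X n - T)) \<longlonglongrightarrow> 0"
  shows "(\<lambda>n. \<omega> (X n)) \<longlonglongrightarrow> \<omega> T"
proof -
  have bnd: "cmod (\<omega> (X n) - \<omega> T) \<le> op_norm S (X n - T)" for n
    using character_le_op_norm[OF cone \<omega> closed(4)[OF X T]] character_diff[OF cone \<omega> X T] by simp
  have "(\<lambda>n. \<omega> (X n) - \<omega> T) \<longlonglongrightarrow> 0"
    by (rule Lim_null_comparison[OF always_eventually[OF allI[OF bnd]] lim])
  then show ?thesis by (rule LIM_zero_cancel)
qed

text \<open>Characters are contractive, so agreement on the generators passes to norm limits.\<close>

lemma character_eqI:
  assumes \<omega>: "character S \<omega>" and \<psi>: "character S \<psi>"
    and eq: "\<And>s. s \<in> S \<Longrightarrow> \<omega> (fock S s) = \<psi> (fock S s)" and T: "T \<in> \<A>"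
  shows "\<omega> T = \<psi> T"
  using cone T
proof (induction T rule: fock_algebra_induct)
  case (limit X T)
  then show ?case
    using character_tendsto[OF \<omega> limit.hyps] character_tendsto[OF \<psi> limit.hyps]
    by (auto intro: LIMSEQ_unique)
next
  case (add T U)
  then show ?case by (simp only: characterD(2)[OF \<omega>] characterD(2)[OF \<psi>])
next
  case (comp T U)
  then show ?case by (simp only: characterD(4)[OF \<omega>] characterD(4)[OF \<psi>])
qed (simp_all add: eq characterD(3)[OF \<omega>] characterD(3)[OF \<psi>])

lemma character_point:
  assumes \<omega>: "character S \<omega>"
  obtains w where "\<And>i. i \<ge> d \<Longrightarrow> w i = 0" "\<And>i. cmod (w i) \<le> 1" "\<And>s. s \<in> S \<Longrightarrow> \<omega> (fock S s) = mon w s"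
proof -
  obtain N where N: "\<And>n i. n \<ge> N \<Longrightarrow> i < d \<Longrightarrow> axis_tuple i n \<in> h ` S"
    using axes by blast
  define c where "c x = \<omega> (fock S (inv_into S h x))" for x
  have ch: "c (h s) = \<omega> (fock S s)" if "s \<in> S" for s
    using that by (simp add: c_def inv_into_f_f[OF inj])
  obtain w where w: "\<And>i. i \<ge> d \<Longrightarrow> w i = 0" "\<And>x. x \<in> h ` S \<Longrightarrow> c x = monom_at d w x"
  proof (rule monoid_character_is_monomial[of "h ` S" d N c])
    show "h ` S \<subseteq> nat_tuples d" using exponent by auto
    show "0 \<in> h ` S" using exponent_zero zero_S by (metis image_eqI)
    show "c 0 = 1" using ch[OF zero_S] \<omega> by (simp only: exponent_zero character_def)
    show "x + y \<in> h ` S" "c (x + y) = c x * c y" if xyS: "x \<in> h ` S" "y \<in> h ` S" for x y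
    proof -
      obtain s t where st: "s \<in> S" "t \<in> S" "x = h s" "y = h t" using xyS by blast
      have xy: "x + y = h (s + t)" using exponent_add st by simp
      then show "x + y \<in> h ` S" using add_S st by blast
      have "c (x + y) = \<omega> (fock S s \<circ> fock S t)"
        unfolding xy ch[OF add_S[OF st(1,2)]] fock_comp[OF cone st(1,2)] ..
      then show "c (x + y) = c x * c y"
        using st ch fock_in_fock_algebra characterD(4)[OF \<omega>] by metis
    qed
  qed (use N that in auto)
  have eq: "\<omega> (fock S s) = mon w s" if "s \<in> S" for s
    using w(2)[of "h s"] ch that by (simp add: mon_def)
  have "cmod (w i) \<le> 1" for i
  proof (cases "i < d")
    case True
    then obtain s where s: "s \<in> S" "axis_tuple i (Suc N) = h s" using N[of "Suc N" i] by auto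
    have "cmod (\<omega> (fock S s)) \<le> 1"
      using character_le_op_norm[OF cone \<omega> fock_in_fock_algebra[OF s(1)]]
        op_norm_fock_le_1[OF cone s(1)] by linarith
    then have "cmod (w i) ^ Suc N \<le> 1"
      using eq[OF s(1)] True s(2)[symmetric]
      by (simp only: mon_def monom_at_axis norm_power)
    then show ?thesis by (metis norm_ge_zero power_le_one_iff nat.distinct(1))
  qed (use w(1) in simp)
  with w(1) eq show thesis by (intro that)
qed

text \<open>Evaluations are contractive, so norm limits are uniform limits of functions on the polydisc.\<close>

lemma ev_holomorphic:
  assumes T: "T \<in> \<A>"
  shows "disc_holomorphic d (\<lambda>z. ev z T)"
  unfolding disc_holomorphic_def
proof (intro allI impI)
  fix y assume y: "analytic_disc d y"
  then have pd: "y l \<in> polydisc d" if "l \<in> ball 0 1" for l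
    using that by (simp add: analytic_disc_def)
  show "(\<lambda>l. ev (y l) T) holomorphic_on ball 0 1"
    using cone T
  proof (induction T rule: fock_algebra_induct)
    case (fock s)
    then show ?case
      using y by (auto simp: ev_fock mon_def monom_at_def analytic_disc_def intro!: holomorphic_intros)
  next
    case (add T U)
    have "(\<lambda>l. ev (y l) T + ev (y l) U) holomorphic_on ball 0 1"
      using add by (intro holomorphic_intros)
    then show ?case by (rule holomorphic_transform) (erule ev_add[symmetric, OF pd add.hyps])
  next
    case (scale c T)
    have "(\<lambda>l. c * ev (y l) T) holomorphic_on ball 0 1"
      using scale by (intro holomorphic_intros)
    then show ?case by (rule holomorphic_transform) (erule ev_scale[symmetric, OF pd scale.hyps])
  next
    case (comp T U)
    have "(\<lambda>l. ev (y l) T * ev (y l) U) holomorphic_on ball 0 1"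
      using comp by (intro holomorphic_intros)
    then show ?case by (rule holomorphic_transform) (erule ev_comp[symmetric, OF pd comp.hyps])
  next
    case (limit X T)
    have bound: "cmod (ev (y l) (X n) - ev (y l) T) \<le> op_norm S (X n - T)" if "l \<in> ball 0 1" for l n
      using character_le_op_norm[OF cone character_ev[OF pd[OF that]] closed(4)[OF limit.hyps(1,2)]]
        character_diff[OF cone character_ev[OF pd[OF that]] limit.hyps(1,2)] by simp
    have uni: "uniform_limit (ball 0 1) (\<lambda>n l. ev (y l) (X n)) (\<lambda>l. ev (y l) T) sequentially"
    proof (rule uniform_limitI)
      fix e :: real assume "e > 0"
      then have "\<forall>\<^sub>F n in sequentially. op_norm S (X n - T) < e"
        using limit.hyps(3) order_tendstoD(2) by blast
      then show "\<forall>\<^sub>F n in sequentially. \<forall>l\<in>ball 0 1. dist (ev (y l) (X n)) (ev (y l) T) < e"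
        by eventually_elim (use bound in \<open>fastforce simp: dist_norm intro: le_less_trans\<close>)
    qed
    show ?case
    proof (rule holomorphic_uniform_sequence[OF open_ball limit.IH])
      fix x :: complex assume "x \<in> ball 0 1"
      then obtain r where "r > 0" "cball x r \<subseteq> ball 0 1"
        using open_contains_cball open_ball by blast
      then show "\<exists>r>0. cball x r \<subseteq> ball 0 1 \<and>
          uniform_limit (cball x r) (\<lambda>n l. ev (y l) (X n)) (\<lambda>l. ev (y l) T) sequentially"
        using uniform_limit_on_subset[OF uni] by blast
    qed
  qed
qed

end

section \<open>Isomorphisms induce biholomorphic maps of polydiscs\<close>

lemma cone_multiple:
  assumes "positive_cone S" "s \<in> S"
  shows "(\<Sum>i<n::nat. s) \<in> S"
  using assms by (induction n) (auto simp: positive_cone_def)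

text \<open>The isomorphism from the seminormalization to \<open>\<int>\<^sub>+\<^sup>d\<close> restricts to \<open>S\<close>. The preimage of each unit
  vector lies in the seminormalization, which says that its large multiples lie in \<open>S\<close>.\<close>

lemma higher_rank_coordinates:
  assumes "higher_rank_numerical_semigroup S"
  obtains d h where "fock_coordinates S d h"
proof -
  let ?N = "seminormalization S"
  have S: "positive_cone S" using assms by (simp add: higher_rank_numerical_semigroup_def)
  obtain d h where h: "bij_betw h ?N (nat_tuples d)"
    and hadd: "\<And>s t. s \<in> ?N \<Longrightarrow> t \<in> ?N \<Longrightarrow> h (s + t) = h s + h t"
    using assms unfolding higher_rank_numerical_semigroup_def semigroup_isomorphic_def by blast
  have sub: "S \<subseteq> ?N"
    using cone_multiple[OF S] by (auto simp: seminormalization_def)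
  have N_add: "s + t \<in> ?N" if "s \<in> ?N" "t \<in> ?N" for s t
  proof -
    have "\<forall>\<^sub>F n in sequentially. (\<Sum>i<n. s) \<in> S" "\<forall>\<^sub>F n in sequentially. (\<Sum>i<n. t) \<in> S"
      using that by (auto simp: seminormalization_def)
    then have "\<forall>\<^sub>F n in sequentially. (\<Sum>i<n. s + t) \<in> S"
      by eventually_elim (use S in \<open>simp add: sum.distrib positive_cone_def\<close>)
    then show ?thesis by (simp add: seminormalization_def)
  qed
  have h0: "h 0 = 0"
  proof -
    have "0 \<in> ?N" using sub S by (auto simp: positive_cone_def)
    then have "h 0 + 0 = h 0 + h 0" using hadd[of 0 0] by (simp only: add_0_right)
    then show ?thesis by (simp only: add_left_cancel)
  qed
  have "\<exists>g\<in>?N. h g = axis_tuple i 1" if "i < d" for i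
  proof -
    have "axis_tuple i 1 \<in> nat_tuples d" using that by (auto simp: axis_tuple_def nat_tuples_def)
    then show ?thesis using h by (metis bij_betw_imp_surj_on imageE)
  qed
  then obtain g where g: "\<And>i. i < d \<Longrightarrow> g i \<in> ?N" "\<And>i. i < d \<Longrightarrow> h (g i) = axis_tuple i 1"
    by metis
  have gn: "(\<Sum>k<n. g i) \<in> ?N \<and> h (\<Sum>k<n. g i) = axis_tuple i n" if i: "i < d" for i n
  proof (induction n)
    case 0
    then show ?case using h0 sub S by (auto simp: axis_tuple_zero positive_cone_def)
  next
    case (Suc n)
    then have "h ((\<Sum>k<n. g i) + g i) = axis_tuple i (n + 1)"
      using hadd g i by (metis axis_tuple_add)
    then show ?case using N_add Suc g(1)[OF i] by simp
  qed
  have "\<forall>\<^sub>F n in sequentially. \<forall>i\<in>{..<d}. (\<Sum>k<n. g i) \<in> S"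
    using g(1) by (intro eventually_ball_finite) (auto simp: seminormalization_def)
  then obtain N :: nat where "\<forall>n\<ge>N. \<forall>i\<in>{..<d}. (\<Sum>k<n. g i) \<in> S"
    unfolding eventually_sequentially by blast
  then have "\<exists>N. \<forall>n\<ge>N. \<forall>i<d. axis_tuple i n \<in> h ` S"
    using gn by (intro exI[of _ N] allI impI) (metis image_eqI lessThan_iff)
  then have "fock_coordinates S d h"
    using S sub h hadd
    by unfold_locales (auto simp: subset_iff bij_betw_def intro: inj_on_subset)
  then show thesis by (rule that)
qed

lemma op_scale_zero: "op_scale 0 T = 0"
  by (auto simp: op_scale_def fun_eq_iff)

lemma algebra_isoD:
  assumes "algebra_iso A B \<phi>"
  shows "bij_betw \<phi> A B"
    and "T \<in> A \<Longrightarrow> U \<in> A \<Longrightarrow> \<phi> (T + U) = \<phi> T + \<phi> U"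
    and "T \<in> A \<Longrightarrow> \<phi> (op_scale c T) = op_scale c (\<phi> T)"
    and "T \<in> A \<Longrightarrow> U \<in> A \<Longrightarrow> \<phi> (T \<circ> U) = \<phi> T \<circ> \<phi> U"
    and "T \<in> A \<Longrightarrow> \<phi> T \<in> B"
  using assms unfolding algebra_iso_def by (blast dest: bij_betwE)+

lemma algebra_iso_inverse:
  assumes S: "positive_cone S" and iso: "algebra_iso (fock_algebra S) B \<phi>"
  shows "algebra_iso B (fock_algebra S) (inv_into (fock_algebra S) \<phi>)"
proof -
  let ?A = "fock_algebra S"
  let ?\<psi> = "inv_into ?A \<phi>"
  note iso' = algebra_isoD[OF iso]
  note closed = fock_algebra_closed[OF S]
  have \<psi>: "?\<psi> T \<in> ?A" "\<phi> (?\<psi> T) = T" if "T \<in> B" for T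
    using that iso'(1) by (auto simp: bij_betw_def inv_into_into f_inv_into_f)
  have eqI: "?\<psi> T = U" if "U \<in> ?A" "\<phi> U = T" for T U
    using that iso'(1) by (auto simp: bij_betw_def inv_into_f_eq)
  show ?thesis
    unfolding algebra_iso_def
  proof (intro conjI ballI allI)
    show "bij_betw ?\<psi> B ?A" by (rule bij_betw_inv_into[OF iso'(1)])
    fix T assume T: "T \<in> B"
    show "?\<psi> (op_scale c T) = op_scale c (?\<psi> T)" for c
      by (rule eqI[OF closed(2)[OF \<psi>(1)[OF T]]]) (simp only: iso'(3)[OF \<psi>(1)[OF T]] \<psi>(2)[OF T])
    fix U assume U: "U \<in> B"
    show "?\<psi> (T + U) = ?\<psi> T + ?\<psi> U"
      by (rule eqI[OF closed(1)[OF \<psi>(1)[OF T] \<psi>(1)[OF U]]])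
         (simp only: iso'(2)[OF \<psi>(1)[OF T] \<psi>(1)[OF U]] \<psi>(2)[OF T] \<psi>(2)[OF U])
    show "?\<psi> (T \<circ> U) = ?\<psi> T \<circ> ?\<psi> U"
      by (rule eqI[OF closed(3)[OF \<psi>(1)[OF T] \<psi>(1)[OF U]]])
         (simp only: iso'(4)[OF \<psi>(1)[OF T] \<psi>(1)[OF U]] \<psi>(2)[OF T] \<psi>(2)[OF U])
  qed
qed

text \<open>An algebra homomorphism need not be unital by definition, but a surjective one maps the unit to a unit.\<close>

lemma algebra_iso_unit:
  assumes S1: "positive_cone S1" and S2: "positive_cone S2"
    and iso: "algebra_iso (fock_algebra S1) (fock_algebra S2) \<phi>"
  shows "\<phi> (fock S1 0) = fock S2 0"
proof -
  have I: "fock S1 0 \<in> fock_algebra S1" "fock S2 0 \<in> fock_algebra S2"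
    using S1 S2 by (auto intro!: fock_in_fock_algebra simp: positive_cone_def)
  obtain X where X: "X \<in> fock_algebra S1" "\<phi> X = fock S2 0"
    using I(2) algebra_isoD(1)[OF iso] by (metis bij_betw_imp_surj_on imageE)
  have "\<phi> (fock S1 0) = \<phi> (fock S1 0) \<circ> fock S2 0"
    by (simp only: comp_fock_zero[OF fock_algebra_closed(6)[OF S2 algebra_isoD(5)[OF iso I(1)]]])
  also have "\<dots> = \<phi> (fock S1 0 \<circ> X)"
    using algebra_isoD(4)[OF iso I(1) X(1)] X(2) by simp
  also have "\<dots> = fock S2 0"
    using fock_zero_comp[OF fock_algebra_closed(6)[OF S1 X(1)]] X(2) by simp
  finally show ?thesis .
qed

lemma (in fock_coordinates) mon_injective:
  assumes z: "z \<in> polydisc d" and w: "w \<in> polydisc d"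
    and eq: "\<And>t. t \<in> S \<Longrightarrow> mon z t = mon w t"
  shows "z = w"
proof
  fix i
  obtain N where N: "\<And>n i. n \<ge> N \<Longrightarrow> i < d \<Longrightarrow> axis_tuple i n \<in> h ` S"
    using axes by blast
  show "z i = w i"
  proof (cases "i < d")
    case True
    have pw: "z i ^ n = w i ^ n" if "n \<ge> N" for n
    proof -
      obtain t where "t \<in> S" "axis_tuple i n = h t" using N[OF \<open>n \<ge> N\<close> True] by blast
      then show ?thesis using eq[of t] monom_at_axis[OF True] by (metis mon_def)
    qed
    show ?thesis
      by (rule eq_from_consecutive_powers[of "Suc N"]) (use pw[of "Suc N"] pw[of "Suc (Suc N)"] in auto)
  qed (use z w in \<open>simp add: polydisc_def\<close>)
qed

lemma maximum_attained_constant_polydisc: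
  assumes u: "disc_holomorphic d u" and le: "\<And>z. z \<in> polydisc d \<Longrightarrow> cmod (u z) \<le> 1"
    and z0: "z0 \<in> polydisc d" "cmod (u z0) = 1" and z: "z \<in> polydisc d"
  shows "u z = u z0"
proof -
  have const: "u w = u 0" if w: "w \<in> polydisc d" and max: "cmod (u w) = 1 \<or> cmod (u 0) = 1" for w
  proof -
    obtain r where r: "0 < r" "r < 1" "\<And>k. cmod (w k) \<le> r" using polydisc_radius[OF w] by blast
    define y where "y l k = (l / of_real r) * w k" for l :: complex and k
    have y: "analytic_disc d y" unfolding y_def[abs_def] by (rule radial_disc[OF w r(1,3)])
    have yr: "y (of_real r) = w" and y0: "y 0 = 0" using r by (auto simp: y_def fun_eq_iff)
    obtain p where p: "p \<in> ball 0 1" "cmod (u (y p)) = 1"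
      using max yr y0 r by (metis abs_of_pos centre_in_ball mem_ball_0 norm_of_real zero_less_one)
    have "(\<lambda>l. u (y l)) constant_on ball 0 1"
      using u y p le
      by (intro maximum_modulus_principle[where U = "ball 0 1" and \<xi> = p])
         (auto simp: disc_holomorphic_def analytic_disc_def)
    then have "u (y (of_real r)) = u (y 0)" using r unfolding constant_on_def by auto
    then show ?thesis by (simp only: yr y0)
  qed
  have "u z0 = u 0" using const z0 by blast
  moreover have "u z = u 0" using const[OF z] z0 calculation by metis
  ultimately show ?thesis by simp
qed

text \<open>The point \<open>f z\<close> represents the character \<open>T \<mapsto> ev z (\<phi> T)\<close>. Its coordinates are holomorphic in
  \<open>z\<close> because their high powers are. If one of them had modulus \<open>1\<close> somewhere, it would be a
  constant, and then some \<open>\<phi> V\<^sub>s\<close> with \<open>s \<noteq> 0\<close> would be scalar.\<close>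

lemma algebra_iso_point_map:
  assumes C1: "fock_coordinates S1 d1 h1" and C2: "fock_coordinates S2 d2 h2"
    and iso: "algebra_iso (fock_algebra S1) (fock_algebra S2) \<phi>"
  obtains f where "\<And>z. z \<in> polydisc d2 \<Longrightarrow> f z \<in> polydisc d1"
    "\<And>i. i < d1 \<Longrightarrow> disc_holomorphic d2 (\<lambda>z. f z i)"
    "\<And>z T. z \<in> polydisc d2 \<Longrightarrow> T \<in> fock_algebra S1 \<Longrightarrow>
        fock_coordinates.ev S2 d2 h2 z (\<phi> T) = fock_coordinates.ev S1 d1 h1 (f z) T"
proof -
  interpret A: fock_coordinates S1 d1 h1 by fact
  interpret B: fock_coordinates S2 d2 h2 by fact
  note iso' = algebra_isoD[OF iso]
  have ch: "character S1 (\<lambda>T. B.ev z (\<phi> T))" if z: "z \<in> polydisc d2" for z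
    unfolding character_def
  proof (intro conjI ballI allI)
    show "B.ev z (\<phi> (fock S1 0)) = 1"
      unfolding algebra_iso_unit[OF A.cone B.cone iso] by (rule characterD(1)[OF B.character_ev[OF z]])
    fix T assume T: "T \<in> A.\<A>"
    show "B.ev z (\<phi> (op_scale c T)) = c * B.ev z (\<phi> T)" for c
      by (simp only: iso'(3)[OF T] B.ev_scale[OF z iso'(5)[OF T]])
    fix U assume U: "U \<in> A.\<A>"
    show "B.ev z (\<phi> (T + U)) = B.ev z (\<phi> T) + B.ev z (\<phi> U)"
      by (simp only: iso'(2)[OF T U] B.ev_add[OF z iso'(5)[OF T] iso'(5)[OF U]])
    show "B.ev z (\<phi> (T \<circ> U)) = B.ev z (\<phi> T) * B.ev z (\<phi> U)"
      by (simp only: iso'(4)[OF T U] B.ev_comp[OF z iso'(5)[OF T] iso'(5)[OF U]])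
  qed
  have "\<forall>z\<in>polydisc d2. \<exists>w. (\<forall>i\<ge>d1. w i = 0) \<and> (\<forall>i. cmod (w i) \<le> 1) \<and>
      (\<forall>s\<in>S1. B.ev z (\<phi> (fock S1 s)) = A.mon w s)"
  proof
    fix z assume z: "z \<in> polydisc d2"
    show "\<exists>w. (\<forall>i\<ge>d1. w i = 0) \<and> (\<forall>i. cmod (w i) \<le> 1) \<and>
        (\<forall>s\<in>S1. B.ev z (\<phi> (fock S1 s)) = A.mon w s)"
    proof (rule A.character_point[OF ch[OF z]])
      fix w assume "\<And>i. d1 \<le> i \<Longrightarrow> w i = 0" "\<And>i. cmod (w i) \<le> 1"
        "\<And>s. s \<in> S1 \<Longrightarrow> B.ev z (\<phi> (fock S1 s)) = A.mon w s"
      then show ?thesis by (intro exI[of _ w]) simp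
    qed
  qed
  then obtain f where f: "\<And>z i. z \<in> polydisc d2 \<Longrightarrow> i \<ge> d1 \<Longrightarrow> f z i = 0"
      "\<And>z i. z \<in> polydisc d2 \<Longrightarrow> cmod (f z i) \<le> 1"
      "\<And>z s. z \<in> polydisc d2 \<Longrightarrow> s \<in> S1 \<Longrightarrow> B.ev z (\<phi> (fock S1 s)) = A.mon (f z) s"
    by metis
  obtain N where N: "\<And>n i. n \<ge> N \<Longrightarrow> i < d1 \<Longrightarrow> axis_tuple i n \<in> h1 ` S1"
    using A.axes by blast
  have power: "\<exists>s\<in>S1. h1 s = axis_tuple i n \<and>
      (\<forall>z\<in>polydisc d2. B.ev z (\<phi> (fock S1 s)) = f z i ^ n)" if i: "i < d1" and n: "n \<ge> N" for i n
  proof -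
    obtain s where s: "s \<in> S1" "axis_tuple i n = h1 s" using N[OF n i] by blast
    then show ?thesis
      using f(3) monom_at_axis[OF i] by (metis A.mon_def)
  qed
  have hol: "disc_holomorphic d2 (\<lambda>z. f z i)" if i: "i < d1" for i
    unfolding disc_holomorphic_def
  proof (intro allI impI)
    fix y assume y: "analytic_disc d2 y"
    have pw: "(\<lambda>l. f (y l) i ^ n) holomorphic_on ball 0 1" if n: "n \<ge> N" for n
    proof -
      obtain s where s: "s \<in> S1" "\<And>z. z \<in> polydisc d2 \<Longrightarrow> B.ev z (\<phi> (fock S1 s)) = f z i ^ n"
        using power[OF i n] by blast
      have "(\<lambda>l. B.ev (y l) (\<phi> (fock S1 s))) holomorphic_on ball 0 1"
        using B.ev_holomorphic[OF iso'(5)[OF fock_in_fock_algebra[OF s(1)]]] y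
        by (auto simp: disc_holomorphic_def)
      then show ?thesis
        by (rule holomorphic_transform) (use s(2) y in \<open>auto simp: analytic_disc_def\<close>)
    qed
    show "(\<lambda>l. f (y l) i) holomorphic_on ball 0 1"
      by (rule holomorphic_from_consecutive_powers[OF open_ball _ pw[of "Suc N"] pw[of "Suc (Suc N)"]]) auto
  qed
  have interior: "cmod (f z0 i) < 1" if z0: "z0 \<in> polydisc d2" and i: "i < d1" for z0 i
  proof (rule ccontr)
    assume "\<not> cmod (f z0 i) < 1"
    then have one: "cmod (f z0 i) = 1" using f(2)[OF z0, of i] by simp
    have const: "f z i = f z0 i" if z: "z \<in> polydisc d2" for z
      using maximum_attained_constant_polydisc[OF hol[OF i] f(2) z0 one z] .
    \<comment> \<open>The exponent \<open>Suc N\<close> is positive, so that the element \<open>s\<close> below is not \<open>0\<close>.\<close>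
    define c where "c = f z0 i ^ Suc N"
    obtain s where s: "s \<in> S1" "h1 s = axis_tuple i (Suc N)"
      "\<And>z. z \<in> polydisc d2 \<Longrightarrow> B.ev z (\<phi> (fock S1 s)) = f z i ^ Suc N"
      using power[OF i, of "Suc N"] by auto
    note I = fock_in_fock_algebra[OF A.zero_S]
    note V = fock_in_fock_algebra[OF s(1)]
    note D = A.closed(4)[OF V A.closed(2)[OF I, of c]]
    have "\<phi> (fock S1 s - op_scale c (fock S1 0)) = 0"
    proof (rule B.ev_injective[OF iso'(5)[OF D]])
      fix z assume z: "z \<in> polydisc d2"
      have "B.ev z (\<phi> (fock S1 s - op_scale c (fock S1 0))) =
          B.ev z (\<phi> (fock S1 s)) - c * B.ev z (\<phi> (fock S1 0))"
        unfolding character_diff[OF A.cone ch[OF z] V A.closed(2)[OF I]]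
          characterD(3)[OF ch[OF z] I] ..
      also have "\<dots> = 0"
        using s(3)[OF z] const[OF z] characterD(1)[OF ch[OF z]] by (simp add: c_def)
      finally show "B.ev z (\<phi> (fock S1 s - op_scale c (fock S1 0))) = 0" .
    qed
    moreover have "\<phi> 0 = 0"
      using iso'(3)[OF I, of 0] by (simp only: op_scale_zero)
    ultimately have "\<phi> (fock S1 s - op_scale c (fock S1 0)) = \<phi> 0" by (simp only:)
    then have "fock S1 s - op_scale c (fock S1 0) = 0"
      using inj_onD[OF bij_betw_imp_inj_on[OF iso'(1)] _ D A.closed(5)[OF I]] by blast
    then have "(fock S1 s - op_scale c (fock S1 0)) (basis_vec 0) s = 0"
      by (simp only:) simp
    moreover have "s \<noteq> 0"
    proof
      assume "s = 0"
      then have "axis_tuple i (Suc N) i = 0" using s(2) A.exponent_zero by simp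
      then show False by (simp add: axis_tuple_def)
    qed
    ultimately show False
      using fock_basis_vec[OF A.zero_S, of s] fock_basis_vec[OF A.zero_S, of 0]
      by (simp add: op_scale_def basis_vec_def)
  qed
  have pd: "f z \<in> polydisc d1" if "z \<in> polydisc d2" for z
    using f(1)[OF that] interior[OF that] by (simp add: polydisc_def)
  show thesis
  proof (rule that[OF pd hol])
    fix z T assume z: "z \<in> polydisc d2" and T: "T \<in> A.\<A>"
    show "B.ev z (\<phi> T) = A.ev (f z) T"
      by (rule A.character_eqI[OF ch[OF z] A.character_ev[OF pd[OF z]] _ T])
         (simp add: f(3)[OF z] A.ev_fock)
  qed
qed

lemma holomorphic_power_series_at_zero:
  assumes "u holomorphic_on ball 0 1" "cmod l < 1"
  shows "(\<lambda>n. (deriv ^^ n) u 0 / fact n * l ^ n) sums u l"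
  using holomorphic_power_series[OF assms(1), of l] assms(2) by simp

lemma algebra_iso_splits_coordinates:
  assumes C1: "fock_coordinates S1 d1 h1" and C2: "fock_coordinates S2 d2 h2"
    and iso: "algebra_iso (fock_algebra S1) (fock_algebra S2) \<phi>"
  obtains p m where "bij_betw p {..<d2} {..<d1}"
    "\<And>j. j < d2 \<Longrightarrow> m j holomorphic_on ball 0 1"
    "\<And>j. j < d2 \<Longrightarrow> deriv (m j) 0 \<noteq> 0"
    "\<And>j. j < d2 \<Longrightarrow> m j 0 = 0 \<Longrightarrow> \<exists>c. c \<noteq> 0 \<and> (\<forall>l. cmod l < 1 \<longrightarrow> m j l = c * l)"
    "\<And>s z. s \<in> S1 \<Longrightarrow> z \<in> polydisc d2 \<Longrightarrow>
       fock_coordinates.ev S2 d2 h2 z (\<phi> (fock S1 s)) = (\<Prod>j<d2. m j (z j) ^ h1 s (p j))"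
proof -
  interpret A: fock_coordinates S1 d1 h1 by fact
  interpret B: fock_coordinates S2 d2 h2 by fact
  define \<psi> where "\<psi> = inv_into A.\<A> \<phi>"
  have iso': "algebra_iso B.\<A> A.\<A> \<psi>"
    unfolding \<psi>_def by (rule algebra_iso_inverse[OF A.cone iso])
  have \<phi>\<psi>: "\<phi> (\<psi> T) = T" if "T \<in> B.\<A>" for T
    using that algebra_isoD(1)[OF iso] unfolding \<psi>_def by (simp add: bij_betw_def f_inv_into_f)
  have \<psi>\<phi>: "\<psi> (\<phi> T) = T" if "T \<in> A.\<A>" for T
    using that algebra_isoD(1)[OF iso] unfolding \<psi>_def by (simp add: bij_betw_def)
  obtain f where f: "\<And>z. z \<in> polydisc d2 \<Longrightarrow> f z \<in> polydisc d1"
      "\<And>i. i < d1 \<Longrightarrow> disc_holomorphic d2 (\<lambda>z. f z i)"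
    and ef: "\<And>z T. z \<in> polydisc d2 \<Longrightarrow> T \<in> A.\<A> \<Longrightarrow> B.ev z (\<phi> T) = A.ev (f z) T"
    by (rule algebra_iso_point_map[OF C1 C2 iso]) blast
  obtain g where g: "\<And>z. z \<in> polydisc d1 \<Longrightarrow> g z \<in> polydisc d2"
      "\<And>i. i < d2 \<Longrightarrow> disc_holomorphic d1 (\<lambda>z. g z i)"
    and eg: "\<And>z T. z \<in> polydisc d1 \<Longrightarrow> T \<in> B.\<A> \<Longrightarrow> A.ev z (\<psi> T) = B.ev (g z) T"
    by (rule algebra_iso_point_map[OF C2 C1 iso']) blast
  have gf: "g (f z) = z" if z: "z \<in> polydisc d2" for z
  proof (rule B.mon_injective[OF g(1)[OF f(1)[OF z]] z])
    fix t assume t: "t \<in> S2"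
    note V = fock_in_fock_algebra[OF t]
    have "B.ev (g (f z)) (fock S2 t) = B.ev z (\<phi> (\<psi> (fock S2 t)))"
      by (simp only: eg[OF f(1)[OF z] V] ef[OF z algebra_isoD(5)[OF iso' V]])
    then show "B.mon (g (f z)) t = B.mon z t"
      by (simp only: \<phi>\<psi>[OF V] B.ev_fock[OF t])
  qed
  have fg: "f (g z) = z" if z: "z \<in> polydisc d1" for z
  proof (rule A.mon_injective[OF f(1)[OF g(1)[OF z]] z])
    fix t assume t: "t \<in> S1"
    note V = fock_in_fock_algebra[OF t]
    have "A.ev (f (g z)) (fock S1 t) = A.ev z (\<psi> (\<phi> (fock S1 t)))"
      by (simp only: ef[OF g(1)[OF z] V] eg[OF z algebra_isoD(5)[OF iso V]])
    then show "A.mon (f (g z)) t = A.mon z t"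
      by (simp only: \<psi>\<phi>[OF V] A.ev_fock[OF t])
  qed
  show thesis
  proof (rule polydisc_biholomorphism_splits[OF f g gf fg])
    fix p m assume pm: "bij_betw p {..<d2} {..<d1}"
    "\<And>j. j < d2 \<Longrightarrow> m j holomorphic_on ball 0 1"
    "\<And>j. j < d2 \<Longrightarrow> deriv (m j) 0 \<noteq> 0"
    "\<And>j z. j < d2 \<Longrightarrow> z \<in> polydisc d2 \<Longrightarrow> f z (p j) = m j (z j)"
    "\<And>j. j < d2 \<Longrightarrow> m j 0 = 0 \<Longrightarrow> \<exists>c. c \<noteq> 0 \<and> (\<forall>l. cmod l < 1 \<longrightarrow> m j l = c * l)"
    show thesis
    proof (rule that[OF pm(1,2,3,5)])
      fix s z assume s: "s \<in> S1" and z: "z \<in> polydisc d2"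
      have "B.ev z (\<phi> (fock S1 s)) = (\<Prod>i<d1. f z i ^ h1 s i)"
        by (simp only: ef[OF z fock_in_fock_algebra[OF s]] A.ev_fock[OF s] A.mon_def monom_at_def)
      also have "\<dots> = (\<Prod>j<d2. f z (p j) ^ h1 s (p j))"
        using prod.reindex_bij_betw[OF pm(1), of "\<lambda>i. f z i ^ h1 s i"] by simp
      also have "\<dots> = (\<Prod>j<d2. m j (z j) ^ h1 s (p j))"
        using pm(4)[OF _ z] by (intro prod.cong) auto
      finally show "B.ev z (\<phi> (fock S1 s)) = (\<Prod>j<d2. m j (z j) ^ h1 s (p j))" .
    qed
  qed
qed

text \<open>Exponents of \<open>S\<^sub>2\<close> are detected as nonzero Taylor coefficients of products of powers of the disc
  automorphisms \<open>m\<^sub>j\<close>. The coefficient at \<open>(h1 s (p j))\<^sub>j\<close> itself may vanish when some \<open>m\<^sub>j\<close> moves the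
  origin: already the quadratic coefficient of the square of such an \<open>m\<^sub>j\<close> can be zero. Hence the
  detour through the exponent \<open>k\<close> below and the unit vectors.\<close>

lemma exponents_transfer:
  assumes C1: "fock_coordinates S1 d1 h1" and C2: "fock_coordinates S2 d2 h2"
    and iso: "algebra_iso (fock_algebra S1) (fock_algebra S2) \<phi>"
  obtains p where "bij_betw p {..<d2} {..<d1}"
    "\<And>s. s \<in> S1 \<Longrightarrow> (\<lambda>j. if j < d2 then h1 s (p j) else 0) \<in> h2 ` S2"
proof -
  interpret A: fock_coordinates S1 d1 h1 by fact
  interpret B: fock_coordinates S2 d2 h2 by fact
  obtain p m where p: "bij_betw p {..<d2} {..<d1}"
    and mhol: "\<And>j. j < d2 \<Longrightarrow> m j holomorphic_on ball 0 1"
    and mderiv: "\<And>j. j < d2 \<Longrightarrow> deriv (m j) 0 \<noteq> 0"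
    and mlin: "\<And>j. j < d2 \<Longrightarrow> m j 0 = 0 \<Longrightarrow> \<exists>c. c \<noteq> 0 \<and> (\<forall>l. cmod l < 1 \<longrightarrow> m j l = c * l)"
    and prod: "\<And>s z. s \<in> S1 \<Longrightarrow> z \<in> polydisc d2 \<Longrightarrow>
       B.ev z (\<phi> (fock S1 s)) = (\<Prod>j<d2. m j (z j) ^ h1 s (p j))"
    by (rule algebra_iso_splits_coordinates[OF C1 C2 iso]) blast
  have member: "k \<in> h2 ` S2"
    if s: "s \<in> S1" and k: "k \<in> nat_tuples d2"
      and b: "\<And>j. j < d2 \<Longrightarrow> \<exists>b. (\<forall>l. cmod l < 1 \<longrightarrow> (\<lambda>n. b n * l ^ n) sums (m j l ^ h1 s (p j))) \<and> b (k j) \<noteq> 0"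
    for s k
  proof -
    obtain b where b: "\<And>j. j < d2 \<Longrightarrow> (\<forall>l. cmod l < 1 \<longrightarrow> (\<lambda>n. b j n * l ^ n) sums (m j l ^ h1 s (p j))) \<and> b j (k j) \<noteq> 0"
      using b by metis
    let ?F = "\<phi> (fock S1 s) (basis_vec 0)"
    have F: "?F \<in> ell2 S2"
      by (rule bounded_ops_range[OF B.closed(6)[OF algebra_isoD(5)[OF iso fock_in_fock_algebra[OF s]]]])
    have "(if k \<in> h2 ` S2 then ?F (inv_into S2 h2 k) else 0) = 1 * (\<Prod>j<d2. b j (k j))"
      using prod[OF s] b k
      by (intro B.transform_coefficient[OF F, where u = "\<lambda>j l. m j l ^ h1 s (p j)"])
         (auto simp: B.ev_def)
    moreover have "(\<Prod>j<d2. b j (k j)) \<noteq> 0" using b by auto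
    ultimately show ?thesis by (auto split: if_splits)
  qed
  have const_series: "\<exists>b. (\<forall>l. cmod l < 1 \<longrightarrow> (\<lambda>n. b n * l ^ n) sums (u l ^ 0)) \<and> b 0 \<noteq> (0 :: complex)"
    for u :: "complex \<Rightarrow> complex"
  proof (intro exI[of _ "\<lambda>n. if n = 0 then 1 else 0"] conjI allI impI)
    fix l :: complex
    show "(\<lambda>n. (if n = 0 then 1 else 0) * l ^ n) sums (u l ^ 0)"
      using sums_finite[of "{0}" "\<lambda>n. (if n = 0 then 1 else 0) * l ^ n"] by simp
  qed simp
  \<comment> \<open>The function \<open>(m j (z j)) ^ Suc N\<close> has the linear coefficient \<open>Suc N * deriv (m j) 0 * m j 0 ^ N\<close>.\<close>
  have unit_axis: "axis_tuple j 1 \<in> h2 ` S2" if j: "j < d2" and mj: "m j 0 \<noteq> 0" for j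
  proof -
    obtain N where N: "\<And>n i. n \<ge> N \<Longrightarrow> i < d1 \<Longrightarrow> axis_tuple i n \<in> h1 ` S1"
      using A.axes by blast
    have "p j < d1" using p j by (auto simp: bij_betw_def)
    then obtain s where s: "s \<in> S1" "h1 s = axis_tuple (p j) (Suc N)"
      using N[of "Suc N" "p j"] by (metis imageE le_SucI order_refl)
    show ?thesis
    proof (rule member[OF s(1)])
      show "axis_tuple j 1 \<in> nat_tuples d2" using j by (auto simp: axis_tuple_def nat_tuples_def)
      fix i assume i: "i < d2"
      show "\<exists>b. (\<forall>l. cmod l < 1 \<longrightarrow> (\<lambda>n. b n * l ^ n) sums (m i l ^ h1 s (p i))) \<and> b (axis_tuple j 1 i) \<noteq> 0"
      proof (cases "i = j")
        case False
        then have "p i \<noteq> p j" using p i j by (auto simp: bij_betw_def inj_on_def)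
        then show ?thesis
          using const_series[of "m i"] False by (simp add: s(2) axis_tuple_def)
      next
        case True
        let ?u = "\<lambda>l. m j l ^ Suc N"
        have hol: "?u holomorphic_on ball 0 1" using mhol[OF j] by (intro holomorphic_intros)
        have "(m j has_field_derivative deriv (m j) 0) (at 0)"
          by (rule holomorphic_derivI[OF mhol[OF j]]) auto
        from DERIV_imp_deriv[OF DERIV_power[OF this, of "Suc N"]]
        have "deriv ?u 0 = of_nat (Suc N) * (deriv (m j) 0 * m j 0 ^ N)"
          by simp
        then have "deriv ?u 0 \<noteq> 0" using mderiv[OF j] mj by (simp del: of_nat_Suc)
        then show ?thesis
          using holomorphic_power_series_at_zero[OF hol] True s(2)
          by (intro exI[of _ "\<lambda>n. (deriv ^^ n) ?u 0 / fact n"]) (simp add: axis_tuple_def)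
      qed
    qed
  qed
  have K_add: "x + y \<in> h2 ` S2" if xy: "x \<in> h2 ` S2" "y \<in> h2 ` S2" for x y
  proof -
    obtain s t where "s \<in> S2" "t \<in> S2" "x = h2 s" "y = h2 t" using xy by blast
    then have "x + y = h2 (s + t)" "s + t \<in> S2" using B.exponent_add B.add_S by auto
    then show ?thesis by blast
  qed
  have K0: "0 \<in> h2 ` S2" using B.exponent_zero B.zero_S by (metis image_eqI)
  have axis_mult: "axis_tuple j n \<in> h2 ` S2" if "j < d2" "m j 0 \<noteq> 0" for j n
  proof (induction n)
    case (Suc n)
    show ?case using K_add[OF unit_axis[OF that] Suc] by (simp add: axis_tuple_add)
  qed (simp only: axis_tuple_zero K0)
  show thesis
  proof (rule that[OF p])
    fix s assume s: "s \<in> S1"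
    \<comment> \<open>In a coordinate with \<open>m j 0 \<noteq> 0\<close> the constant coefficient is nonzero, otherwise \<open>m j\<close> is linear.\<close>
    define k where "k j = (if j < d2 \<and> m j 0 = 0 then h1 s (p j) else 0)" for j
    have k: "k \<in> h2 ` S2"
    proof (rule member[OF s])
      show "k \<in> nat_tuples d2" by (auto simp: k_def nat_tuples_def)
      fix j assume j: "j < d2"
      let ?e = "h1 s (p j)"
      show "\<exists>b. (\<forall>l. cmod l < 1 \<longrightarrow> (\<lambda>n. b n * l ^ n) sums (m j l ^ ?e)) \<and> b (k j) \<noteq> 0"
      proof (cases "m j 0 = 0")
        case True
        then obtain c where c: "c \<noteq> 0" "\<And>l. cmod l < 1 \<Longrightarrow> m j l = c * l" using mlin[OF j] by blast
        show ?thesis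
        proof (intro exI[of _ "\<lambda>n. if n = ?e then c ^ ?e else 0"] conjI allI impI)
          fix l :: complex assume "cmod l < 1"
          then show "(\<lambda>n. (if n = ?e then c ^ ?e else 0) * l ^ n) sums (m j l ^ ?e)"
            using sums_finite[of "{?e}" "\<lambda>n. (if n = ?e then c ^ ?e else 0) * l ^ n"] c(2)
            by (simp add: power_mult_distrib)
        qed (use c True j in \<open>simp add: k_def\<close>)
      next
        case False
        let ?u = "\<lambda>l. m j l ^ ?e"
        have hol: "?u holomorphic_on ball 0 1" using mhol[OF j] by (intro holomorphic_intros)
        show ?thesis
          using holomorphic_power_series_at_zero[OF hol] False
          by (intro exI[of _ "\<lambda>n. (deriv ^^ n) ?u 0 / fact n"]) (simp add: k_def)
      qed
    qed
    \<comment> \<open>The missing multiples of unit vectors are added one coordinate at a time.\<close>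
    have "(\<lambda>j. if j < n then h1 s (p j) else k j) \<in> h2 ` S2" if "n \<le> d2" for n
      using that
    proof (induction n)
      case 0
      then show ?case using k by simp
    next
      case (Suc n)
      let ?t = "\<lambda>n j. if j < n then h1 s (p j) else k j"
      show ?case
      proof (cases "m n 0 = 0")
        case True
        then have "?t (Suc n) = ?t n" using Suc.prems by (auto simp: k_def fun_eq_iff less_Suc_eq)
        then show ?thesis using Suc by simp
      next
        case False
        then have "?t (Suc n) = ?t n + axis_tuple n (h1 s (p n))"
          by (auto simp: k_def fun_eq_iff less_Suc_eq axis_tuple_def)
        moreover have "?t n + axis_tuple n (h1 s (p n)) \<in> h2 ` S2"
          using Suc False by (intro K_add axis_mult) auto
        ultimately show ?thesis by (simp only:)
      qed
    qed
    moreover have "(\<lambda>j. if j < d2 then h1 s (p j) else k j) = (\<lambda>j. if j < d2 then h1 s (p j) else 0)"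
      by (auto simp: k_def)
    ultimately show "(\<lambda>j. if j < d2 then h1 s (p j) else 0) \<in> h2 ` S2"
      by (metis order_refl)
  qed
qed

section \<open>Comparing the semigroups\<close>

definition reindex :: "nat \<Rightarrow> (nat \<Rightarrow> nat) \<Rightarrow> (nat \<Rightarrow> nat) \<Rightarrow> nat \<Rightarrow> nat" where
  "reindex d p x = (\<lambda>j. if j < d then x (p j) else 0)"

lemma reindex_inj_on:
  assumes "bij_betw p {..<d} {..<d}"
  shows "inj_on (reindex d p) (nat_tuples d)"
proof (rule inj_onI, rule ext)
  fix x y i assume xy: "x \<in> nat_tuples d" "y \<in> nat_tuples d" "reindex d p x = reindex d p y"
  show "x i = y i"
  proof (cases "i < d")
    case True
    then obtain j where "j < d" "i = p j" using assms by (auto simp: bij_betw_def)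
    then show ?thesis using fun_cong[OF xy(3), of j] by (simp add: reindex_def)
  qed (use xy in \<open>auto simp: nat_tuples_def\<close>)
qed

lemma reindex_degree:
  assumes "bij_betw p {..<d} {..<d}"
  shows "(\<Sum>j<d. reindex d p x j) = (\<Sum>j<d. x j)"
  using sum.reindex_bij_betw[OF assms, of x] by (simp add: reindex_def)

lemma finite_tuples_of_degree: "finite {x \<in> nat_tuples d. (\<Sum>j<d. x j) = n}"
proof (rule finite_subset)
  show "{x \<in> nat_tuples d. (\<Sum>j<d. x j) = n} \<subseteq>
      {x. \<forall>j. (j \<in> {..<d} \<longrightarrow> x j \<in> {..n}) \<and> (j \<notin> {..<d} \<longrightarrow> x j = 0)}"
    by (auto simp: nat_tuples_def intro: member_le_sum)
  show "finite \<dots>" by (rule finite_set_of_finite_funs) auto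
qed

text \<open>Permuting coordinates preserves the degree, and there are finitely many tuples of each degree, so
  injections in both directions force equal cardinalities in each degree.\<close>

lemma mutual_reindex_surj:
  assumes K: "K1 \<subseteq> nat_tuples d" "K2 \<subseteq> nat_tuples d"
    and p: "bij_betw p {..<d} {..<d}" "reindex d p ` K1 \<subseteq> K2"
    and q: "bij_betw q {..<d} {..<d}" "reindex d q ` K2 \<subseteq> K1"
  shows "reindex d p ` K1 = K2"
proof -
  have deg: "reindex d p ` {x \<in> K1. (\<Sum>j<d. x j) = n} = {x \<in> K2. (\<Sum>j<d. x j) = n}" for n
  proof (rule card_subset_eq)
    let ?K1 = "{x \<in> K1. (\<Sum>j<d. x j) = n}" and ?K2 = "{x \<in> K2. (\<Sum>j<d. x j) = n}"
    have fin: "finite ?K1" "finite ?K2"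
      using K by (auto intro: finite_subset[OF _ finite_tuples_of_degree[of d n]])
    show "finite ?K2" by fact
    show sub: "reindex d p ` ?K1 \<subseteq> ?K2" using p by (auto simp: reindex_degree)
    have sub': "reindex d q ` ?K2 \<subseteq> ?K1" using q by (auto simp: reindex_degree)
    have ip: "inj_on (reindex d p) ?K1" and iq: "inj_on (reindex d q) ?K2"
      using K p q by (auto intro: inj_on_subset[OF reindex_inj_on])
    have "card ?K2 \<le> card ?K1" by (rule card_inj_on_le[OF iq sub' fin(1)])
    moreover have "card ?K1 \<le> card ?K2" by (rule card_inj_on_le[OF ip sub fin(2)])
    ultimately show "card (reindex d p ` ?K1) = card ?K2" by (simp add: card_image[OF ip])
  qed
  have "x \<in> reindex d p ` K1" if "x \<in> K2" for x
    using deg[of "\<Sum>j<d. x j"] that by blast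
  then show ?thesis using p(2) by blast
qed

lemma algebra_iso_imp_semigroup_isomorphic:
  assumes C1: "fock_coordinates S1 d1 h1" and C2: "fock_coordinates S2 d2 h2"
    and iso: "algebra_iso (fock_algebra S1) (fock_algebra S2) \<phi>"
  shows "semigroup_isomorphic S1 S2"
proof -
  interpret A: fock_coordinates S1 d1 h1 by fact
  interpret B: fock_coordinates S2 d2 h2 by fact
  obtain p where p: "bij_betw p {..<d2} {..<d1}"
    and pK: "\<And>s. s \<in> S1 \<Longrightarrow> reindex d2 p (h1 s) \<in> h2 ` S2"
    using exponents_transfer[OF C1 C2 iso] unfolding reindex_def by metis
  obtain q where q: "bij_betw q {..<d1} {..<d2}"
    and qK: "\<And>s. s \<in> S2 \<Longrightarrow> reindex d1 q (h2 s) \<in> h1 ` S1"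
    using exponents_transfer[OF C2 C1 algebra_iso_inverse[OF A.cone iso]] unfolding reindex_def by metis
  have d: "d1 = d2" using bij_betw_same_card[OF p] by simp
  let ?\<tau> = "reindex d2 p"
  have surj: "?\<tau> ` (h1 ` S1) = h2 ` S2"
    using A.exponent B.exponent p q pK qK
    by (intro mutual_reindex_surj[of _ _ _ _ q]) (auto simp: d)
  have "inj_on ?\<tau> (h1 ` S1)"
    using A.exponent p by (intro inj_on_subset[OF reindex_inj_on]) (auto simp: d)
  then have "bij_betw ?\<tau> (h1 ` S1) (h2 ` S2)" using surj by (simp add: bij_betw_def)
  moreover have "bij_betw h1 S1 (h1 ` S1)" "bij_betw h2 S2 (h2 ` S2)"
    using A.inj B.inj by (simp_all add: bij_betw_def)
  ultimately have bij: "bij_betw (inv_into S2 h2 \<circ> (?\<tau> \<circ> h1)) S1 S2"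
    by (intro bij_betw_trans[of _ _ "h2 ` S2"] bij_betw_trans[of _ _ "h1 ` S1"] bij_betw_inv_into)
  define k where "k = inv_into S2 h2 \<circ> (?\<tau> \<circ> h1)"
  have k: "k s \<in> S2" "h2 (k s) = ?\<tau> (h1 s)" if "s \<in> S1" for s
    using pK[OF that] by (auto simp: k_def inv_into_into f_inv_into_f)
  have "k (s + t) = k s + k t" if st: "s \<in> S1" "t \<in> S1" for s t
  proof (rule inj_onD[OF B.inj _ k(1)[OF A.add_S[OF st]] B.add_S[OF k(1)[OF st(1)] k(1)[OF st(2)]]])
    have "?\<tau> (h1 s + h1 t) = ?\<tau> (h1 s) + ?\<tau> (h1 t)" by (auto simp: reindex_def fun_eq_iff)
    then show "h2 (k (s + t)) = h2 (k s + k t)"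
      by (simp only: k(2)[OF A.add_S[OF st]] B.exponent_add[OF k(1)[OF st(1)] k(1)[OF st(2)]]
          k(2)[OF st(1)] k(2)[OF st(2)] A.exponent_add[OF st])
  qed
  then show ?thesis
    using bij unfolding semigroup_isomorphic_def k_def by blast
qed

section \<open>Isomorphic semigroups have completely isometrically isomorphic algebras\<close>

text \<open>Both directions of the isomorphism are parameters, which makes the situation symmetric: every
  statement about one direction also holds for the other by interpretation.\<close>

locale cone_isomorphism =
  fixes S1 :: "'a::ab_group_add set" and S2 :: "'b::ab_group_add set"
    and k :: "'a \<Rightarrow> 'b" and k' :: "'b \<Rightarrow> 'a"
  assumes cone1: "positive_cone S1" and cone2: "positive_cone S2"
    and k: "s \<in> S1 \<Longrightarrow> k s \<in> S2" "s \<in> S1 \<Longrightarrow> k' (k s) = s"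
    and k': "y \<in> S2 \<Longrightarrow> k' y \<in> S1" "y \<in> S2 \<Longrightarrow> k (k' y) = y"
    and k_add: "s \<in> S1 \<Longrightarrow> t \<in> S1 \<Longrightarrow> k (s + t) = k s + k t"
begin

lemma cone_isomorphism_sym: "cone_isomorphism S2 S1 k' k"
proof
  fix s t assume st: "s \<in> S2" "t \<in> S2"
  have "k' (s + t) = k' (k (k' s + k' t))" using st k' by (simp add: k_add)
  also have "\<dots> = k' s + k' t"
    using st k'(1) cone1 by (intro k(2)) (simp add: positive_cone_def)
  finally show "k' (s + t) = k' s + k' t" .
qed (use cone1 cone2 k k' in auto)

definition push :: "('a \<Rightarrow> complex) \<Rightarrow> 'b \<Rightarrow> complex" where
  "push f = (\<lambda>y. if y \<in> S2 then f (k' y) else 0)"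

definition pull :: "('b \<Rightarrow> complex) \<Rightarrow> 'a \<Rightarrow> complex" where
  "pull f = (\<lambda>x. if x \<in> S1 then f (k x) else 0)"

text \<open>Conjugation by the unitary \<open>push\<close>, with value \<open>0\<close> outside \<open>\<ell>\<^sup>2(S\<^sub>2)\<close> as required of a bounded
  operator.\<close>

definition conjugate :: "'a l2op \<Rightarrow> 'b l2op" where
  "conjugate T = (\<lambda>f. if f \<in> ell2 S2 then push (T (pull f)) else 0)"

lemma push_ell2:
  assumes "f \<in> ell2 S1"
  shows "push f \<in> ell2 S2" "ell2_norm S2 (push f) = ell2_norm S1 f"
proof -
  have bij: "bij_betw k' S2 S1" by (rule bij_betwI[of _ _ _ k]) (use k k' in auto)
  have "(\<lambda>y. (cmod (f (k' y)))\<^sup>2) summable_on S2 \<longleftrightarrow> (\<lambda>x. (cmod (f x))\<^sup>2) summable_on S1"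
    by (rule summable_on_reindex_bij_betw[OF bij])
  moreover have "(\<lambda>y. (cmod (push f y))\<^sup>2) summable_on S2 \<longleftrightarrow> (\<lambda>y. (cmod (f (k' y)))\<^sup>2) summable_on S2"
    by (rule summable_on_cong) (simp add: push_def)
  ultimately show "push f \<in> ell2 S2" using assms by (simp add: ell2_def) (simp add: push_def)
  have "(\<Sum>\<^sub>\<infinity>y\<in>S2. (cmod (push f y))\<^sup>2) = (\<Sum>\<^sub>\<infinity>y\<in>S2. (cmod (f (k' y)))\<^sup>2)"
    by (rule infsum_cong) (simp add: push_def)
  also have "\<dots> = (\<Sum>\<^sub>\<infinity>x\<in>S1. (cmod (f x))\<^sup>2)"
    by (rule infsum_reindex_bij_betw[OF bij])
  finally show "ell2_norm S2 (push f) = ell2_norm S1 f" by (simp add: ell2_norm_def)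
qed

lemma pull_ell2:
  assumes "f \<in> ell2 S2"
  shows "pull f \<in> ell2 S1" "ell2_norm S1 (pull f) = ell2_norm S2 f"
proof -
  interpret inv: cone_isomorphism S2 S1 k' k by (rule cone_isomorphism_sym)
  show "pull f \<in> ell2 S1" "ell2_norm S1 (pull f) = ell2_norm S2 f"
    using inv.push_ell2[OF assms] by (simp_all add: pull_def inv.push_def)
qed

lemma pull_push: "f \<in> ell2 S1 \<Longrightarrow> pull (push f) = f"
  using k by (auto simp: pull_def push_def ell2_def fun_eq_iff)

lemma push_linear:
  "push (f + g) = push f + push g" "push (f - g) = push f - push g"
  "push (\<lambda>x. c * f x) = (\<lambda>y. c * push f y)" "push 0 = 0"
  "push (\<Sum>j\<in>J. F j) = (\<Sum>j\<in>J. push (F j))"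
proof -
  show add: "push (f + g) = push f + push g" for f g by (auto simp: push_def fun_eq_iff)
  show zero: "push 0 = 0" by (auto simp: push_def fun_eq_iff)
  show "push (\<Sum>j\<in>J. F j) = (\<Sum>j\<in>J. push (F j))"
    by (induction J rule: infinite_finite_induct) (simp_all only: sum.infinite sum.empty sum.insert zero add simp_thms)
qed (auto simp: push_def fun_eq_iff)

lemma pull_linear:
  "pull (f + g) = pull f + pull g" "pull (\<lambda>x. c * f x) = (\<lambda>y. c * pull f y)" "pull 0 = 0"
  by (auto simp: pull_def fun_eq_iff)

lemma conjugate_apply: "f \<in> ell2 S2 \<Longrightarrow> conjugate T f = push (T (pull f))"
  by (simp add: conjugate_def)

lemma conjugate_bounded:
  assumes T: "T \<in> bounded_ops S1"
  shows "conjugate T \<in> bounded_ops S2" "op_norm S2 (conjugate T) \<le> op_norm S1 T"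
proof -
  note T' = bounded_opsD[OF T] bounded_ops_range[OF T]
  have bound: "ell2_norm S2 (conjugate T f) \<le> op_norm S1 T * ell2_norm S2 f" if f: "f \<in> ell2 S2" for f
    using op_norm_bound[OF T pull_ell2(1)[OF f]]
    by (simp add: conjugate_apply[OF f] push_ell2(2)[OF T'(5)] pull_ell2(2)[OF f])
  show "conjugate T \<in> bounded_ops S2"
    unfolding bounded_ops_def
  proof (intro CollectI conjI ballI allI impI)
    show "conjugate T f \<in> ell2 S2" if "f \<in> ell2 S2" for f
      unfolding conjugate_apply[OF that] by (rule push_ell2(1)[OF T'(5)])
    show "conjugate T f = 0" if "f \<notin> ell2 S2" for f using that by (simp add: conjugate_def)
    show "conjugate T (f + g) = conjugate T f + conjugate T g" if f: "f \<in> ell2 S2" and g: "g \<in> ell2 S2" for f g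
      by (simp only: conjugate_apply[OF ell2_add(1)[OF f g]] conjugate_apply[OF f] conjugate_apply[OF g]
          pull_linear T'(3)[OF pull_ell2(1)[OF f] pull_ell2(1)[OF g]] push_linear)
    show "conjugate T (\<lambda>x. c * f x) = (\<lambda>x. c * conjugate T f x)" if f: "f \<in> ell2 S2" for c f
      by (simp only: conjugate_apply[OF ell2_scale(1)[OF f]] conjugate_apply[OF f]
          pull_linear T'(4)[OF pull_ell2(1)[OF f]] push_linear)
    show "\<exists>K. \<forall>f\<in>ell2 S2. ell2_norm S2 (conjugate T f) \<le> K * ell2_norm S2 f" using bound by blast
  qed
  show "op_norm S2 (conjugate T) \<le> op_norm S1 T"
    by (rule op_norm_le[OF bound op_norm_nonneg[OF T]])
qed

lemma conjugate_add: "conjugate (T + U) = conjugate T + conjugate U"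
  and conjugate_diff: "conjugate (T - U) = conjugate T - conjugate U"
  and conjugate_scale: "conjugate (op_scale c T) = op_scale c (conjugate T)"
  by (auto simp: conjugate_def op_scale_def push_def fun_eq_iff)

lemma conjugate_comp:
  assumes T: "T \<in> bounded_ops S1" and U: "U \<in> bounded_ops S1"
  shows "conjugate (T \<circ> U) = conjugate T \<circ> conjugate U"
proof
  fix f show "conjugate (T \<circ> U) f = (conjugate T \<circ> conjugate U) f"
  proof (cases "f \<in> ell2 S2")
    case True
    note e = bounded_ops_range[OF U, of "pull f"]
    show ?thesis
      by (simp only: o_apply conjugate_apply[OF True] conjugate_apply[OF push_ell2(1)[OF e]] pull_push[OF e])
  next
    case False
    have "conjugate T 0 = 0" by (rule bounded_ops_apply_zero[OF conjugate_bounded(1)[OF T]])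
    then show ?thesis using False by (simp only: o_apply conjugate_def if_False)
  qed
qed

lemma conjugate_fock:
  assumes s: "s \<in> S1"
  shows "conjugate (fock S1 s) = fock S2 (k s)"
proof
  interpret inv: cone_isomorphism S2 S1 k' k by (rule cone_isomorphism_sym)
  fix f show "conjugate (fock S1 s) f = fock S2 (k s) f"
  proof (cases "f \<in> ell2 S2")
    case True
    have "push (\<lambda>x. pull f (x - s)) y = f (y - k s)" for y
    proof (cases "y \<in> S2")
      case y: True
      show ?thesis
      proof (cases "k' y - s \<in> S1")
        case True
        have "k (k' y - s) + k s = y" using k_add[OF True s] k'(2)[OF y] by simp
        then have "k (k' y - s) = y - k s" by (simp add: eq_diff_eq)
        then show ?thesis using True y by (simp add: push_def pull_def)
      next
        case False
        have "y - k s \<notin> S2"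
        proof
          assume "y - k s \<in> S2"
          then have "k' (y - k s) + s = k' y" "k' (y - k s) \<in> S1"
            using inv.k_add[of "y - k s" "k s"] k(1,2)[OF s] k'(1) by auto
          then show False using False by (metis add_diff_cancel_right')
        qed
        then show ?thesis using False y True \<open>f \<in> ell2 S2\<close> by (simp add: push_def pull_def ell2_def)
      qed
    next
      case False
      have "y - k s \<notin> S2"
      proof
        assume "y - k s \<in> S2"
        then have "(y - k s) + k s \<in> S2" using k(1)[OF s] cone2 unfolding positive_cone_def by blast
        then show False using False by simp
      qed
      then show ?thesis using False \<open>f \<in> ell2 S2\<close> by (simp add: push_def ell2_def)
    qed
    then show ?thesis
      using True by (simp add: conjugate_apply fock_def pull_ell2(1) fun_eq_iff)
  qed (simp add: conjugate_def fock_def)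
qed

text \<open>Conjugation is contractive and carries generators to generators, so it respects every operation
  that builds the algebra.\<close>

lemma conjugate_fock_algebra:
  assumes "T \<in> fock_algebra S1"
  shows "conjugate T \<in> fock_algebra S2"
  using cone1 assms
proof (induction T rule: fock_algebra_induct)
  case (fock s)
  then show ?case unfolding conjugate_fock[OF fock] by (intro fock_in_fock_algebra k(1))
next
  case (add T U)
  then show ?case unfolding conjugate_add by (intro fock_algebra_closed(1)[OF cone2])
next
  case (scale c T)
  then show ?case unfolding conjugate_scale by (intro fock_algebra_closed(2)[OF cone2])
next
  case (comp T U)
  note TU = comp.hyps[THEN fock_algebra_closed(6)[OF cone1]]
  show ?case unfolding conjugate_comp[OF TU] by (rule fock_algebra_closed(3)[OF cone2 comp.IH])
next
  case (limit X T)
  note closed = fock_algebra_closed[OF cone1]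
  note D = closed(6)[OF closed(4)[OF limit.hyps(1,2)]]
  show ?case
  proof (rule fock_algebra_limit[OF conjugate_bounded(1)[OF closed(6)[OF limit.hyps(2)]] limit.IH])
    have up: "op_norm S2 (conjugate (X n) - conjugate T) \<le> op_norm S1 (X n - T)" for n
      using conjugate_bounded(2)[OF D[of n]] by (simp only: conjugate_diff)
    have lo: "0 \<le> op_norm S2 (conjugate (X n) - conjugate T)" for n
      using op_norm_nonneg[OF conjugate_bounded(1)[OF D[of n]]] by (simp only: conjugate_diff)
    show "(\<lambda>n. op_norm S2 (conjugate (X n) - conjugate T)) \<longlonglongrightarrow> 0"
      by (rule tendsto_sandwich[OF always_eventually[OF allI[OF lo]] always_eventually[OF allI[OF up]]
            tendsto_const limit.hyps(3)])
  qed
qed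

lemma conjugate_inverse:
  assumes T: "T \<in> bounded_ops S1"
  shows "cone_isomorphism.conjugate S2 S1 k' k (conjugate T) = T"
proof
  interpret inv: cone_isomorphism S2 S1 k' k by (rule cone_isomorphism_sym)
  have eq: "inv.push = pull" "inv.pull = push"
    by (auto simp: fun_eq_iff inv.push_def inv.pull_def push_def pull_def)
  fix f show "inv.conjugate (conjugate T) f = T f"
  proof (cases "f \<in> ell2 S1")
    case True
    show ?thesis
      by (simp only: inv.conjugate_apply[OF True] eq conjugate_apply[OF push_ell2(1)[OF True]]
          pull_push[OF True] pull_push[OF bounded_ops_range[OF T]])
  qed (simp add: inv.conjugate_def bounded_opsD(2)[OF T])
qed

text \<open>The substitution \<open>G j = pull (F j)\<close> turns a value of one supremum into an equal value of the
  other. The entries of \<open>N\<close> are related to those of \<open>M\<close> only by a hypothesis, so that the roles of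
  the two matrices can be exchanged.\<close>

lemma conjugate_matrix_subset:
  assumes M: "\<And>i j. i < n \<Longrightarrow> j < n \<Longrightarrow> M i j \<in> bounded_ops S1"
    and N: "\<And>i j. i < n \<Longrightarrow> j < n \<Longrightarrow> N i j = conjugate (M i j)"
  shows "{sqrt (\<Sum>i<n. (ell2_norm S2 (\<Sum>j<n. N i j (F j)))\<^sup>2) | F.
            (\<forall>j<n. F j \<in> ell2 S2) \<and> sqrt (\<Sum>j<n. (ell2_norm S2 (F j))\<^sup>2) \<le> 1}
       \<subseteq> {sqrt (\<Sum>i<n. (ell2_norm S1 (\<Sum>j<n. M i j (F j)))\<^sup>2) | F.
            (\<forall>j<n. F j \<in> ell2 S1) \<and> sqrt (\<Sum>j<n. (ell2_norm S1 (F j))\<^sup>2) \<le> 1}"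
proof
  fix t assume "t \<in> {sqrt (\<Sum>i<n. (ell2_norm S2 (\<Sum>j<n. N i j (F j)))\<^sup>2) | F.
            (\<forall>j<n. F j \<in> ell2 S2) \<and> sqrt (\<Sum>j<n. (ell2_norm S2 (F j))\<^sup>2) \<le> 1}"
  then obtain F where F: "t = sqrt (\<Sum>i<n. (ell2_norm S2 (\<Sum>j<n. N i j (F j)))\<^sup>2)"
    "\<And>j. j < n \<Longrightarrow> F j \<in> ell2 S2" "sqrt (\<Sum>j<n. (ell2_norm S2 (F j))\<^sup>2) \<le> 1"
    by blast
  define G where "G j = pull (F j)" for j
  have row: "ell2_norm S2 (\<Sum>j<n. N i j (F j)) = ell2_norm S1 (\<Sum>j<n. M i j (G j))" if i: "i < n" for i
  proof -
    have "(\<Sum>j<n. N i j (F j)) = (\<Sum>j<n. push (M i j (G j)))"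
      using i by (intro sum.cong) (auto simp: N conjugate_apply F(2) G_def)
    also have "\<dots> = push (\<Sum>j<n. M i j (G j))" by (simp only: push_linear)
    finally have eq: "(\<Sum>j<n. N i j (F j)) = push (\<Sum>j<n. M i j (G j))" .
    have "(\<Sum>j<n. M i j (G j)) \<in> ell2 S1"
      using ell2_norm_sum[of "{..<n}" "\<lambda>j. M i j (G j)" S1] bounded_ops_range[OF M[OF i]] by simp
    then show ?thesis unfolding eq by (rule push_ell2(2))
  qed
  have "t = sqrt (\<Sum>i<n. (ell2_norm S1 (\<Sum>j<n. M i j (G j)))\<^sup>2)"
    unfolding F(1) by (intro arg_cong[of _ _ sqrt] sum.cong) (auto simp: row)
  moreover have "\<forall>j<n. G j \<in> ell2 S1" using F(2) by (auto simp: G_def pull_ell2)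
  moreover have "sqrt (\<Sum>j<n. (ell2_norm S1 (G j))\<^sup>2) \<le> 1"
    using F(2,3) by (simp add: G_def pull_ell2(2))
  ultimately show "t \<in> {sqrt (\<Sum>i<n. (ell2_norm S1 (\<Sum>j<n. M i j (F j)))\<^sup>2) | F.
            (\<forall>j<n. F j \<in> ell2 S1) \<and> sqrt (\<Sum>j<n. (ell2_norm S1 (F j))\<^sup>2) \<le> 1}"
    by blast
qed

lemma conjugate_algebra_iso:
  "algebra_iso (fock_algebra S1) (fock_algebra S2) conjugate"
proof -
  interpret inv: cone_isomorphism S2 S1 k' k by (rule cone_isomorphism_sym)
  note B1 = fock_algebra_closed(6)[OF cone1] and B2 = fock_algebra_closed(6)[OF cone2]
  have "bij_betw conjugate (fock_algebra S1) (fock_algebra S2)"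
    by (rule bij_betwI[of _ _ _ inv.conjugate])
       (auto simp: conjugate_fock_algebra inv.conjugate_fock_algebra conjugate_inverse[OF B1]
          inv.conjugate_inverse[OF B2])
  then show ?thesis
    unfolding algebra_iso_def
    by (intro conjI ballI allI conjugate_add conjugate_scale conjugate_comp B1)
qed

lemma conjugate_completely_isometric:
  "completely_isometric S1 S2 (fock_algebra S1) conjugate"
  unfolding completely_isometric_def
proof (intro allI impI)
  interpret inv: cone_isomorphism S2 S1 k' k by (rule cone_isomorphism_sym)
  fix n and M :: "nat \<Rightarrow> nat \<Rightarrow> 'a l2op"
  assume "\<forall>i<n. \<forall>j<n. M i j \<in> fock_algebra S1"
  then have M: "M i j \<in> bounded_ops S1" if "i < n" "j < n" for i j
    using that fock_algebra_closed(6)[OF cone1] by blast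
  show "matrix_op_norm S2 n (\<lambda>i j. conjugate (M i j)) = matrix_op_norm S1 n M"
    unfolding matrix_op_norm_def
    by (intro arg_cong[of _ _ Sup] equalityI conjugate_matrix_subset inv.conjugate_matrix_subset)
       (simp_all add: M conjugate_bounded(1) conjugate_inverse)
qed

end

lemma semigroup_isomorphic_imp_completely_isometric:
  assumes S1: "positive_cone S1" and S2: "positive_cone S2" and iso: "semigroup_isomorphic S1 S2"
  shows "\<exists>\<phi>. algebra_iso (fock_algebra S1) (fock_algebra S2) \<phi> \<and>
    completely_isometric S1 S2 (fock_algebra S1) \<phi>"
proof -
  obtain k where k: "bij_betw k S1 S2" "\<And>s t. s \<in> S1 \<Longrightarrow> t \<in> S1 \<Longrightarrow> k (s + t) = k s + k t"
    using iso unfolding semigroup_isomorphic_def by blast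
  interpret cone_isomorphism S1 S2 k "inv_into S1 k"
    using S1 S2 k by unfold_locales (auto simp: bij_betw_def inv_into_into f_inv_into_f)
  show ?thesis using conjugate_algebra_iso conjugate_completely_isometric by blast
qed


section \<open>The isomorphism theorem\<close>

theorem theorem3p8:
  fixes S1 :: "'a::ab_group_add set" and S2 :: "'b::ab_group_add set"
  assumes "higher_rank_numerical_semigroup S1"
    and "higher_rank_numerical_semigroup S2"
  shows "(semigroup_isomorphic S1 S2 \<longleftrightarrow>
           (\<exists>\<phi>. algebra_iso (fock_algebra S1) (fock_algebra S2) \<phi> \<and>
                completely_isometric S1 S2 (fock_algebra S1) \<phi>)) \<and>
         ((\<exists>\<phi>. algebra_iso (fock_algebra S1) (fock_algebra S2) \<phi> \<and>
                completely_isometric S1 S2 (fock_algebra S1) \<phi>) \<longleftrightarrow>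
           (\<exists>\<phi>. algebra_iso (fock_algebra S1) (fock_algebra S2) \<phi>))"
proof -
  have S1: "positive_cone S1" and S2: "positive_cone S2"
    using assms by (simp_all add: higher_rank_numerical_semigroup_def)
  obtain d1 h1 where C1: "fock_coordinates S1 d1 h1"
    using higher_rank_coordinates[OF assms(1)] by blast
  obtain d2 h2 where C2: "fock_coordinates S2 d2 h2"
    using higher_rank_coordinates[OF assms(2)] by blast
  show ?thesis
    using semigroup_isomorphic_imp_completely_isometric[OF S1 S2]
      algebra_iso_imp_semigroup_isomorphic[OF C1 C2] by blast
qed

end
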